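(* Let $M$ be a complete two-dimensional Riemannian manifold and let $\mathcal{N}\subset M$ be a neighborhood with compact closure. Let $R>0$ be such that the Gaussian curvature of $M$ on $\mathcal{N}$ is bounded above by $1/R^2$. Let $ABC$ be a geodesic triangle contained in $\mathcal{N}$ (and in a neighborhood $\mathcal{U}\subseteq\mathcal{N}$ as described in the context). If the three angles of $ABC$ each measure less than $2\pi/3$ and the maximum geodesic distance between two points in the domain of the triangle is less than $R\pi/2$, then there exists a balanced point of the triangle $ABC$.
   Context: Standing assumption: $\mathcal{U}$ is a neighborhood of a point of the surface $M$, homeomorphic to an open disk in $\mathbb{R}^2$, such that for any two points $P,Q\in\mathcal{U}$ there is exactly one geodesic from $P$ to $Q$ lying inside $\mathcal{U}$, and it is the shortest curve in $M$ connecting them. This geodesic is denoted $\gamma_{P,Q}$, and $d(P,Q)$ is the geodesic distance in $M$ (the length of the shortest curve joining $P$ and $Q$). For points $P,X,Q$ in $\mathcal{U}$ with $X\neq P,Q$, the angle $\angle PXQ$ is the smaller of the two angles in $T_XM$ between the tangent vectors at $X$ of $\gamma_{X,P}$ and $\gamma_{X,Q}$; $m(\angle PXQ)\in[0,\pi]$ is its measure. The triangle $ABC$ has distinct vertices $A,B,C\in\mathcal{U}$ and sides $\gamma_{A,B},\gamma_{B,C},\gamma_{C,A}$; its domain is the closed region in $\mathcal{U}$ bounded by the three sides. A balanced point of the triangle $ABC$ is a point $T$ lying inside the triangle such that $m(\angle ATB)=m(\angle BTC)=m(\angle CTA)=2\pi/3$. *)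

theory Defs
  imports "HOL-Analysis.Analysis"
begin

section \<open>Smooth maps between Euclidean spaces\<close>

text \<open>Intended for open \<open>S\<close>; as the domain is finite-dimensional, continuity of all iterated
  directional derivatives is the usual notion of class \<open>C\<^sup>k\<close>.\<close>

primrec Ck_on :: "nat \<Rightarrow> 'a::euclidean_space set \<Rightarrow> ('a \<Rightarrow> 'b::real_normed_vector) \<Rightarrow> bool" where
  "Ck_on 0 S f \<longleftrightarrow> continuous_on S f"
| "Ck_on (Suc k) S f \<longleftrightarrow>
     f differentiable_on S \<and> (\<forall>v. Ck_on k S (\<lambda>x. frechet_derivative f (at x) v))"

definition smooth_on :: "'a::euclidean_space set \<Rightarrow> ('a \<Rightarrow> 'b::real_normed_vector) \<Rightarrow> bool" where
  "smooth_on S f \<longleftrightarrow> (\<forall>k. Ck_on k S f)"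


section \<open>Riemannian surfaces\<close>

text \<open>A chart is a pair of a coordinate domain and a coordinate map. The manifold is the union
  of the chart domains, with the subspace topology. The metric is given by its coefficient
  matrix in each chart, as a function of the coordinates.\<close>

type_synonym 'a chart = "'a set \<times> ('a \<Rightarrow> real^2)"

abbreviation cdom :: "'a chart \<Rightarrow> 'a set" where "cdom \<kappa> \<equiv> fst \<kappa>"
abbreviation cmap :: "'a chart \<Rightarrow> 'a \<Rightarrow> real^2" where "cmap \<kappa> \<equiv> snd \<kappa>"
abbreviation cinv :: "'a chart \<Rightarrow> real^2 \<Rightarrow> 'a" where "cinv \<kappa> \<equiv> inv_into (cdom \<kappa>) (cmap \<kappa>)"

record 'a surface =
  charts :: "'a chart set"
  metric :: "'a chart \<Rightarrow> real^2 \<Rightarrow> real^2^2"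

definition carrier :: "'a surface \<Rightarrow> 'a set" where
  "carrier M = (\<Union>\<kappa>\<in>charts M. cdom \<kappa>)"

definition transition :: "'a chart \<Rightarrow> 'a chart \<Rightarrow> real^2 \<Rightarrow> real^2" where
  "transition \<kappa> \<kappa>' = cmap \<kappa>' \<circ> cinv \<kappa>"

definition riemannian_surface ::
    "'a::{t2_space,second_countable_topology} surface \<Rightarrow> bool" where
  "riemannian_surface M \<longleftrightarrow>
    (\<forall>\<kappa>\<in>charts M.
        open (cdom \<kappa>) \<and> open (cmap \<kappa> ` cdom \<kappa>) \<and>
        homeomorphism (cdom \<kappa>) (cmap \<kappa> ` cdom \<kappa>) (cmap \<kappa>) (cinv \<kappa>)) \<and>
    (\<forall>\<kappa>\<in>charts M. \<forall>\<kappa>'\<in>charts M.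
        smooth_on (cmap \<kappa> ` (cdom \<kappa> \<inter> cdom \<kappa>')) (transition \<kappa> \<kappa>')) \<and>
    (\<forall>\<kappa>\<in>charts M.
        smooth_on (cmap \<kappa> ` cdom \<kappa>) (metric M \<kappa>) \<and>
        (\<forall>x\<in>cmap \<kappa> ` cdom \<kappa>.
           transpose (metric M \<kappa> x) = metric M \<kappa> x \<and>
           (\<forall>v. v \<noteq> 0 \<longrightarrow> 0 < v \<bullet> (metric M \<kappa> x *v v)))) \<and>
    (\<forall>\<kappa>\<in>charts M. \<forall>\<kappa>'\<in>charts M. \<forall>x\<in>cmap \<kappa> ` (cdom \<kappa> \<inter> cdom \<kappa>'). \<forall>u v.
        u \<bullet> (metric M \<kappa> x *v v) =
        (let D = frechet_derivative (transition \<kappa> \<kappa>') (at x)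
         in D u \<bullet> (metric M \<kappa>' (transition \<kappa> \<kappa>' x) *v D v)))"

text \<open>Quantities at a point which do not depend on the chart (the inner product of two tangent
  vectors, the Gaussian curvature) are computed in an arbitrarily chosen chart around it.\<close>

definition chart_at :: "'a surface \<Rightarrow> 'a \<Rightarrow> 'a chart" where
  "chart_at M p = (SOME \<kappa>. \<kappa> \<in> charts M \<and> p \<in> cdom \<kappa>)"

definition inner_at :: "'a surface \<Rightarrow> 'a \<Rightarrow> real^2 \<Rightarrow> real^2 \<Rightarrow> real" where
  "inner_at M p u v =
    (let \<kappa> = chart_at M p in u \<bullet> (metric M \<kappa> (cmap \<kappa> p) *v v))"

definition norm_at :: "'a surface \<Rightarrow> 'a \<Rightarrow> real^2 \<Rightarrow> real" where
  "norm_at M p v = sqrt (inner_at M p v v)"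


section \<open>Levi-Civita connection and Gaussian curvature\<close>

definition partial :: "2 \<Rightarrow> (real^2 \<Rightarrow> real) \<Rightarrow> real^2 \<Rightarrow> real" where
  "partial i f x = frechet_derivative f (at x) (axis i 1)"

text \<open>\<open>christoffel g k i j\<close> is \<open>\<Gamma>\<^sup>k\<^sub>i\<^sub>j\<close>.\<close>

definition christoffel :: "(real^2 \<Rightarrow> real^2^2) \<Rightarrow> 2 \<Rightarrow> 2 \<Rightarrow> 2 \<Rightarrow> real^2 \<Rightarrow> real" where
  "christoffel g k i j x =
    (\<Sum>l\<in>UNIV. matrix_inv (g x) $ k $ l *
       (partial i (\<lambda>y. g y $ j $ l) x + partial j (\<lambda>y. g y $ i $ l) x
          - partial l (\<lambda>y. g y $ i $ j) x)) / 2"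

text \<open>\<open>R(\<partial>\<^sub>i, \<partial>\<^sub>j) \<partial>\<^sub>k = (\<Sum>l. riemann g l k i j \<partial>\<^sub>l)\<close>, where
  \<open>R(X, Y) Z = \<nabla>\<^sub>X \<nabla>\<^sub>Y Z - \<nabla>\<^sub>Y \<nabla>\<^sub>X Z - \<nabla>\<^bsub>[X, Y]\<^esub> Z\<close>.\<close>

definition riemann :: "(real^2 \<Rightarrow> real^2^2) \<Rightarrow> 2 \<Rightarrow> 2 \<Rightarrow> 2 \<Rightarrow> 2 \<Rightarrow> real^2 \<Rightarrow> real" where
  "riemann g l k i j x =
     partial i (christoffel g l j k) x - partial j (christoffel g l i k) x
     + (\<Sum>m\<in>UNIV. christoffel g l i m x * christoffel g m j k x
                 - christoffel g l j m x * christoffel g m i k x)"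

text \<open>\<open>K = \<langle>R(\<partial>\<^sub>1, \<partial>\<^sub>2) \<partial>\<^sub>2, \<partial>\<^sub>1\<rangle> / det g\<close>, which is positive on round spheres.\<close>

definition gaussian_curvature :: "'a surface \<Rightarrow> 'a \<Rightarrow> real" where
  "gaussian_curvature M p =
    (let \<kappa> = chart_at M p; g = metric M \<kappa>; x = cmap \<kappa> p
     in (\<Sum>l\<in>UNIV. g x $ l $ 1 * riemann g l 2 1 2 x) / det (g x))"


section \<open>Curves, length, distance\<close>

text \<open>The derivatives are one-sided at the end points of the interval \<open>I\<close>.\<close>

definition C1_curve_on :: "'a::topological_space surface \<Rightarrow> real set \<Rightarrow> (real \<Rightarrow> 'a) \<Rightarrow> bool" where
  "C1_curve_on M I c \<longleftrightarrow>
     continuous_on I c \<and> c ` I \<subseteq> carrier M \<and>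
     (\<forall>\<kappa>\<in>charts M. \<exists>v. continuous_on {t\<in>I. c t \<in> cdom \<kappa>} v \<and>
        (\<forall>t\<in>I. c t \<in> cdom \<kappa> \<longrightarrow>
           ((cmap \<kappa> \<circ> c) has_vector_derivative v t) (at t within I)))"

text \<open>Piecewise \<open>C\<^sup>1\<close> curves are required to be \<open>C\<^sup>1\<close> on the closed pieces, so that the speed is
  bounded and the length integral exists.\<close>

definition curve_between ::
    "'a::topological_space surface \<Rightarrow> 'a \<Rightarrow> 'a \<Rightarrow> (real \<Rightarrow> 'a) \<Rightarrow> bool" where
  "curve_between M P Q c \<longleftrightarrow>
     c 0 = P \<and> c 1 = Q \<and>
     (\<exists>S. finite S \<and>
        (\<forall>a b. 0 \<le> a \<and> a < b \<and> b \<le> 1 \<and> {a<..<b} \<inter> S = {} \<longrightarrow> C1_curve_on M {a..b} c))"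

definition velocity :: "'a surface \<Rightarrow> (real \<Rightarrow> 'a) \<Rightarrow> real \<Rightarrow> real^2" where
  "velocity M c t =
     vector_derivative (cmap (chart_at M (c t)) \<circ> c) (at t within {0..1})"

definition curve_length :: "'a surface \<Rightarrow> (real \<Rightarrow> 'a) \<Rightarrow> real" where
  "curve_length M c = integral {0..1} (\<lambda>t. norm_at M (c t) (velocity M c t))"

definition gdist :: "'a::topological_space surface \<Rightarrow> 'a \<Rightarrow> 'a \<Rightarrow> real" where
  "gdist M P Q = Inf (curve_length M ` {c. curve_between M P Q c})"


section \<open>Geodesics\<close>

definition geodesic_on :: "'a::topological_space surface \<Rightarrow> real set \<Rightarrow> (real \<Rightarrow> 'a) \<Rightarrow> bool" where
  "geodesic_on M I c \<longleftrightarrow>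
     continuous_on I c \<and> c ` I \<subseteq> carrier M \<and>
     (\<forall>\<kappa>\<in>charts M. \<exists>v. \<forall>t\<in>I. c t \<in> cdom \<kappa> \<longrightarrow>
        ((cmap \<kappa> \<circ> c) has_vector_derivative v t) (at t within I) \<and>
        (v has_vector_derivative
           (\<chi> k. - (\<Sum>i\<in>UNIV. \<Sum>j\<in>UNIV.
              christoffel (metric M \<kappa>) k i j (cmap \<kappa> (c t)) * v t $ i * v t $ j)))
          (at t within I))"

definition complete_surface :: "'a::topological_space surface \<Rightarrow> bool" where
  "complete_surface M \<longleftrightarrow>
     (\<forall>\<kappa>\<in>charts M. \<forall>p\<in>cdom \<kappa>. \<forall>w. \<exists>c. geodesic_on M UNIV c \<and> c 0 = p \<and>
        ((cmap \<kappa> \<circ> c) has_vector_derivative w) (at 0))"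

text \<open>Geodesics from \<open>P\<close> to \<open>Q\<close> are normalized to have domain \<open>[0, 1]\<close> (and the value
  \<^const>\<open>undefined\<close> elsewhere), so that uniqueness is uniqueness up to reparametrization.\<close>

definition geodesic_in ::
    "'a::topological_space surface \<Rightarrow> 'a set \<Rightarrow> 'a \<Rightarrow> 'a \<Rightarrow> (real \<Rightarrow> 'a) \<Rightarrow> bool" where
  "geodesic_in M U P Q c \<longleftrightarrow>
     c \<in> extensional {0..1} \<and> geodesic_on M {0..1} c \<and> c ` {0..1} \<subseteq> U \<and> c 0 = P \<and> c 1 = Q"

definition geod :: "'a::topological_space surface \<Rightarrow> 'a set \<Rightarrow> 'a \<Rightarrow> 'a \<Rightarrow> real \<Rightarrow> 'a" where
  "geod M U P Q = (THE c. geodesic_in M U P Q c)"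

definition uniquely_geodesic_disk :: "'a::topological_space surface \<Rightarrow> 'a set \<Rightarrow> bool" where
  "uniquely_geodesic_disk M U \<longleftrightarrow>
     open U \<and> U \<subseteq> carrier M \<and> U homeomorphic ball (0::real^2) 1 \<and>
     (\<forall>P\<in>U. \<forall>Q\<in>U. P \<noteq> Q \<longrightarrow>
        (\<exists>!c. geodesic_in M U P Q c) \<and>
        (\<forall>\<sigma>. curve_between M P Q \<sigma> \<longrightarrow> curve_length M (geod M U P Q) \<le> curve_length M \<sigma>))"


section \<open>Angles, triangles, balanced points\<close>

text \<open>\<open>angle M U P X Q\<close> is the measure of the angle at \<open>X\<close>.\<close>

definition angle :: "'a::topological_space surface \<Rightarrow> 'a set \<Rightarrow> 'a \<Rightarrow> 'a \<Rightarrow> 'a \<Rightarrow> real" where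
  "angle M U P X Q =
    (let u = velocity M (geod M U X P) 0; v = velocity M (geod M U X Q) 0
     in arccos (inner_at M X u v / (norm_at M X u * norm_at M X v)))"

definition triangle_sides :: "'a::topological_space surface \<Rightarrow> 'a set \<Rightarrow> 'a \<Rightarrow> 'a \<Rightarrow> 'a \<Rightarrow> 'a set" where
  "triangle_sides M U A B C =
     geod M U A B ` {0..1} \<union> geod M U B C ` {0..1} \<union> geod M U C A ` {0..1}"

text \<open>Under a homeomorphism of \<open>U\<close> with the plane, a subset of \<open>U\<close> is contained in a compact
  subset of \<open>U\<close> iff its image is bounded. So the following is the union of the bounded components
  of the complement of the sides, that is, the inside of the Jordan curve formed by the sides.\<close>

definition triangle_interior ::
    "'a::topological_space surface \<Rightarrow> 'a set \<Rightarrow> 'a \<Rightarrow> 'a \<Rightarrow> 'a \<Rightarrow> 'a set" where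
  "triangle_interior M U A B C =
     {X \<in> U - triangle_sides M U A B C.
        \<exists>K. compact K \<and> K \<subseteq> U \<and>
            connected_component_set (U - triangle_sides M U A B C) X \<subseteq> K}"

definition triangle_domain ::
    "'a::topological_space surface \<Rightarrow> 'a set \<Rightarrow> 'a \<Rightarrow> 'a \<Rightarrow> 'a \<Rightarrow> 'a set" where
  "triangle_domain M U A B C = triangle_sides M U A B C \<union> triangle_interior M U A B C"

definition balanced_point ::
    "'a::topological_space surface \<Rightarrow> 'a set \<Rightarrow> 'a \<Rightarrow> 'a \<Rightarrow> 'a \<Rightarrow> 'a \<Rightarrow> bool" where
  "balanced_point M U A B C T \<longleftrightarrow>
     T \<in> triangle_interior M U A B C \<and>
     angle M U A T B = 2 * pi / 3 \<and> angle M U B T C = 2 * pi / 3 \<and> angle M U C T A = 2 * pi / 3"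

end

theory Submission
  imports Defs
begin

text \<open>A balanced point is found as a minimiser \<^term>\<open>T\<close> of the sum of the distances to the three vertices over
  the compact triangle domain.  Only the easy half of the first variation formula is needed: comparison
  with a short straight segment in a chart gives an upper bound for the sum near \<^term>\<open>T\<close>.  If \<^term>\<open>T\<close>
  lies inside, the unit vectors towards the vertices therefore add up to zero, so they enclose angles of
  \<^term>\<open>2 * pi / 3\<close>.  At a vertex with an angle below \<^term>\<open>2 * pi / 3\<close>, the sum decreases along the
  bisector, and on an open side it decreases towards the opposite vertex.

  What remains is to see that these two directions point into the triangle.  By the theta curve lemma
  a cevian, or a short chord near a vertex, runs inside the triangle, unless a vertex lies inside a loop
  formed by the cevian or chord and parts of the sides.  In that case a side extended beyond this vertex
  (by completeness) must leave the loop, because geodesics of the disk are minimal and the distance is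
  bounded on compact sets; but two geodesics of the disk meet at most once.\<close>


section \<open>Charts, speed and length of curves\<close>

text \<open>The distance to a vertex is never differentiated: minimality is contradicted by any
  competing curve that is short enough, so an upper bound by the length of a broken curve does the
  work of a derivative. Accordingly a direction is tested only through a sequence of points of the
  triangle approaching \<open>T\<close> along it. The obstacle is that angles are infinitesimal
  while the inside of the triangle is topological: nothing says in advance that the bisector at a
  vertex or a cevian points inwards. The theta curve lemma bridges this gap because it only asks how
  arcs intersect, and intersections of geodesics are governed by unique continuation. Hence the
  detour through local uniqueness for the geodesic equation. Nondegeneracy enters as the condition
  that no angle equals pi, which follows from the bound 2 pi / 3. At a vertex this bound arises as
  follows: for unit vectors \<open>u\<close>, \<open>v\<close> the norm of \<open>u + v\<close>
  exceeds 1 exactly when they enclose less than 2 pi / 3, and 1 is the rate at which the distance to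
  the vertex itself grows.\<close>

definition chart_norm :: "'a surface \<Rightarrow> 'a chart \<Rightarrow> real^2 \<Rightarrow> real^2 \<Rightarrow> real" where
  "chart_norm M \<kappa> x v = sqrt (v \<bullet> (metric M \<kappa> x *v v))"

definition speed :: "'a::topological_space surface \<Rightarrow> (real \<Rightarrow> 'a) \<Rightarrow> real \<Rightarrow> real" where
  "speed M c t = norm_at M (c t) (velocity M c t)"

text \<open>By continuity the times spent in an open set form a relative neighbourhood of
  \<open>t\<close> in \<open>I\<close>, so limits and derivatives at \<open>t\<close> do not notice
  the restriction to one chart.\<close>

lemma at_within_chart_dom:
  assumes "continuous_on I c" "t \<in> I" "open W" "c t \<in> W"
  shows "at t within {s\<in>I. c s \<in> W} = at t within I"
proof -
  obtain V where V: "open V" "V \<inter> I = c -` W \<inter> I"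
    using assms(1,3) unfolding continuous_on_open_invariant by blast
  show ?thesis
    by (rule at_within_nhd[of t V]) (use V assms in auto)
qed

lemma eventually_in_open:
  assumes "continuous (at t within I) c" "open W" "c t \<in> W"
  shows "\<forall>\<^sub>F s in at t within I. c s \<in> W"
  using assms unfolding continuous_within by (rule topological_tendstoD)

locale riem_surface =
  fixes M :: "'a::{t2_space,second_countable_topology} surface"
  assumes riem: "riemannian_surface M"
begin

lemma chart_open: "\<kappa> \<in> charts M \<Longrightarrow> open (cdom \<kappa>)"
  and chart_image_open: "\<kappa> \<in> charts M \<Longrightarrow> open (cmap \<kappa> ` cdom \<kappa>)"
  and chart_homeo: "\<kappa> \<in> charts M \<Longrightarrow> homeomorphism (cdom \<kappa>) (cmap \<kappa> ` cdom \<kappa>) (cmap \<kappa>) (cinv \<kappa>)"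
  and transition_smooth: "\<kappa> \<in> charts M \<Longrightarrow> \<kappa>' \<in> charts M \<Longrightarrow>
        smooth_on (cmap \<kappa> ` (cdom \<kappa> \<inter> cdom \<kappa>')) (transition \<kappa> \<kappa>')"
  and metric_smooth: "\<kappa> \<in> charts M \<Longrightarrow> smooth_on (cmap \<kappa> ` cdom \<kappa>) (metric M \<kappa>)"
  and metric_sym: "\<kappa> \<in> charts M \<Longrightarrow> x \<in> cmap \<kappa> ` cdom \<kappa> \<Longrightarrow> transpose (metric M \<kappa> x) = metric M \<kappa> x"
  and metric_pos: "\<kappa> \<in> charts M \<Longrightarrow> x \<in> cmap \<kappa> ` cdom \<kappa> \<Longrightarrow> v \<noteq> 0 \<Longrightarrow> 0 < v \<bullet> (metric M \<kappa> x *v v)"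
  using riem unfolding riemannian_surface_def by blast+

lemma metric_compat:
  assumes "\<kappa> \<in> charts M" "\<kappa>' \<in> charts M" "p \<in> cdom \<kappa>" "p \<in> cdom \<kappa>'"
    and "D = frechet_derivative (transition \<kappa> \<kappa>') (at (cmap \<kappa> p))"
  shows "u \<bullet> (metric M \<kappa> (cmap \<kappa> p) *v v) = D u \<bullet> (metric M \<kappa>' (cmap \<kappa>' p) *v D v)"
proof -
  have "cinv \<kappa> (cmap \<kappa> p) = p"
    using chart_homeo[OF assms(1)] assms(3) by (auto simp: homeomorphism_def)
  then have "transition \<kappa> \<kappa>' (cmap \<kappa> p) = cmap \<kappa>' p" by (simp add: transition_def)
  moreover have "cmap \<kappa> p \<in> cmap \<kappa> ` (cdom \<kappa> \<inter> cdom \<kappa>')" using assms by blast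
  moreover have "\<forall>x\<in>cmap \<kappa> ` (cdom \<kappa> \<inter> cdom \<kappa>'). \<forall>u v.
        u \<bullet> (metric M \<kappa> x *v v) =
        (let D = frechet_derivative (transition \<kappa> \<kappa>') (at x)
         in D u \<bullet> (metric M \<kappa>' (transition \<kappa> \<kappa>' x) *v D v))"
    using riem assms(1,2) unfolding riemannian_surface_def by blast
  ultimately show ?thesis using assms(5) by (metis (no_types, lifting))
qed

lemma cinv_cmap: "\<kappa> \<in> charts M \<Longrightarrow> p \<in> cdom \<kappa> \<Longrightarrow> cinv \<kappa> (cmap \<kappa> p) = p"
  using chart_homeo by (fastforce simp: homeomorphism_def)

lemma cmap_cinv: "\<kappa> \<in> charts M \<Longrightarrow> x \<in> cmap \<kappa> ` cdom \<kappa> \<Longrightarrow> cmap \<kappa> (cinv \<kappa> x) = x"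
  using chart_homeo by (fastforce simp: homeomorphism_def)

lemma cinv_in: "\<kappa> \<in> charts M \<Longrightarrow> x \<in> cmap \<kappa> ` cdom \<kappa> \<Longrightarrow> cinv \<kappa> x \<in> cdom \<kappa>"
  using chart_homeo by (fastforce simp: homeomorphism_def)

lemma cmap_continuous: "\<kappa> \<in> charts M \<Longrightarrow> continuous_on (cdom \<kappa>) (cmap \<kappa>)"
  using chart_homeo by (fastforce simp: homeomorphism_def)

lemma cinv_continuous: "\<kappa> \<in> charts M \<Longrightarrow> continuous_on (cmap \<kappa> ` cdom \<kappa>) (cinv \<kappa>)"
  using chart_homeo by (fastforce simp: homeomorphism_def)

lemma chart_image_inter_open:
  assumes "\<kappa> \<in> charts M" "open V"
  shows "open (cmap \<kappa> ` (cdom \<kappa> \<inter> V))"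
proof -
  have "cmap \<kappa> ` (cdom \<kappa> \<inter> V) = cmap \<kappa> ` cdom \<kappa> \<inter> cinv \<kappa> -` V"
    using cinv_cmap[OF assms(1)] by force
  then show ?thesis
    using continuous_open_preimage[OF cinv_continuous chart_image_open] assms by auto
qed

lemma chart_at: "p \<in> carrier M \<Longrightarrow> chart_at M p \<in> charts M \<and> p \<in> cdom (chart_at M p)"
  unfolding chart_at_def carrier_def by (rule someI_ex) auto

lemma transition_has_derivative:
  assumes "\<kappa> \<in> charts M" "\<kappa>' \<in> charts M" "p \<in> cdom \<kappa>" "p \<in> cdom \<kappa>'"
  shows "(transition \<kappa> \<kappa>' has_derivative frechet_derivative (transition \<kappa> \<kappa>') (at (cmap \<kappa> p)))
           (at (cmap \<kappa> p))"
proof -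
  let ?S = "cmap \<kappa> ` (cdom \<kappa> \<inter> cdom \<kappa>')"
  have "Ck_on (Suc 0) ?S (transition \<kappa> \<kappa>')"
    using transition_smooth[OF assms(1,2)] unfolding smooth_on_def by blast
  then have "transition \<kappa> \<kappa>' differentiable_on ?S" by simp
  then have "transition \<kappa> \<kappa>' differentiable (at (cmap \<kappa> p) within ?S)"
    using assms unfolding differentiable_on_def by blast
  moreover have "at (cmap \<kappa> p) within ?S = at (cmap \<kappa> p)"
    using chart_image_inter_open[OF assms(1) chart_open[OF assms(2)]] assms
    by (intro at_within_open) auto
  ultimately show ?thesis by (simp add: frechet_derivative_works)
qed

lemma chart_change:
  assumes "\<kappa> \<in> charts M" "\<kappa>' \<in> charts M" "t \<in> I" "continuous (at t within I) c"
    and "c t \<in> cdom \<kappa>" "c t \<in> cdom \<kappa>'"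
    and d: "((cmap \<kappa> \<circ> c) has_vector_derivative w) (at t within I)"
  shows "((cmap \<kappa>' \<circ> c) has_vector_derivative
            frechet_derivative (transition \<kappa> \<kappa>') (at (cmap \<kappa> (c t))) w) (at t within I)"
proof -
  let ?F = "frechet_derivative (transition \<kappa> \<kappa>') (at (cmap \<kappa> (c t)))"
  have "(transition \<kappa> \<kappa>' has_derivative ?F) (at ((cmap \<kappa> \<circ> c) t) within (cmap \<kappa> \<circ> c) ` I)"
    using transition_has_derivative[OF assms(1,2,5,6)] by (simp add: has_derivative_at_withinI)
  from vector_derivative_diff_chain_within[OF d this]
  have *: "((transition \<kappa> \<kappa>' \<circ> (cmap \<kappa> \<circ> c)) has_derivative (\<lambda>h. h *\<^sub>R ?F w)) (at t within I)"
    unfolding has_vector_derivative_def .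
  have "\<forall>\<^sub>F s in at t within I. c s \<in> cdom \<kappa>"
    using eventually_in_open[OF assms(4) chart_open[OF assms(1)] assms(5)] .
  then have "\<forall>\<^sub>F s in at t within I. (transition \<kappa> \<kappa>' \<circ> (cmap \<kappa> \<circ> c)) s = (cmap \<kappa>' \<circ> c) s"
    by eventually_elim (simp add: transition_def cinv_cmap[OF assms(1)])
  \<comment> \<open>The two coordinate curves agree only as long as \<open>c\<close> stays in
    \<open>cdom \<kappa>\<close>; this holds eventually at \<open>t\<close>, which is all that a
    derivative sees.\<close>
  from has_derivative_transform_eventually[OF * this]
  show ?thesis
    unfolding has_vector_derivative_def using assms(1,3,5) by (simp add: transition_def cinv_cmap o_def)
qed

lemma velocity_eq:
  assumes "\<kappa> \<in> charts M" "t \<in> {0..1}" "continuous (at t within {0..1}) c" "c t \<in> cdom \<kappa>"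
    and "((cmap \<kappa> \<circ> c) has_vector_derivative w) (at t within {0..1})"
  shows "velocity M c t = frechet_derivative (transition \<kappa> (chart_at M (c t))) (at (cmap \<kappa> (c t))) w"
proof -
  have "c t \<in> carrier M" using assms by (auto simp: carrier_def)
  note k = chart_at[OF this]
  show ?thesis unfolding velocity_def
    by (rule vector_derivative_within_closed_interval)
       (use chart_change[OF assms(1) _ assms(2,3,4) _ assms(5)] k assms in auto)
qed

lemma velocity_chart_at:
  assumes "t \<in> {0..1}"
    and "((cmap (chart_at M (c t)) \<circ> c) has_vector_derivative w) (at t within {0..1})"
  shows "velocity M c t = w"
  unfolding velocity_def
  by (rule vector_derivative_within_closed_interval) (use assms in auto)

lemma norm_at_chart_at: "norm_at M p v = chart_norm M (chart_at M p) (cmap (chart_at M p) p) v"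
  by (simp add: norm_at_def inner_at_def chart_norm_def Let_def)

text \<open>Metric compatibility makes the speed computable in any chart around \<open>c t\<close>.
  This matters because \<open>velocity\<close> refers to \<open>chart_at M (c t)\<close>, a choice
  that may jump with \<open>t\<close>.\<close>

lemma speed_eq:
  assumes "\<kappa> \<in> charts M" "t \<in> {0..1}" "continuous (at t within {0..1}) c" "c t \<in> cdom \<kappa>"
    and "((cmap \<kappa> \<circ> c) has_vector_derivative w) (at t within {0..1})"
  shows "speed M c t = chart_norm M \<kappa> (cmap \<kappa> (c t)) w"
proof -
  have "c t \<in> carrier M" using assms by (auto simp: carrier_def)
  note k = chart_at[OF this]
  show ?thesis
    unfolding speed_def norm_at_chart_at velocity_eq[OF assms] chart_norm_def
    using metric_compat[OF assms(1) _ assms(4), of "chart_at M (c t)"] k by simp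
qed

lemma metric_continuous: "\<kappa> \<in> charts M \<Longrightarrow> continuous_on (cmap \<kappa> ` cdom \<kappa>) (metric M \<kappa>)"
  using metric_smooth[of \<kappa>] Ck_on.simps(1) unfolding smooth_on_def by blast

lemma chart_norm_continuous:
  assumes "\<kappa> \<in> charts M" "continuous_on J x" "continuous_on J v" "x ` J \<subseteq> cmap \<kappa> ` cdom \<kappa>"
  shows "continuous_on J (\<lambda>t. chart_norm M \<kappa> (x t) (v t))"
proof -
  have m: "continuous_on J (\<lambda>t. metric M \<kappa> (x t))"
    using continuous_on_compose2[OF metric_continuous[OF assms(1)] assms(2,4)] .
  show ?thesis unfolding chart_norm_def matrix_vector_mult_def inner_vec_def
    by (intro continuous_intros assms m)
qed

lemma chart_norm_scale: "chart_norm M \<kappa> x (a *\<^sub>R v) = \<bar>a\<bar> * chart_norm M \<kappa> x v"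
  by (simp add: chart_norm_def matrix_vector_mult_scaleR real_sqrt_mult flip: mult.assoc)

lemma C1_deriv:
  assumes "C1_curve_on M I c" "\<kappa> \<in> charts M"
  obtains v where "continuous_on {t\<in>I. c t \<in> cdom \<kappa>} v"
    "\<And>t. t \<in> I \<Longrightarrow> c t \<in> cdom \<kappa> \<Longrightarrow> ((cmap \<kappa> \<circ> c) has_vector_derivative v t) (at t within I)"
  using assms unfolding C1_curve_on_def by blast

lemma C1_continuous: "C1_curve_on M I c \<Longrightarrow> continuous_on I c"
  and C1_carrier: "C1_curve_on M I c \<Longrightarrow> t \<in> I \<Longrightarrow> c t \<in> carrier M"
  unfolding C1_curve_on_def by auto

text \<open>Continuity at \<open>t\<close> is tested in the single chart chosen at \<open>t\<close>,
  on the relatively open set of times that the curve spends in it.\<close>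

lemma speed_continuous:
  assumes "C1_curve_on M {0..1} c"
  shows "continuous_on {0..1} (speed M c)"
  unfolding continuous_on_eq_continuous_within
proof
  fix t :: real assume t: "t \<in> {0..1}"
  note cont = C1_continuous[OF assms]
  define \<kappa> where "\<kappa> = chart_at M (c t)"
  have k: "\<kappa> \<in> charts M" "c t \<in> cdom \<kappa>"
    using chart_at[OF C1_carrier[OF assms t]] by (auto simp: \<kappa>_def)
  obtain v where v: "continuous_on {t\<in>{0..1}. c t \<in> cdom \<kappa>} v"
    "\<And>t. t \<in> {0..1} \<Longrightarrow> c t \<in> cdom \<kappa> \<Longrightarrow> ((cmap \<kappa> \<circ> c) has_vector_derivative v t) (at t within {0..1})"
    using C1_deriv[OF assms k(1)] by blast
  let ?J = "{t\<in>{0..1}. c t \<in> cdom \<kappa>}"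
  have "continuous_on ?J (\<lambda>s. chart_norm M \<kappa> (cmap \<kappa> (c s)) (v s))"
    by (rule chart_norm_continuous[OF k(1)])
       (use v(1) in \<open>auto intro!: continuous_on_compose2[OF cmap_continuous[OF k(1)]] continuous_on_subset[OF cont]\<close>)
  moreover have "chart_norm M \<kappa> (cmap \<kappa> (c s)) (v s) = speed M c s" if "s \<in> ?J" for s
    using speed_eq[OF k(1) _ _ _ v(2)] that cont by (simp add: continuous_on_eq_continuous_within)
  ultimately have "continuous_on ?J (speed M c)" by (rule continuous_on_eq)
  then have "continuous (at t within ?J) (speed M c)"
    using t k by (simp add: continuous_on_eq_continuous_within)
  then show "continuous (at t within {0..1}) (speed M c)"
    using at_within_chart_dom[OF cont t chart_open[OF k(1)] k(2)] by simp
qed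

lemma speed_nonneg: "t \<in> {0..1} \<Longrightarrow> C1_curve_on M {0..1} c \<Longrightarrow> 0 \<le> speed M c t"
  unfolding speed_def norm_at_chart_at chart_norm_def
  using metric_pos[of "chart_at M (c t)" "cmap (chart_at M (c t)) (c t)" "velocity M c t"] chart_at[of "c t"]
    C1_carrier[of "{0..1}" c t]
  by (cases "velocity M c t = 0") auto

lemma curve_length_eq: "curve_length M c = integral {0..1} (speed M c)"
  by (simp add: curve_length_def speed_def[abs_def])

lemma has_integral_speed:
  "C1_curve_on M {0..1} c \<Longrightarrow> (speed M c has_integral curve_length M c) {0..1}"
  unfolding curve_length_eq
  using integrable_continuous_real[OF speed_continuous] by (simp add: integrable_integral)

section \<open>Affine reparametrization and concatenation of curves\<close>

lemma has_vd_affine: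
  fixes f :: "real \<Rightarrow> 'b::real_normed_vector"
  assumes "(f has_vector_derivative w) (at (a*t+b) within J)" "(\<lambda>t. a*t+b) ` I \<subseteq> J"
  shows "((\<lambda>s. f (a * s+b)) has_vector_derivative a *\<^sub>R w) (at t within I)"
proof -
  have "((\<lambda>s. a * s+b) has_vector_derivative a) (at t within I)"
    by (auto intro!: derivative_eq_intros simp flip: has_real_derivative_iff_has_vector_derivative)
  from vector_diff_chain_within[OF this has_vector_derivative_within_subset[OF assms]]
  show ?thesis by (simp add: o_def)
qed

lemma C1_affine:
  assumes c: "C1_curve_on M J c" and J: "(\<lambda>t. a*t+b) ` I \<subseteq> J"
  shows "C1_curve_on M I (\<lambda>t. c (a*t+b))"
  unfolding C1_curve_on_def
proof (intro conjI ballI)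
  show "continuous_on I (\<lambda>t. c (a*t+b))"
    by (rule continuous_on_compose2[OF C1_continuous[OF c] _ J]) (intro continuous_intros)
  show "(\<lambda>t. c (a*t+b)) ` I \<subseteq> carrier M" using C1_carrier[OF c] J by blast
  fix \<kappa> assume k: "\<kappa> \<in> charts M"
  obtain v where v: "continuous_on {t\<in>J. c t \<in> cdom \<kappa>} v"
    "\<And>t. t \<in> J \<Longrightarrow> c t \<in> cdom \<kappa> \<Longrightarrow> ((cmap \<kappa> \<circ> c) has_vector_derivative v t) (at t within J)"
    using C1_deriv[OF c k] by blast
  show "\<exists>v. continuous_on {t\<in>I. c (a*t+b) \<in> cdom \<kappa>} v \<and>
        (\<forall>t\<in>I. c (a*t+b) \<in> cdom \<kappa> \<longrightarrow>
           ((cmap \<kappa> \<circ> (\<lambda>t. c (a*t+b))) has_vector_derivative v t) (at t within I))"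
  proof (intro exI conjI ballI impI)
    show "continuous_on {t\<in>I. c (a*t+b) \<in> cdom \<kappa>} (\<lambda>t. a *\<^sub>R v (a*t+b))"
      using J by (intro continuous_intros continuous_on_compose2[OF v(1)]) auto
    fix t assume "t \<in> I" "c (a*t+b) \<in> cdom \<kappa>"
    then have "((cmap \<kappa> \<circ> c) has_vector_derivative v (a*t+b)) (at (a*t+b) within J)"
      using J v by blast
    from has_vd_affine[OF this J]
    show "((cmap \<kappa> \<circ> (\<lambda>t. c (a*t+b))) has_vector_derivative a *\<^sub>R v (a*t+b)) (at t within I)"
      by (simp add: o_def)
  qed
qed

lemma C1_cong:
  assumes "C1_curve_on M I c" "\<And>t. t \<in> I \<Longrightarrow> c' t = c t"
  shows "C1_curve_on M I c'"
  unfolding C1_curve_on_def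
proof (intro conjI ballI)
  show "continuous_on I c'" using C1_continuous[OF assms(1)] assms(2) by (simp cong: continuous_on_cong)
  show "c' ` I \<subseteq> carrier M" using C1_carrier[OF assms(1)] assms(2) by auto
  fix \<kappa> assume k: "\<kappa> \<in> charts M"
  obtain v where v: "continuous_on {t\<in>I. c t \<in> cdom \<kappa>} v"
    "\<And>t. t \<in> I \<Longrightarrow> c t \<in> cdom \<kappa> \<Longrightarrow> ((cmap \<kappa> \<circ> c) has_vector_derivative v t) (at t within I)"
    using C1_deriv[OF assms(1) k] by blast
  have "{t\<in>I. c' t \<in> cdom \<kappa>} = {t\<in>I. c t \<in> cdom \<kappa>}" using assms(2) by auto
  moreover have "((cmap \<kappa> \<circ> c') has_vector_derivative v t) (at t within I)"
    if "t \<in> I" "c' t \<in> cdom \<kappa>" for t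
    using v(2)[of t] that assms(2) by (auto intro: has_vector_derivative_transform[rotated -1])
  ultimately show "\<exists>v. continuous_on {t\<in>I. c' t \<in> cdom \<kappa>} v \<and>
        (\<forall>t\<in>I. c' t \<in> cdom \<kappa> \<longrightarrow> ((cmap \<kappa> \<circ> c') has_vector_derivative v t) (at t within I))"
    using v by auto
qed

lemma speed_affine:
  assumes c: "C1_curve_on M {0..1} c" and lr: "0 \<le> l" "l < t" "t < r" "r \<le> 1"
    and im: "(\<lambda>s. a * s+b) ` {l..r} \<subseteq> {0..1}"
    and c': "\<And>s. l \<le> s \<Longrightarrow> s \<le> r \<Longrightarrow> c' s = c (a * s+b)"
  shows "speed M c' t = \<bar>a\<bar> * speed M c (a*t+b)"
proof -
  have ab: "a*t+b \<in> {0..1}" using im lr by (meson atLeastAtMost_iff imageI less_imp_le subsetD)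
  define \<kappa> where "\<kappa> = chart_at M (c (a*t+b))"
  have k: "\<kappa> \<in> charts M" "c (a*t+b) \<in> cdom \<kappa>"
    using chart_at[OF C1_carrier[OF c ab]] by (auto simp: \<kappa>_def)
  obtain v where v: 
    "\<And>t. t \<in> {0..1} \<Longrightarrow> c t \<in> cdom \<kappa> \<Longrightarrow> ((cmap \<kappa> \<circ> c) has_vector_derivative v t) (at t within {0..1})"
    using C1_deriv[OF c k(1)] by blast
  have C1: "C1_curve_on M {l..r} c'"
    by (rule C1_cong[OF C1_affine[OF c im]]) (use c' in auto)
  have w: "at t within {l..r} = at t within {0..1}"
    using lr by (intro at_within_nhd[of t "{l<..<r}"]) auto
  have ct: "continuous (at t within {0..1}) c'"
    using C1_continuous[OF C1] lr unfolding continuous_on_eq_continuous_within w[symmetric] by auto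
  have "((\<lambda>s. (cmap \<kappa> \<circ> c) (a * s+b)) has_vector_derivative a *\<^sub>R v (a*t+b)) (at t within {l..r})"
    by (rule has_vd_affine[OF v[OF ab k(2)] im])
  then have "((cmap \<kappa> \<circ> c') has_vector_derivative a *\<^sub>R v (a*t+b)) (at t within {l..r})"
    by (rule has_vector_derivative_transform[rotated -1]) (use c' lr in auto)
  then have "speed M c' t = chart_norm M \<kappa> (cmap \<kappa> (c' t)) (a *\<^sub>R v (a*t+b))"
    by (intro speed_eq[OF k(1)]) (use ct lr c' k w in auto)
  also have "\<dots> = \<bar>a\<bar> * chart_norm M \<kappa> (cmap \<kappa> (c (a*t+b))) (v (a*t+b))"
    using c' lr by (simp add: chart_norm_scale)
  also have "chart_norm M \<kappa> (cmap \<kappa> (c (a*t+b))) (v (a*t+b)) = speed M c (a*t+b)"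
    by (rule speed_eq[OF k(1), symmetric])
       (use C1_continuous[OF c] v ab k in \<open>auto simp: continuous_on_eq_continuous_within\<close>)
  finally show ?thesis .
qed

text \<open>The parameter \<open>1/2\<close> is the only possible corner, hence the exceptional set
  in \<open>curve_between\<close>. On each half the speed doubles, which compensates the halved
  interval; the end points of the halves form a finite set that the integral ignores.\<close>

lemma join_curves:
  assumes c1: "C1_curve_on M {0..1} c1" and c2: "C1_curve_on M {0..1} c2" and j: "c1 1 = c2 0"
  shows "curve_between M (c1 0) (c2 1) (c1 +++ c2)"
    and "curve_length M (c1 +++ c2) = curve_length M c1 + curve_length M c2"
proof -
  let ?c = "c1 +++ c2"
  have e1: "?c s = c1 (2 * s+0)" if "s \<le> 1/2" for s using that by (simp add: joinpaths_def)
  have e2: "?c s = c2 (2 * s+(-1))" if "1/2 \<le> s" for s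
    using that j unfolding joinpaths_def by (cases "s = 1/2") (simp_all only: order_antisym_conv if_False not_less, simp_all)
  show "curve_between M (c1 0) (c2 1) ?c" unfolding curve_between_def
  proof (intro conjI exI[of _ "{1/2}"] allI impI)
    show "?c 0 = c1 0" "?c 1 = c2 1" by (simp_all add: joinpaths_def)
    fix a b :: real assume ab: "0 \<le> a \<and> a < b \<and> b \<le> 1 \<and> {a<..<b} \<inter> {1/2} = {}"
    then consider "b \<le> 1/2" | "1/2 \<le> a" by (force simp: not_le)
    then show "C1_curve_on M {a..b} ?c"
    proof cases
      case 1
      show ?thesis
        by (rule C1_cong[OF C1_affine[OF c1, of 2 0]]) (use ab 1 e1 in auto)
    next
      case 2
      show ?thesis
        by (rule C1_cong[OF C1_affine[OF c2, of 2 "-1"]]) (use ab 2 e2 in auto)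
    qed
  qed auto
  have i1: "(speed M ?c has_integral curve_length M c1) {0..1/2}"
  proof -
    have "((\<lambda>x. 2 * speed M c1 (2 *\<^sub>R x + 0)) has_integral 2 * (curve_length M c1 /\<^sub>R 2 ^ DIM(real)))
           (cbox ((0 - 0) /\<^sub>R 2) ((1 - 0) /\<^sub>R 2))"
      by (intro has_integral_mult_right has_integral_affinity') (use has_integral_speed[OF c1] in auto)
    then have h: "((\<lambda>x. 2 * speed M c1 (2*x+0)) has_integral curve_length M c1) {0..1/2}"
      by (simp add: cbox_interval)
    show ?thesis
    proof (rule has_integral_spike_finite[OF _ _ h])
      fix x :: real assume "x \<in> {0..1/2} - {0,1/2}"
      then show "speed M ?c x = 2 * speed M c1 (2*x+0)"
        using speed_affine[OF c1, of 0 x "1/2" 2 0 ?c] e1 by auto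
    qed simp
  qed
  have i2: "(speed M ?c has_integral curve_length M c2) {1/2..1}"
  proof -
    have "((\<lambda>x. 2 * speed M c2 (2 *\<^sub>R x + (-1))) has_integral 2 * (curve_length M c2 /\<^sub>R 2 ^ DIM(real)))
           (cbox ((0 - (-1)) /\<^sub>R 2) ((1 - (-1)) /\<^sub>R 2))"
      by (intro has_integral_mult_right has_integral_affinity') (use has_integral_speed[OF c2] in auto)
    then have h: "((\<lambda>x. 2 * speed M c2 (2*x+(-1))) has_integral curve_length M c2) {1/2..1}"
      by (simp add: cbox_interval)
    show ?thesis
    proof (rule has_integral_spike_finite[OF _ _ h])
      fix x :: real assume "x \<in> {1/2..1} - {1/2,1}"
      then show "speed M ?c x = 2 * speed M c2 (2*x+(-1))"
        using speed_affine[OF c2, of "1/2" x 1 2 "-1" ?c] e2 by (force simp: image_subset_iff)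
    qed simp
  qed
  show "curve_length M ?c = curve_length M c1 + curve_length M c2"
    unfolding curve_length_eq[of ?c]
    using has_integral_combine[OF _ _ i1 i2] by (simp add: integral_unique)
qed

end


section \<open>Geodesics\<close>

text \<open>Away from \<open>m\<close> only one piece is visible; at \<open>m\<close> the filter of
  the union is the supremum of the two one-sided filters.\<close>

lemma has_vector_derivative_union_at:
  fixes f :: "real \<Rightarrow> 'b::real_normed_vector"
  assumes I: "I1 \<subseteq> {..m}" "I2 \<subseteq> {m..}" "m \<in> I1" "m \<in> I2" "t \<in> I1 \<union> I2"
    and d1: "t \<in> I1 \<Longrightarrow> (f has_vector_derivative d) (at t within I1)"
    and d2: "t \<in> I2 \<Longrightarrow> (f has_vector_derivative d) (at t within I2)"
  shows "(f has_vector_derivative d) (at t within (I1 \<union> I2))"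
proof -
  consider "t < m" | "t > m" | "t = m" by linarith
  then show ?thesis
  proof cases
    case 1
    then have "at t within (I1 \<union> I2) = at t within I1"
      using I by (intro at_within_nhd[of t "{..<m}"]) auto
    moreover have "t \<in> I1" using I 1 by auto
    ultimately show ?thesis using d1 by simp
  next
    case 2
    then have "at t within (I1 \<union> I2) = at t within I2"
      using I by (intro at_within_nhd[of t "{m<..}"]) auto
    moreover have "t \<in> I2" using I 2 by auto
    ultimately show ?thesis using d2 by simp
  next
    case 3
    show ?thesis using d1[unfolded has_vector_derivative_def has_derivative_within]
        d2[unfolded has_vector_derivative_def has_derivative_within] I(3,4)
      unfolding has_vector_derivative_def has_derivative_within 3
      unfolding at_within_union
      by (auto intro: filterlim_sup)
  qed
qed

lemma frechet_derivative_partial: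
  fixes f :: "real^2 \<Rightarrow> real"
  assumes "f differentiable (at x)"
  shows "frechet_derivative f (at x) h = partial 1 f x * h $ 1 + partial 2 f x * h $ 2"
proof -
  have lin: "linear (frechet_derivative f (at x))"
    using assms by (rule linear_frechet_derivative)
  have "h = h $ 1 *\<^sub>R axis 1 1 + h $ 2 *\<^sub>R axis 2 1"
    by (simp add: vec_eq_iff forall_2 axis_def)
  then have "frechet_derivative f (at x) h =
      frechet_derivative f (at x) (h $ 1 *\<^sub>R axis 1 1 + h $ 2 *\<^sub>R axis 2 1)" by simp
  also have "\<dots> = h $ 1 *\<^sub>R partial 1 f x + h $ 2 *\<^sub>R partial 2 f x"
    by (simp only: linear_add[OF lin] linear_scale[OF lin] partial_def)
  finally show ?thesis by (simp add: mult.commute)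
qed

context riem_surface
begin

definition geod_acc :: "'a chart \<Rightarrow> real^2 \<Rightarrow> real^2 \<Rightarrow> real^2" where
  "geod_acc \<kappa> x v = (\<chi> k. - (\<Sum>i\<in>UNIV. \<Sum>j\<in>UNIV. christoffel (metric M \<kappa>) k i j x * v $ i * v $ j))"

lemma geodesic_deriv:
  assumes "geodesic_on M I c" "\<kappa> \<in> charts M"
  obtains v where
    "\<And>t. t \<in> I \<Longrightarrow> c t \<in> cdom \<kappa> \<Longrightarrow> ((cmap \<kappa> \<circ> c) has_vector_derivative v t) (at t within I)"
    "\<And>t. t \<in> I \<Longrightarrow> c t \<in> cdom \<kappa> \<Longrightarrow> (v has_vector_derivative geod_acc \<kappa> (cmap \<kappa> (c t)) (v t)) (at t within I)"
  using assms unfolding geodesic_on_def geod_acc_def by blast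

lemma geodesicI:
  assumes "continuous_on I c" "c ` I \<subseteq> carrier M"
    and "\<And>\<kappa>. \<kappa> \<in> charts M \<Longrightarrow> \<exists>v. \<forall>t\<in>I. c t \<in> cdom \<kappa> \<longrightarrow>
        ((cmap \<kappa> \<circ> c) has_vector_derivative v t) (at t within I) \<and>
        (v has_vector_derivative geod_acc \<kappa> (cmap \<kappa> (c t)) (v t)) (at t within I)"
  shows "geodesic_on M I c"
  using assms unfolding geodesic_on_def geod_acc_def by blast

text \<open>Homogeneity of degree two in the velocity is what keeps affinely reparametrized
  geodesics geodesic.\<close>

lemma geod_acc_scale: "geod_acc \<kappa> x (a *\<^sub>R v) = (a*a) *\<^sub>R geod_acc \<kappa> x v"
  by (simp add: geod_acc_def vec_eq_iff sum_distrib_left mult_ac)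

lemma geodesic_continuous: "geodesic_on M I c \<Longrightarrow> continuous_on I c"
  and geodesic_carrier: "geodesic_on M I c \<Longrightarrow> t \<in> I \<Longrightarrow> c t \<in> carrier M"
  unfolding geodesic_on_def by auto

lemma geodesic_C1:
  assumes "geodesic_on M I c"
  shows "C1_curve_on M I c"
  unfolding C1_curve_on_def
proof (intro conjI ballI)
  show "continuous_on I c" "c ` I \<subseteq> carrier M" using assms unfolding geodesic_on_def by auto
  fix \<kappa> assume k: "\<kappa> \<in> charts M"
  obtain v where v: 
    "\<And>t. t \<in> I \<Longrightarrow> c t \<in> cdom \<kappa> \<Longrightarrow> ((cmap \<kappa> \<circ> c) has_vector_derivative v t) (at t within I)"
    "\<And>t. t \<in> I \<Longrightarrow> c t \<in> cdom \<kappa> \<Longrightarrow> (v has_vector_derivative geod_acc \<kappa> (cmap \<kappa> (c t)) (v t)) (at t within I)"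
    using geodesic_deriv[OF assms k] by blast
  have "continuous_on {t\<in>I. c t \<in> cdom \<kappa>} v"
    unfolding continuous_on_eq_continuous_within
  proof
    fix t assume "t \<in> {t\<in>I. c t \<in> cdom \<kappa>}"
    then have "continuous (at t within I) v"
      using v(2) has_vector_derivative_continuous by blast
    then show "continuous (at t within {t\<in>I. c t \<in> cdom \<kappa>}) v"
      by (rule continuous_within_subset) blast
  qed
  with v show "\<exists>v. continuous_on {t\<in>I. c t \<in> cdom \<kappa>} v \<and>
        (\<forall>t\<in>I. c t \<in> cdom \<kappa> \<longrightarrow> ((cmap \<kappa> \<circ> c) has_vector_derivative v t) (at t within I))"
    by blast
qed

lemma geodesic_affine:
  assumes c: "geodesic_on M J c" and J: "(\<lambda>t. a*t+b) ` I \<subseteq> J"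
  shows "geodesic_on M I (\<lambda>t. c (a*t+b))"
proof (rule geodesicI)
  show "continuous_on I (\<lambda>t. c (a*t+b))"
    by (rule continuous_on_compose2[OF geodesic_continuous[OF c] _ J]) (intro continuous_intros)
  show "(\<lambda>t. c (a*t+b)) ` I \<subseteq> carrier M" using geodesic_carrier[OF c] J by blast
  fix \<kappa> assume k: "\<kappa> \<in> charts M"
  obtain v where v: 
    "\<And>t. t \<in> J \<Longrightarrow> c t \<in> cdom \<kappa> \<Longrightarrow> ((cmap \<kappa> \<circ> c) has_vector_derivative v t) (at t within J)"
    "\<And>t. t \<in> J \<Longrightarrow> c t \<in> cdom \<kappa> \<Longrightarrow> (v has_vector_derivative geod_acc \<kappa> (cmap \<kappa> (c t)) (v t)) (at t within J)"
    using geodesic_deriv[OF c k] by blast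
  show "\<exists>v. \<forall>t\<in>I. c (a*t+b) \<in> cdom \<kappa> \<longrightarrow>
        ((cmap \<kappa> \<circ> (\<lambda>t. c (a*t+b))) has_vector_derivative v t) (at t within I) \<and>
        (v has_vector_derivative geod_acc \<kappa> (cmap \<kappa> (c (a*t+b))) (v t)) (at t within I)"
  proof (intro exI ballI impI conjI)
    fix t assume t: "t \<in> I" "c (a*t+b) \<in> cdom \<kappa>"
    then have J': "a*t+b \<in> J" using J by blast
    show "((cmap \<kappa> \<circ> (\<lambda>t. c (a*t+b))) has_vector_derivative a *\<^sub>R v (a*t+b)) (at t within I)"
      using has_vd_affine[OF v(1)[OF J' t(2)] J] by (simp add: o_def)
    show "((\<lambda>t. a *\<^sub>R v (a*t+b)) has_vector_derivative geod_acc \<kappa> (cmap \<kappa> (c (a*t+b))) (a *\<^sub>R v (a*t+b)))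
          (at t within I)"
      using bounded_linear.has_vector_derivative[OF bounded_linear_scaleR_right[of a]
          has_vd_affine[OF v(2)[OF J' t(2)] J]]
      by (simp add: geod_acc_scale)
  qed
qed

lemma geodesic_cong:
  assumes "geodesic_on M I c" "\<And>t. t \<in> I \<Longrightarrow> c' t = c t"
  shows "geodesic_on M I c'"
proof (rule geodesicI)
  show "continuous_on I c'" using geodesic_continuous[OF assms(1)] assms(2) by (simp cong: continuous_on_cong)
  show "c' ` I \<subseteq> carrier M" using geodesic_carrier[OF assms(1)] assms(2) by auto
  fix \<kappa> assume k: "\<kappa> \<in> charts M"
  obtain v where v: 
    "\<And>t. t \<in> I \<Longrightarrow> c t \<in> cdom \<kappa> \<Longrightarrow> ((cmap \<kappa> \<circ> c) has_vector_derivative v t) (at t within I)"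
    "\<And>t. t \<in> I \<Longrightarrow> c t \<in> cdom \<kappa> \<Longrightarrow> (v has_vector_derivative geod_acc \<kappa> (cmap \<kappa> (c t)) (v t)) (at t within I)"
    using geodesic_deriv[OF assms(1) k] by blast
  have "((cmap \<kappa> \<circ> c') has_vector_derivative v t) (at t within I)"
    if "t \<in> I" "c' t \<in> cdom \<kappa>" for t
    using v(1)[of t] that assms(2) by (auto intro: has_vector_derivative_transform[rotated -1])
  then show "\<exists>v. \<forall>t\<in>I. c' t \<in> cdom \<kappa> \<longrightarrow>
        ((cmap \<kappa> \<circ> c') has_vector_derivative v t) (at t within I) \<and>
        (v has_vector_derivative geod_acc \<kappa> (cmap \<kappa> (c' t)) (v t)) (at t within I)"
    using v assms(2) by (intro exI[of _ v]) auto
qed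

text \<open>A second order equation only needs matching position and velocity at \<open>m\<close>.
  Equality of the velocities is assumed in one chart around \<open>c m\<close>;
  \<open>chart_change\<close> carries it to every other chart, where the one-sided derivatives are
  unique because \<open>m\<close> is a limit point of both pieces.\<close>

lemma geodesic_glue:
  assumes g1: "geodesic_on M I1 c" and g2: "geodesic_on M I2 c"
    and I: "I1 \<subseteq> {..m}" "I2 \<subseteq> {m..}" "m \<in> I1" "m \<in> I2"
    and nt: "at m within I1 \<noteq> bot" "at m within I2 \<noteq> bot"
    and k0: "\<kappa>0 \<in> charts M" "c m \<in> cdom \<kappa>0"
    and w: "((cmap \<kappa>0 \<circ> c) has_vector_derivative w) (at m within I1)"
       "((cmap \<kappa>0 \<circ> c) has_vector_derivative w) (at m within I2)"
  shows "geodesic_on M (I1 \<union> I2) c"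
proof (rule geodesicI)
  have "continuous (at t within (I1 \<union> I2)) c" if "t \<in> I1 \<union> I2" for t
  proof -
    consider "t < m" | "t > m" | "t = m" by linarith
    then show ?thesis
    proof cases
      case 1
      then have "at t within (I1 \<union> I2) = at t within I1"
        using I by (intro at_within_nhd[of t "{..<m}"]) auto
      then show ?thesis
        using 1 I that geodesic_continuous[OF g1] by (auto simp: continuous_on_eq_continuous_within)
    next
      case 2
      then have "at t within (I1 \<union> I2) = at t within I2"
        using I by (intro at_within_nhd[of t "{m<..}"]) auto
      then show ?thesis
        using 2 I that geodesic_continuous[OF g2] by (auto simp: continuous_on_eq_continuous_within)
    next
      case 3
      have "(c \<longlongrightarrow> c m) (at m within I1)" "(c \<longlongrightarrow> c m) (at m within I2)"
        using I geodesic_continuous[OF g1] geodesic_continuous[OF g2] by (auto simp: continuous_on)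
      then show ?thesis
        unfolding continuous_within 3 unfolding at_within_union by (rule filterlim_sup)
    qed
  qed
  then show "continuous_on (I1 \<union> I2) c" by (simp add: continuous_on_eq_continuous_within)
  show "c ` (I1 \<union> I2) \<subseteq> carrier M" using geodesic_carrier[OF g1] geodesic_carrier[OF g2] by auto
  fix \<kappa> assume k: "\<kappa> \<in> charts M"
  obtain v1 where v1: 
    "\<And>t. t \<in> I1 \<Longrightarrow> c t \<in> cdom \<kappa> \<Longrightarrow> ((cmap \<kappa> \<circ> c) has_vector_derivative v1 t) (at t within I1)"
    "\<And>t. t \<in> I1 \<Longrightarrow> c t \<in> cdom \<kappa> \<Longrightarrow> (v1 has_vector_derivative geod_acc \<kappa> (cmap \<kappa> (c t)) (v1 t)) (at t within I1)"
    using geodesic_deriv[OF g1 k] by blast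
  obtain v2 where v2: 
    "\<And>t. t \<in> I2 \<Longrightarrow> c t \<in> cdom \<kappa> \<Longrightarrow> ((cmap \<kappa> \<circ> c) has_vector_derivative v2 t) (at t within I2)"
    "\<And>t. t \<in> I2 \<Longrightarrow> c t \<in> cdom \<kappa> \<Longrightarrow> (v2 has_vector_derivative geod_acc \<kappa> (cmap \<kappa> (c t)) (v2 t)) (at t within I2)"
    using geodesic_deriv[OF g2 k] by blast
  have eq: "v1 m = v2 m" if "c m \<in> cdom \<kappa>"
  proof -
    have c1: "continuous (at m within I1) c" and c2: "continuous (at m within I2) c"
      using I geodesic_continuous[OF g1] geodesic_continuous[OF g2]
      by (auto simp: continuous_on_eq_continuous_within)
    show ?thesis
      using vector_derivative_unique_within[OF nt(1) v1(1)[OF I(3) that] chart_change[OF k0(1) k I(3) c1 k0(2) that w(1)]]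
        vector_derivative_unique_within[OF nt(2) v2(1)[OF I(4) that] chart_change[OF k0(1) k I(4) c2 k0(2) that w(2)]]
      by simp
  qed
  \<comment> \<open>At \<open>m\<close> this takes the value of \<open>v2\<close>. It equals
    \<open>v1 m\<close> only if \<open>c m\<close> lies in the chart at hand, hence the side
    condition in \<open>vI1\<close>.\<close>
  define v where "v = (\<lambda>t. if t < m then v1 t else v2 t)"
  have vI1: "v t = v1 t" if "t \<in> I1" "c m \<in> cdom \<kappa> \<or> t \<noteq> m" for t
    using that I eq by (auto simp: v_def dest!: subsetD)
  have vI2: "v t = v2 t" if "t \<in> I2" for t using that I by (auto simp: v_def)
  show "\<exists>v. \<forall>t\<in>I1 \<union> I2. c t \<in> cdom \<kappa> \<longrightarrow>
        ((cmap \<kappa> \<circ> c) has_vector_derivative v t) (at t within (I1 \<union> I2)) \<and>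
        (v has_vector_derivative geod_acc \<kappa> (cmap \<kappa> (c t)) (v t)) (at t within (I1 \<union> I2))"
  proof (intro exI ballI impI conjI)
    fix t assume t: "t \<in> I1 \<union> I2" "c t \<in> cdom \<kappa>"
    show "((cmap \<kappa> \<circ> c) has_vector_derivative v t) (at t within (I1 \<union> I2))"
    proof (rule has_vector_derivative_union_at[OF I t(1)])
      assume t1: "t \<in> I1"
      have "v t = v1 t" using vI1[OF t1] t by auto
      then show "((cmap \<kappa> \<circ> c) has_vector_derivative v t) (at t within I1)"
        using v1(1)[OF t1 t(2)] by simp
    next
      assume t2: "t \<in> I2"
      show "((cmap \<kappa> \<circ> c) has_vector_derivative v t) (at t within I2)"
        using v2(1)[OF t2 t(2)] vI2[OF t2] by simp
    qed
    show "(v has_vector_derivative geod_acc \<kappa> (cmap \<kappa> (c t)) (v t)) (at t within (I1 \<union> I2))"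
    proof (rule has_vector_derivative_union_at[OF I t(1)])
      assume t1: "t \<in> I1"
      have vt: "v t = v1 t" using vI1[OF t1] t by auto
      have ev: "\<forall>\<^sub>F s in at t within I1. v1 s = v s"
      proof (cases "t = m")
        case True
        then show ?thesis using t vI1 by (auto simp: eventually_at_filter)
      next
        case False
        then have "t < m" using I t1 by auto
        then have "\<forall>\<^sub>F s in at t within I1. s < m"
          by (auto intro!: order_tendstoD(2)[of "\<lambda>x. x"] tendsto_ident_at)
        then show ?thesis by eventually_elim (simp add: v_def)
      qed
      show "(v has_vector_derivative geod_acc \<kappa> (cmap \<kappa> (c t)) (v t)) (at t within I1)"
        using v1(2)[OF t1 t(2)] unfolding has_vector_derivative_def vt
        by (rule has_derivative_transform_eventually) (use ev vt t1 in auto)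
    next
      assume t2: "t \<in> I2"
      show "(v has_vector_derivative geod_acc \<kappa> (cmap \<kappa> (c t)) (v t)) (at t within I2)"
        by (rule has_vector_derivative_transform[OF t2 _ ]) (use vI2 v2(2) t t2 in auto)
    qed
  qed
qed

section \<open>Constancy of the speed of a geodesic\<close>

lemma metric_differentiable:
  assumes "\<kappa> \<in> charts M" "x \<in> cmap \<kappa> ` cdom \<kappa>"
  shows "(\<lambda>y. metric M \<kappa> y $ i $ j) differentiable (at x)"
proof -
  have "Ck_on (Suc 0) (cmap \<kappa> ` cdom \<kappa>) (metric M \<kappa>)"
    using metric_smooth[OF assms(1)] unfolding smooth_on_def by blast
  then have "metric M \<kappa> differentiable (at x within cmap \<kappa> ` cdom \<kappa>)"
    using assms(2) unfolding Ck_on.simps differentiable_on_def by blast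
  then have "metric M \<kappa> differentiable (at x)"
    using at_within_open[OF assms(2) chart_image_open[OF assms(1)]] by simp
  then obtain D where "(metric M \<kappa> has_derivative D) (at x)" unfolding differentiable_def by blast
  then have "((\<lambda>y. metric M \<kappa> y $ i $ j) has_derivative (\<lambda>h. D h $ i $ j)) (at x)"
    by (intro bounded_linear.has_derivative[OF bounded_linear_vec_nth])
  then show ?thesis unfolding differentiable_def by blast
qed

lemma metric_sym_entry:
  assumes "\<kappa> \<in> charts M" "x \<in> cmap \<kappa> ` cdom \<kappa>"
  shows "metric M \<kappa> x $ i $ j = metric M \<kappa> x $ j $ i"
proof -
  have "transpose (metric M \<kappa> x) $ j $ i = metric M \<kappa> x $ j $ i" using metric_sym[OF assms] by simp
  then show ?thesis by (simp add: transpose_def)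
qed

lemma partial_metric_sym:
  assumes "\<kappa> \<in> charts M" "x \<in> cmap \<kappa> ` cdom \<kappa>"
  shows "partial k (\<lambda>y. metric M \<kappa> y $ i $ j) x = partial k (\<lambda>y. metric M \<kappa> y $ j $ i) x"
proof -
  have "((\<lambda>y. metric M \<kappa> y $ j $ i) has_derivative frechet_derivative (\<lambda>y. metric M \<kappa> y $ j $ i) (at x)) (at x)"
    using metric_differentiable[OF assms] frechet_derivative_works by blast
  then have "((\<lambda>y. metric M \<kappa> y $ i $ j) has_derivative frechet_derivative (\<lambda>y. metric M \<kappa> y $ j $ i) (at x)) (at x)"
    by (rule has_derivative_transform_within_open[OF _ chart_image_open[OF assms(1)] assms(2)])
       (rule metric_sym_entry[OF assms(1)])
  from frechet_derivative_at[OF this] show ?thesis by (simp add: partial_def)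
qed

lemma metric_inv:
  assumes "\<kappa> \<in> charts M" "x \<in> cmap \<kappa> ` cdom \<kappa>"
  shows "metric M \<kappa> x ** matrix_inv (metric M \<kappa> x) = mat 1"
proof -
  have "v = 0" if "metric M \<kappa> x *v v = 0" for v
    using metric_pos[OF assms, of v] that by auto
  then have "invertible (metric M \<kappa> x)"
    by (simp add: invertible_left_inverse matrix_left_invertible_ker)
  then obtain B where "metric M \<kappa> x ** B = mat 1 \<and> B ** metric M \<kappa> x = mat 1"
    unfolding invertible_def by blast
  then show ?thesis unfolding matrix_inv_def by (rule someI2) simp
qed

text \<open>Lowering the index cancels the inverse matrix, so that the energy computation involves
  only first derivatives of the metric.\<close>

lemma christoffel_lower:
  assumes "\<kappa> \<in> charts M" "x \<in> cmap \<kappa> ` cdom \<kappa>"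
  shows "2 * (\<Sum>k\<in>UNIV. metric M \<kappa> x $ l $ k * christoffel (metric M \<kappa>) k i j x) =
    (partial i (\<lambda>y. metric M \<kappa> y $ j $ l) x + partial j (\<lambda>y. metric M \<kappa> y $ i $ l) x
          - partial l (\<lambda>y. metric M \<kappa> y $ i $ j) x)"
proof -
  define X where "X = (\<chi> l. partial i (\<lambda>y. metric M \<kappa> y $ j $ l) x + partial j (\<lambda>y. metric M \<kappa> y $ i $ l) x
          - partial l (\<lambda>y. metric M \<kappa> y $ i $ j) x)"
  have C: "christoffel (metric M \<kappa>) k i j x = (matrix_inv (metric M \<kappa> x) *v X) $ k / 2" for k
    by (simp add: christoffel_def matrix_vector_mult_def X_def)
  have "(\<Sum>k\<in>UNIV. metric M \<kappa> x $ l $ k * christoffel (metric M \<kappa>) k i j x) =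
      (metric M \<kappa> x *v (matrix_inv (metric M \<kappa> x) *v X)) $ l / 2"
    unfolding C by (simp add: matrix_vector_mult_def[of "metric M \<kappa> x"] sum_divide_distrib)
  also have "metric M \<kappa> x *v (matrix_inv (metric M \<kappa> x) *v X) = X"
    by (simp add: matrix_vector_mul_assoc metric_inv[OF assms])
  finally show ?thesis by (simp add: X_def)
qed

text \<open>Compatibility of the Levi-Civita connection with the metric: the derivative consists of
  twice the inner product of velocity and acceleration plus the derivative of the metric along the
  velocity, and by symmetry of the metric these two cancel.\<close>

lemma energy_deriv:
  assumes k: "\<kappa> \<in> charts M" "x t \<in> cmap \<kappa> ` cdom \<kappa>" 
    and x: "(x has_vector_derivative v t) (at t within I)"
    and v: "(v has_vector_derivative geod_acc \<kappa> (x t) (v t)) (at t within I)"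
  shows "((\<lambda>s. v s \<bullet> (metric M \<kappa> (x s) *v v s)) has_vector_derivative 0) (at t within I)"
proof -
  let ?g = "\<lambda>i j y. metric M \<kappa> y $ i $ j"
  let ?a = "geod_acc \<kappa> (x t) (v t)"
  let ?p = "\<lambda>k i j. partial k (?g i j) (x t)"
  have g: "((\<lambda>s. ?g i j (x s)) has_real_derivative (?p 1 i j * v t $ 1 + ?p 2 i j * v t $ 2)) (at t within I)" for i j
  proof -
    have "(?g i j has_derivative frechet_derivative (?g i j) (at (x t))) (at (x t) within x ` I)"
      using metric_differentiable[OF k] frechet_derivative_works has_derivative_at_withinI by blast
    from vector_derivative_diff_chain_within[OF x this]
    show ?thesis using frechet_derivative_partial[OF metric_differentiable[OF k], of i j "v t"]
      by (simp add: o_def has_real_derivative_iff_has_vector_derivative)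
  qed
  have vi: "((\<lambda>s. v s $ i) has_real_derivative ?a $ i) (at t within I)" for i
    using bounded_linear.has_vector_derivative[OF bounded_linear_vec_nth v]
    by (simp add: has_real_derivative_iff_has_vector_derivative)
  have low: "2 * (?g l 1 (x t) * ?a $ 1 + ?g l 2 (x t) * ?a $ 2) =
      - (\<Sum>i\<in>UNIV. \<Sum>j\<in>UNIV. (?p i j l + ?p j i l - ?p l i j) * v t $ i * v t $ j)" for l
  proof -
    have "2 * (?g l 1 (x t) * ?a $ 1 + ?g l 2 (x t) * ?a $ 2) =
      - (\<Sum>i\<in>UNIV. \<Sum>j\<in>UNIV. 2 * (\<Sum>k\<in>UNIV. ?g l k (x t) * christoffel (metric M \<kappa>) k i j (x t)) * v t $ i * v t $ j)"
      by (simp add: geod_acc_def sum_2 algebra_simps)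
    then show ?thesis by (simp only: christoffel_lower[OF k])
  qed
  have s12: "?p k 2 1 = ?p k 1 2" for k using partial_metric_sym[OF k] .
  have g12: "?g 2 1 (x t) = ?g 1 2 (x t)" using metric_sym_entry[OF k] .
  have "((\<lambda>s. v s $ 1 * (?g 1 1 (x s) * v s $ 1 + ?g 1 2 (x s) * v s $ 2)
      + v s $ 2 * (?g 2 1 (x s) * v s $ 1 + ?g 2 2 (x s) * v s $ 2)) has_real_derivative
      (?a $ 1 * (?g 1 1 (x t) * v t $ 1 + ?g 1 2 (x t) * v t $ 2) + 
       v t $ 1 * ((?p 1 1 1 * v t $ 1 + ?p 2 1 1 * v t $ 2) * v t $ 1 + ?g 1 1 (x t) * ?a $ 1 +
           (?p 1 1 2 * v t $ 1 + ?p 2 1 2 * v t $ 2) * v t $ 2 + ?g 1 2 (x t) * ?a $ 2) + 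
       ?a $ 2 * (?g 2 1 (x t) * v t $ 1 + ?g 2 2 (x t) * v t $ 2) + 
       v t $ 2 * ((?p 1 2 1 * v t $ 1 + ?p 2 2 1 * v t $ 2) * v t $ 1 + ?g 2 1 (x t) * ?a $ 1 +
           (?p 1 2 2 * v t $ 1 + ?p 2 2 2 * v t $ 2) * v t $ 2 + ?g 2 2 (x t) * ?a $ 2))) (at t within I)"
    (is "(?E has_real_derivative ?D) _")
    by (rule derivative_eq_intros g vi refl)+ (simp add: algebra_simps)
  \<comment> \<open>Regrouped so that the acceleration occurs only in the lowered combinations that
    \<open>low\<close> evaluates.\<close>
  also have "?D = v t $ 1 * (2 * (?g 1 1 (x t) * ?a $ 1 + ?g 1 2 (x t) * ?a $ 2))
       + v t $ 2 * (2 * (?g 2 1 (x t) * ?a $ 1 + ?g 2 2 (x t) * ?a $ 2))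
       + v t $ 1 * ((?p 1 1 1 * v t $ 1 + ?p 2 1 1 * v t $ 2) * v t $ 1 + (?p 1 1 2 * v t $ 1 + ?p 2 1 2 * v t $ 2) * v t $ 2)
       + v t $ 2 * ((?p 1 2 1 * v t $ 1 + ?p 2 2 1 * v t $ 2) * v t $ 1 + (?p 1 2 2 * v t $ 1 + ?p 2 2 2 * v t $ 2) * v t $ 2)"
    by (simp add: g12 algebra_simps)
  also have "\<dots> = 0"
    unfolding low sum_2 s12 by (simp add: algebra_simps)
  also have "?E = (\<lambda>s. v s \<bullet> (metric M \<kappa> (x s) *v v s))"
    by (simp add: fun_eq_iff inner_vec_def matrix_vector_mult_def sum_2)
  finally show ?thesis by (simp add: has_real_derivative_iff_has_vector_derivative)
qed

text \<open>The squared speed has derivative 0. Since the parameter interval has length 1, the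
  constant value of the speed is its integral.\<close>

lemma geodesic_speed_const:
  assumes c: "geodesic_on M {0..1} c" and t: "t \<in> {0..1}"
  shows "speed M c t = curve_length M c"
proof -
  note C1 = geodesic_C1[OF c]
  have "((\<lambda>s. (speed M c s)\<^sup>2) has_vector_derivative 0) (at t within {0..1})" if t: "t \<in> {0..1}" for t
  proof -
    define \<kappa> where "\<kappa> = chart_at M (c t)"
    have k: "\<kappa> \<in> charts M" "c t \<in> cdom \<kappa>"
      using chart_at[OF C1_carrier[OF C1 t]] by (auto simp: \<kappa>_def)
    obtain v where v: 
      "\<And>t. t \<in> {0..1} \<Longrightarrow> c t \<in> cdom \<kappa> \<Longrightarrow> ((cmap \<kappa> \<circ> c) has_vector_derivative v t) (at t within {0..1})"
      "\<And>t. t \<in> {0..1} \<Longrightarrow> c t \<in> cdom \<kappa> \<Longrightarrow> (v has_vector_derivative geod_acc \<kappa> (cmap \<kappa> (c t)) (v t)) (at t within {0..1})"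
      using geodesic_deriv[OF c k(1)] by blast
    let ?J = "{t\<in>{0..1}. c t \<in> cdom \<kappa>}"
    note w = at_within_chart_dom[OF C1_continuous[OF C1] t chart_open[OF k(1)] k(2)]
    have A: "((\<lambda>s. v s \<bullet> (metric M \<kappa> ((cmap \<kappa> \<circ> c) s) *v v s)) has_vector_derivative 0) (at t within ?J)"
      unfolding w
      by (rule energy_deriv[where x="cmap \<kappa> \<circ> c" and v=v and t=t, OF k(1) _ v(1)[OF t k(2)]]) (use k v t in auto)
    have B: "(speed M c s)\<^sup>2 = v s \<bullet> (metric M \<kappa> ((cmap \<kappa> \<circ> c) s) *v v s)" if s: "s \<in> ?J" for s
    proof -
      have "speed M c s = chart_norm M \<kappa> (cmap \<kappa> (c s)) (v s)"
        by (rule speed_eq[OF k(1)])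
          (use s v C1_continuous[OF C1] in \<open>auto simp: continuous_on_eq_continuous_within\<close>)
      moreover have "0 \<le> v s \<bullet> (metric M \<kappa> ((cmap \<kappa> \<circ> c) s) *v v s)"
        using metric_pos[OF k(1), of "cmap \<kappa> (c s)" "v s"] s by (cases "v s = 0") auto
      ultimately show ?thesis by (simp add: chart_norm_def)
    qed
    have "((\<lambda>s. (speed M c s)\<^sup>2) has_vector_derivative 0) (at t within ?J)"
      by (rule has_vector_derivative_transform[OF _ B A]) (use t k in auto)
    then show ?thesis unfolding w .
  qed
  then obtain E where E: "\<And>s. s \<in> {0..1} \<Longrightarrow> (speed M c s)\<^sup>2 = E"
    using has_vector_derivative_zero_constant[of "{0..1::real}" "\<lambda>s. (speed M c s)\<^sup>2"] by auto
  then have sp: "speed M c s = sqrt E" if "s \<in> {0..1}" for s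
    using speed_nonneg[OF that C1] E[OF that] by (metis real_sqrt_unique)
  have "((\<lambda>_. sqrt E) has_integral sqrt E) {0..1::real}"
    using has_integral_const_real[of "sqrt E" 0 1] by simp
  then have "(speed M c has_integral sqrt E) {0..1}"
    by (rule has_integral_eq[rotated]) (use sp in auto)
  then have "curve_length M c = sqrt E"
    using has_integral_unique[OF has_integral_speed[OF C1]] by simp
  then show ?thesis using sp t by simp
qed

lemma curve_length_affine:
  assumes c: "geodesic_on M {0..1} c" and im: "(\<lambda>s. a * s+b) ` {0..1} \<subseteq> {0..1}"
  shows "curve_length M (\<lambda>s. c (a * s+b)) = \<bar>a\<bar> * curve_length M c"
proof -
  have g: "geodesic_on M {0..1} (\<lambda>s. c (a * s+b))" by (rule geodesic_affine[OF c im])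
  \<comment> \<open>The constant speed is read off at \<open>1/2\<close> because
    \<open>speed_affine\<close> speaks of interior parameters.\<close>
  have "curve_length M (\<lambda>s. c (a * s+b)) = speed M (\<lambda>s. c (a * s+b)) (1/2)"
    using geodesic_speed_const[OF g, of "1/2"] by simp
  also have "\<dots> = \<bar>a\<bar> * speed M c (a*(1/2)+b)"
    by (rule speed_affine[OF geodesic_C1[OF c], of 0 _ 1]) (use im in auto)
  also have "speed M c (a*(1/2)+b) = curve_length M c"
    by (rule geodesic_speed_const[OF c]) (use im[unfolded image_subset_iff, rule_format, of "1/2"] in auto)
  finally show ?thesis .
qed

lemma curve_length_nonneg: "C1_curve_on M {0..1} c \<Longrightarrow> 0 \<le> curve_length M c"
  using has_integral_nonneg[OF has_integral_speed] speed_nonneg by blast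

end


section \<open>Uniqueness of geodesics\<close>

definition loc_lip :: "('a::real_normed_vector \<Rightarrow> 'b::real_normed_vector) \<Rightarrow> 'a \<Rightarrow> bool" where
  "loc_lip f x \<longleftrightarrow> (\<exists>L d. 0 < d \<and> (\<forall>y\<in>ball x d. \<forall>z\<in>ball x d. norm (f y - f z) \<le> L * norm (y - z)))"

lemma loc_lipI:
  assumes "0 < d" "\<And>y z. y \<in> ball x d \<Longrightarrow> z \<in> ball x d \<Longrightarrow> norm (f y - f z) \<le> L * norm (y - z)"
  shows "loc_lip f x"
  using assms unfolding loc_lip_def by blast

lemma loc_lipE:
  assumes "loc_lip f x"
  obtains L d where "0 < L" "0 < d" "\<And>y z. y \<in> ball x d \<Longrightarrow> z \<in> ball x d \<Longrightarrow> norm (f y - f z) \<le> L * norm (y - z)"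
proof -
  obtain L d where d: "0 < d" and L: "\<And>y z. y \<in> ball x d \<Longrightarrow> z \<in> ball x d \<Longrightarrow> norm (f y - f z) \<le> L * norm (y - z)"
    using assms unfolding loc_lip_def by blast
  \<comment> \<open>The given constant may be 0 or negative; enlarging it makes later divisions by
    it legitimate.\<close>
  have "norm (f y - f z) \<le> (\<bar>L\<bar> + 1) * norm (y - z)" if "y \<in> ball x d" "z \<in> ball x d" for y z
    by (rule order_trans[OF L[OF that]]) (intro mult_right_mono, auto)
  then show thesis by (intro that[of "\<bar>L\<bar>+1" d]) (use d in auto)
qed

lemma loc_lip_const: "loc_lip (\<lambda>x. c) x"
  by (rule loc_lipI[of 1 _ _ 0]) auto

lemma loc_lip_bounded_linear:
  assumes "bounded_linear h"
  shows "loc_lip h x"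
proof -
  interpret bounded_linear h by fact
  obtain K where "\<And>x. norm (h x) \<le> norm x * K" using bounded by blast
  then show ?thesis
    by (intro loc_lipI[of 1 _ _ K]) (auto simp: diff[symmetric] mult.commute)
qed

lemma loc_lip_compose:
  assumes "loc_lip g (f x)" "loc_lip f x"
  shows "loc_lip (\<lambda>y. g (f y)) x"
proof -
  obtain L d where L: "0 < L" "0 < d" "\<And>y z. y \<in> ball (f x) d \<Longrightarrow> z \<in> ball (f x) d \<Longrightarrow> norm (g y - g z) \<le> L * norm (y - z)"
    using loc_lipE[OF assms(1)] by blast
  obtain K e where K: "0 < K" "0 < e" "\<And>y z. y \<in> ball x e \<Longrightarrow> z \<in> ball x e \<Longrightarrow> norm (f y - f z) \<le> K * norm (y - z)"
    using loc_lipE[OF assms(2)] by blast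
  define r where "r = min e (d / K)"
  have r: "0 < r" "r \<le> e" "r \<le> d / K" using L K by (auto simp: r_def)
  have in_ball: "f y \<in> ball (f x) d" if "y \<in> ball x r" for y
  proof -
    have "norm (f x - f y) \<le> K * norm (x - y)" using K(3)[of x y] K(2) that r by auto
    also have "\<dots> < K * (d / K)" using that r K(1) by (intro mult_strict_left_mono) (auto simp: dist_norm)
    finally show ?thesis using K by (simp add: dist_norm)
  qed
  show ?thesis
  proof (rule loc_lipI[of r _ _ "L * K"])
    fix y z assume yz: "y \<in> ball x r" "z \<in> ball x r"
    have "norm (g (f y) - g (f z)) \<le> L * norm (f y - f z)" using L(3) in_ball yz by blast
    also have "\<dots> \<le> L * (K * norm (y - z))" using K(3)[of y z] yz r L(1) by (intro mult_left_mono) auto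
    finally show "norm (g (f y) - g (f z)) \<le> L * K * norm (y - z)" by (simp add: mult.assoc)
  qed (use r in auto)
qed

lemma loc_lip_Pair:
  assumes "loc_lip f x" "loc_lip g x"
  shows "loc_lip (\<lambda>y. (f y, g y)) x"
proof -
  obtain L d where L: "0 < L" "0 < d" "\<And>y z. y \<in> ball x d \<Longrightarrow> z \<in> ball x d \<Longrightarrow> norm (f y - f z) \<le> L * norm (y - z)"
    using loc_lipE[OF assms(1)] by blast
  obtain K e where K: "0 < K" "0 < e" "\<And>y z. y \<in> ball x e \<Longrightarrow> z \<in> ball x e \<Longrightarrow> norm (g y - g z) \<le> K * norm (y - z)"
    using loc_lipE[OF assms(2)] by blast
  show ?thesis
  proof (rule loc_lipI[of "min d e" _ _ "L + K"])
    fix y z assume yz: "y \<in> ball x (min d e)" "z \<in> ball x (min d e)"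
    have "norm ((f y, g y) - (f z, g z)) \<le> norm (f y - f z) + norm (g y - g z)"
      by (simp add: norm_Pair_le)
    also have "\<dots> \<le> L * norm (y - z) + K * norm (y - z)"
      using L(3)[of y z] K(3)[of y z] yz by (intro add_mono) auto
    finally show "norm ((f y, g y) - (f z, g z)) \<le> (L + K) * norm (y - z)" by (simp add: distrib_right)
  qed (use L K in auto)
qed

lemma loc_lip_cong:
  assumes "loc_lip f x" "open S" "x \<in> S" "\<And>y. y \<in> S \<Longrightarrow> g y = f y"
  shows "loc_lip g x"
proof -
  obtain L d where L: "0 < L" "0 < d" "\<And>y z. y \<in> ball x d \<Longrightarrow> z \<in> ball x d \<Longrightarrow> norm (f y - f z) \<le> L * norm (y - z)"
    using loc_lipE[OF assms(1)] by blast
  obtain e where e: "0 < e" "ball x e \<subseteq> S" using assms(2,3) openE by blast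
  show ?thesis 
    by (rule loc_lipI[of "min d e" _ _ L]) (use L e assms(4) in \<open>auto simp: subset_eq\<close>)
qed

text \<open>\<open>Ck_on\<close> yields continuity of the derivative for each fixed direction.
  Summing over a basis turns this into a local bound for the operator norm, and the mean value
  inequality on a convex ball finishes.\<close>

lemma C1_loc_lip:
  fixes f :: "'a::euclidean_space \<Rightarrow> 'b::real_normed_vector"
  assumes S: "open S" "x \<in> S" and f: "Ck_on (Suc 0) S f"
  shows "loc_lip f x"
proof -
  let ?D = "\<lambda>y. frechet_derivative f (at y)"
  have D: "(f has_derivative ?D y) (at y)" if "y \<in> S" for y
    using f that at_within_open[OF that S(1)] unfolding Ck_on.simps differentiable_on_def
    by (metis frechet_derivative_works)
  define N where "N = (\<lambda>y. \<Sum>b\<in>Basis. norm (?D y b))"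
  have "continuous_on S N" using f unfolding N_def by (intro continuous_intros) auto
  then have "isCont N x" using S continuous_on_eq_continuous_at by blast
  then have "\<forall>\<^sub>F y in nhds x. N y < N x + 1"
    using order_tendstoD(2)[of N "N x" "nhds x" "N x + 1"] by (simp add: continuous_at_imp_continuous_at_within isCont_def tendsto_at_iff_tendsto_nhds)
  then obtain V where V: "open V" "x \<in> V" "\<And>y. y \<in> V \<Longrightarrow> N y < N x + 1" unfolding eventually_nhds by blast
  have "open (S \<inter> V)" "x \<in> S \<inter> V" using S V by auto
  then obtain d where d: "0 < d" "ball x d \<subseteq> S \<inter> V" using openE by blast
  have bd: "onorm (?D y) \<le> N x + 1" if "y \<in> ball x d" for y
  proof (rule onorm_bound)
    show "0 \<le> N x + 1" unfolding N_def by (intro add_nonneg_nonneg sum_nonneg) auto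
    fix h :: 'a
    have y: "y \<in> S" "N y < N x + 1" using d that V by auto
    interpret linear "?D y" using D[OF y(1)] has_derivative_linear by blast
    have "?D y h = ?D y (\<Sum>b\<in>Basis. (h \<bullet> b) *\<^sub>R b)" by (simp add: euclidean_representation)
    also have "norm \<dots> \<le> (\<Sum>b\<in>Basis. norm ((h \<bullet> b) *\<^sub>R ?D y b))"
      unfolding sum scale by (rule norm_sum)
    also have "\<dots> \<le> (\<Sum>b\<in>Basis. norm h * norm (?D y b))"
      by (intro sum_mono) (auto intro!: mult_right_mono simp: Basis_le_norm)
    also have "\<dots> = N y * norm h" by (simp add: N_def sum_distrib_left mult.commute)
    also have "\<dots> \<le> (N x + 1) * norm h" using y by (intro mult_right_mono) auto
    finally show "norm (?D y h) \<le> (N x + 1) * norm h" .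
  qed
  show ?thesis
  proof (rule loc_lipI[of d _ _ "N x + 1"])
    fix y z assume "y \<in> ball x d" "z \<in> ball x d"
    then show "norm (f y - f z) \<le> (N x + 1) * norm (y - z)"
      by (intro differentiable_bound[where S="ball x d" and f'="?D"] bd convex_ball)
         (use d in \<open>auto intro!: has_derivative_at_withinI D\<close>)
  qed (use d in auto)
qed

lemma loc_lip_has_derivative:
  fixes f :: "'a::euclidean_space \<Rightarrow> 'b::real_normed_vector"
  assumes S: "open S" "x \<in> S" 
    and D: "\<And>y. y \<in> S \<Longrightarrow> (f has_derivative D y) (at y)" and c: "\<And>v. continuous_on S (\<lambda>y. D y v)"
  shows "loc_lip f x"
proof (rule C1_loc_lip[OF S])
  have "frechet_derivative f (at y) = D y" if "y \<in> S" for y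
    using frechet_derivative_at[OF D[OF that]] by simp
  then show "Ck_on (Suc 0) S f"
    using D c by (auto simp: differentiable_on_def differentiable_def intro: has_derivative_at_withinI
        cong: continuous_on_cong)
qed

lemma loc_lip_add: "loc_lip f x \<Longrightarrow> loc_lip g x \<Longrightarrow> loc_lip (\<lambda>y. f y + g y) x"
  using loc_lip_compose[OF loc_lip_bounded_linear loc_lip_Pair, of "\<lambda>p. fst p + snd p" f x g]
  by (simp add: bounded_linear_add bounded_linear_fst bounded_linear_snd)

lemma loc_lip_minus: "loc_lip f x \<Longrightarrow> loc_lip (\<lambda>y. - f y) x"
  using loc_lip_compose[OF loc_lip_bounded_linear[OF bounded_linear_minus[OF bounded_linear_ident]]] .

lemma loc_lip_diff: "loc_lip f x \<Longrightarrow> loc_lip g x \<Longrightarrow> loc_lip (\<lambda>y. f y - g y) x"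
  using loc_lip_add[OF _ loc_lip_minus, of f x g] by simp

lemma loc_lip_mult:
  fixes f g :: "'a::real_normed_vector \<Rightarrow> real"
  assumes "loc_lip f x" "loc_lip g x"
  shows "loc_lip (\<lambda>y. f y * g y) x"
proof -
  have "loc_lip (\<lambda>p::real\<times>real. fst p * snd p) (f x, g x)"
    by (rule loc_lip_has_derivative[of UNIV _ _ "\<lambda>p h. fst p * snd h + fst h * snd p"])
       (auto intro!: derivative_eq_intros continuous_intros)
  from loc_lip_compose[OF this loc_lip_Pair[OF assms]] show ?thesis by simp
qed

lemma loc_lip_divide:
  fixes f g :: "'a::real_normed_vector \<Rightarrow> real"
  assumes "loc_lip f x" "loc_lip g x" "g x \<noteq> 0"
  shows "loc_lip (\<lambda>y. f y / g y) x"
proof -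
  have "loc_lip (\<lambda>r::real. inverse r) (g x)"
    by (rule loc_lip_has_derivative[of "- {0}" _ _ "\<lambda>r h. - (inverse r * h * inverse r)"])
       (use assms(3) in \<open>auto intro!: derivative_eq_intros continuous_intros\<close>)
  from loc_lip_mult[OF assms(1) loc_lip_compose[OF this assms(2)]]
  show ?thesis by (simp add: divide_inverse)
qed

lemma loc_lip_sum:
  "(\<And>i. i \<in> A \<Longrightarrow> loc_lip (f i) x) \<Longrightarrow> loc_lip (\<lambda>y. \<Sum>i\<in>A. f i y) x"
  by (induction A rule: infinite_finite_induct) (auto intro!: loc_lip_const loc_lip_add)

lemma loc_lip_nth: "loc_lip f x \<Longrightarrow> loc_lip (\<lambda>y. f y $ i) x"
  using loc_lip_compose[OF loc_lip_bounded_linear[OF bounded_linear_vec_nth]] .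

lemma loc_lip_vec:
  fixes f :: "'a::real_normed_vector \<Rightarrow> real^'n"
  assumes "\<And>i. loc_lip (\<lambda>y. f y $ i) x"
  shows "loc_lip f x"
proof -
  have "loc_lip (\<lambda>y. \<Sum>i\<in>UNIV. (f y $ i) *\<^sub>R axis i (1::real)) x"
    by (intro loc_lip_sum loc_lip_compose[OF loc_lip_bounded_linear[OF bounded_linear_scaleR_left] assms])
  moreover have "(\<Sum>i\<in>UNIV. (f y $ i) *\<^sub>R axis i (1::real)) = f y" for y
    using basis_expansion[of "f y"] by (simp add: scalar_mult_eq_scaleR)
  ultimately show ?thesis by simp
qed

text \<open>In place of a Gronwall estimate: on a short interval the mean value inequality bounds
  the maximum of the difference by half of itself, so it vanishes.\<close>

lemma ode_unique_local:
  fixes y1 y2 :: "real \<Rightarrow> 'a::real_normed_vector"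
  assumes F: "loc_lip F (y1 m)" and "m < b" "y1 m = y2 m"
    and d1: "\<And>t. t \<in> {m..b} \<Longrightarrow> (y1 has_vector_derivative F (y1 t)) (at t within {m..b})"
    and d2: "\<And>t. t \<in> {m..b} \<Longrightarrow> (y2 has_vector_derivative F (y2 t)) (at t within {m..b})"
  obtains d where "0 < d" "m + d \<le> b" "\<And>t. t \<in> {m..m+d} \<Longrightarrow> y1 t = y2 t"
proof -
  obtain L r where L: "0 < L" "0 < r" 
    "\<And>y z. y \<in> ball (y1 m) r \<Longrightarrow> z \<in> ball (y1 m) r \<Longrightarrow> norm (F y - F z) \<le> L * norm (y - z)"
    using loc_lipE[OF F] by blast
  have "\<exists>e>0. \<forall>t\<in>{m..b}. dist t m < e \<longrightarrow> y t \<in> ball (y1 m) r"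
    if "y m = y1 m" "(y has_vector_derivative D) (at m within {m..b})" for y D
    using has_vector_derivative_continuous[OF that(2)] L(2) that(1)
    unfolding continuous_within_eps_delta by (auto simp: dist_commute)
  then obtain e1 e2 where e: "0 < e1" "0 < e2"
    "\<And>t. t \<in> {m..b} \<Longrightarrow> dist t m < e1 \<Longrightarrow> y1 t \<in> ball (y1 m) r"
    "\<And>t. t \<in> {m..b} \<Longrightarrow> dist t m < e2 \<Longrightarrow> y2 t \<in> ball (y1 m) r"
    using d1[of m] d2[of m] assms(2,3) by (metis atLeastAtMost_iff less_imp_le order_refl)
  \<comment> \<open>\<open>e1\<close> and \<open>e2\<close> keep both solutions in the ball where
    \<open>F\<close> is Lipschitz; \<open>1/(2*L)\<close> produces the factor 1/2.\<close>
  define d where "d = Min {e1/2, e2/2, b - m, 1/(2*L)}"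
  have d: "0 < d" "d < e1" "d < e2" "m + d \<le> b" "L * d \<le> 1/2"
  proof -
    show "0 < d" "m + d \<le> b" using e assms(2) L(1) by (auto simp: d_def)
    have "d \<le> e1/2" "d \<le> e2/2" "d \<le> 1/(2*L)" unfolding d_def by (rule Min_le; simp)+
    then show "d < e1" "d < e2" "L * d \<le> 1/2" using e L(1) by (auto simp: field_simps)
  qed
  let ?J = "{m..m+d}"
  let ?z = "\<lambda>t. y1 t - y2 t"
  have z: "(?z has_vector_derivative (F (y1 t) - F (y2 t))) (at t within ?J)" if "t \<in> ?J" for t
    using that d by (intro has_vector_derivative_diff has_vector_derivative_within_subset[OF d1, of _ ?J]
       has_vector_derivative_within_subset[OF d2, of _ ?J]) auto
  have "continuous_on ?J ?z"
    using z has_vector_derivative_continuous continuous_on_eq_continuous_within by blast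
  then have "continuous_on ?J (\<lambda>t. norm (?z t))" by (rule continuous_on_norm)
  then obtain s where s: "s \<in> ?J" "\<And>t. t \<in> ?J \<Longrightarrow> norm (?z t) \<le> norm (?z s)"
    using continuous_attains_sup[of ?J "\<lambda>t. norm (?z t)"] d(1) by auto
  have "norm (?z s - ?z m) \<le> L * norm (?z s) * norm (s - m)"
  proof (rule differentiable_bound[of ?J ?z "\<lambda>t h. h *\<^sub>R (F (y1 t) - F (y2 t))"])
    fix t assume t: "t \<in> ?J"
    show "(?z has_derivative (\<lambda>h. h *\<^sub>R (F (y1 t) - F (y2 t)))) (at t within ?J)"
      using z[OF t] by (simp add: has_vector_derivative_def)
    have "norm (F (y1 t) - F (y2 t)) \<le> L * norm (?z t)"
      using t d e by (intro L(3)) (auto simp: dist_real_def)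
    also have "\<dots> \<le> L * norm (?z s)" using s(2)[OF t] L(1) by simp
    finally show "onorm (\<lambda>h. h *\<^sub>R (F (y1 t) - F (y2 t))) \<le> L * norm (?z s)"
      using L(1) by (intro onorm_bound) (auto simp: mult.commute[of "L * _"] mult_left_mono)
  qed (use s d in auto)
  also have "\<dots> = (L * (s - m)) * norm (?z s)" using s by simp
  also have "L * (s - m) \<le> L * d" using s L(1) by simp
  also have "L * d \<le> 1/2" by (rule d)
  finally have "norm (?z s) \<le> 1/2 * norm (?z s)" using assms(3) by (simp add: mult_right_mono)
  then have "norm (?z s) = 0" by simp
  then have "y1 t = y2 t" if "t \<in> ?J" for t using s(2)[OF that] by simp
  then show thesis using that d by blast
qed

context riem_surface
begin

section \<open>Regularity of the geodesic equation and unique continuation\<close>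

lemma loc_lip_metric:
  assumes "\<kappa> \<in> charts M" "x \<in> cmap \<kappa> ` cdom \<kappa>"
  shows "loc_lip (\<lambda>y. metric M \<kappa> y $ i $ j) x"
proof -
  have "Ck_on (Suc 0) (cmap \<kappa> ` cdom \<kappa>) (metric M \<kappa>)"
    using metric_smooth[OF assms(1)] unfolding smooth_on_def by blast
  from C1_loc_lip[OF chart_image_open[OF assms(1)] assms(2) this]
  show ?thesis by (intro loc_lip_nth)
qed

lemma loc_lip_partial_metric:
  assumes "\<kappa> \<in> charts M" "x \<in> cmap \<kappa> ` cdom \<kappa>"
  shows "loc_lip (partial k (\<lambda>y. metric M \<kappa> y $ i $ j)) x"
proof -
  let ?S = "cmap \<kappa> ` cdom \<kappa>"
  have "Ck_on (Suc (Suc 0)) ?S (metric M \<kappa>)"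
    using metric_smooth[OF assms(1)] unfolding smooth_on_def by blast
  then have d: "metric M \<kappa> differentiable_on ?S"
    and "Ck_on (Suc 0) ?S (\<lambda>x. frechet_derivative (metric M \<kappa>) (at x) (axis k 1))"
    unfolding Ck_on.simps(2)[of "Suc 0"] by blast+
  from C1_loc_lip[OF chart_image_open[OF assms(1)] assms(2) this(2)]
  have "loc_lip (\<lambda>x. frechet_derivative (metric M \<kappa>) (at x) (axis k 1) $ i $ j) x"
    by (intro loc_lip_nth)
  then show ?thesis
  proof (rule loc_lip_cong[OF _ chart_image_open[OF assms(1)] assms(2)])
    fix y assume y: "y \<in> ?S"
    have "(metric M \<kappa> has_derivative frechet_derivative (metric M \<kappa>) (at y)) (at y)"
      using d y at_within_open[OF y chart_image_open[OF assms(1)]]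
      unfolding differentiable_on_def by (metis frechet_derivative_works)
    then have "((\<lambda>y. metric M \<kappa> y $ i $ j) has_derivative (\<lambda>h. frechet_derivative (metric M \<kappa>) (at y) h $ i $ j)) (at y)"
      by (intro bounded_linear.has_derivative[OF bounded_linear_vec_nth])
    from frechet_derivative_at[OF this, symmetric]
    show "partial k (\<lambda>y. metric M \<kappa> y $ i $ j) y = frechet_derivative (metric M \<kappa>) (at y) (axis k 1) $ i $ j"
      by (simp add: partial_def)
  qed
qed

text \<open>\<open>matrix_inv\<close> is given by a choice operator; its regularity becomes visible
  through Cramer's formula.\<close>

lemma metric_inv_entries:
  assumes "\<kappa> \<in> charts M" "x \<in> cmap \<kappa> ` cdom \<kappa>"
  defines "G \<equiv> metric M \<kappa> x"
  defines "d \<equiv> G$1$1 * G$2$2 - G$1$2 * G$2$1"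
  shows "d \<noteq> 0" "matrix_inv G $ 1 $ 1 = G$2$2 / d" "matrix_inv G $ 1 $ 2 = - G$1$2 / d"
    "matrix_inv G $ 2 $ 1 = - G$2$1 / d" "matrix_inv G $ 2 $ 2 = G$1$1 / d"
proof -
  let ?H = "matrix_inv G"
  have GH: "G ** ?H = mat 1" unfolding G_def by (rule metric_inv[OF assms(1,2)])
  have "det G * det ?H = 1" using GH by (metis det_I det_mul)
  then show d: "d \<noteq> 0" by (auto simp: d_def det_2)
  have e: "(G ** ?H) $ i $ j = G$i$1 * ?H$1$j + G$i$2 * ?H$2$j" for i j
    by (simp add: matrix_matrix_mult_def sum_2)
  have e11: "G$1$1 * ?H$1$1 + G$1$2 * ?H$2$1 = 1" and e12: "G$1$1 * ?H$1$2 + G$1$2 * ?H$2$2 = 0"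
    and e21: "G$2$1 * ?H$1$1 + G$2$2 * ?H$2$1 = 0" and e22: "G$2$1 * ?H$1$2 + G$2$2 * ?H$2$2 = 1"
    using e[of 1 1] e[of 1 2] e[of 2 1] e[of 2 2] unfolding GH by (simp_all add: mat_def)
  show "?H $ 1 $ 1 = G$2$2 / d" "?H $ 2 $ 1 = - G$2$1 / d"
    by (rule eq_divide_imp[OF d]; use e11 e21 in \<open>unfold d_def; algebra\<close>)+
  show "?H $ 1 $ 2 = - G$1$2 / d" "?H $ 2 $ 2 = G$1$1 / d"
    by (rule eq_divide_imp[OF d]; use e12 e22 in \<open>unfold d_def; algebra\<close>)+
qed

lemma loc_lip_metric_inv:
  assumes k: "\<kappa> \<in> charts M" "x \<in> cmap \<kappa> ` cdom \<kappa>"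
  shows "loc_lip (\<lambda>y. matrix_inv (metric M \<kappa> y) $ i $ j) x"
proof -
  let ?g = "\<lambda>i j y. metric M \<kappa> y $ i $ j"
  let ?d = "\<lambda>y. ?g 1 1 y * ?g 2 2 y - ?g 1 2 y * ?g 2 1 y"
  have l: "loc_lip (\<lambda>y. h y / ?d y) x" if "loc_lip h x" for h
    using metric_inv_entries(1)[OF k]
    by (intro loc_lip_divide loc_lip_diff loc_lip_mult loc_lip_metric k that) auto
  note c = loc_lip_cong[OF _ chart_image_open[OF k(1)] k(2)]
  note e = metric_inv_entries[OF k(1)]
  have "loc_lip (\<lambda>y. matrix_inv (metric M \<kappa> y) $ 1 $ 1) x"
    "loc_lip (\<lambda>y. matrix_inv (metric M \<kappa> y) $ 1 $ 2) x"
    "loc_lip (\<lambda>y. matrix_inv (metric M \<kappa> y) $ 2 $ 1) x"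
    "loc_lip (\<lambda>y. matrix_inv (metric M \<kappa> y) $ 2 $ 2) x"
    by (rule c[OF l e(2)], rule loc_lip_metric[OF k], assumption)
       (rule c[OF l e(3)], rule loc_lip_minus, rule loc_lip_metric[OF k], assumption,
        rule c[OF l e(4)], rule loc_lip_minus, rule loc_lip_metric[OF k], assumption,
        rule c[OF l e(5)], rule loc_lip_metric[OF k], assumption)
  then show ?thesis using exhaust_2[of i] exhaust_2[of j] by auto
qed

lemma loc_lip_christoffel:
  assumes "\<kappa> \<in> charts M" "x \<in> cmap \<kappa> ` cdom \<kappa>"
  shows "loc_lip (christoffel (metric M \<kappa>) k i j) x"
  unfolding christoffel_def[abs_def]
  by (intro loc_lip_divide loc_lip_sum loc_lip_mult loc_lip_diff loc_lip_add loc_lip_const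
      loc_lip_metric_inv loc_lip_partial_metric assms) simp

lemma loc_lip_geodesic_field:
  assumes k: "\<kappa> \<in> charts M" "fst p \<in> cmap \<kappa> ` cdom \<kappa>"
  shows "loc_lip (\<lambda>p. (snd p, geod_acc \<kappa> (fst p) (snd p))) p"
proof -
  have s: "loc_lip snd p" by (rule loc_lip_bounded_linear[OF bounded_linear_snd])
  have c: "loc_lip (\<lambda>p. christoffel (metric M \<kappa>) k i j (fst p)) p" for k i j
    by (rule loc_lip_compose[OF loc_lip_christoffel[OF k] loc_lip_bounded_linear[OF bounded_linear_fst]])
  show ?thesis
    by (rule loc_lip_Pair[OF s], rule loc_lip_vec)
       (auto simp: geod_acc_def intro!: loc_lip_minus loc_lip_sum loc_lip_mult loc_lip_nth s c)
qed

text \<open>Let \<open>T\<close> be the supremum of the times up to which the curves agree.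
  Positions and velocities at \<open>T\<close> are limits from the past, hence equal, and local
  uniqueness in a chart pushes the agreement beyond \<open>T\<close>. Assuming agreement on a
  nontrivial initial interval keeps charts and velocities out of the statement.\<close>

lemma geodesic_unique:
  assumes c1: "geodesic_on M {0..b} c1" and c2: "geodesic_on M {0..b} c2"
    and m: "0 < m" "m \<le> b" and eq: "\<And>t. t \<in> {0..m} \<Longrightarrow> c1 t = c2 t" and t: "t \<in> {0..b}"
  shows "c1 t = c2 t"
proof -
  define A where "A = {t\<in>{m..b}. \<forall>s\<in>{0..t}. c1 s = c2 s}"
  define T where "T = Sup A"
  have mA: "m \<in> A" using m eq by (auto simp: A_def)
  have bA: "bdd_above A" unfolding A_def by (rule bdd_aboveI[of _ b]) auto
  have T: "m \<le> T" "T \<le> b"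
  proof -
    show "m \<le> T" unfolding T_def by (rule cSup_upper[OF mA bA])
    show "T \<le> b" unfolding T_def by (rule cSup_least) (use mA in \<open>auto simp: A_def\<close>)
  qed
  have below: "c1 s = c2 s" if "s \<in> {0..<T}" for s
  proof -
    have "\<exists>a\<in>A. s < a" using that mA bA less_cSup_iff[of A s] unfolding T_def by auto
    then show ?thesis using that by (auto simp: A_def)
  qed
  have nt: "at T within {0..<T} \<noteq> bot" using T m by (simp add: trivial_limit_within islimpt_Ico)
  have eqT: "c1 T = c2 T"
  proof (rule tendsto_unique[OF nt])
    have sub: "{0..<T} \<subseteq> {0..b}" "T \<in> {0..b}" using T m by auto
    have "(c1 \<longlongrightarrow> c1 T) (at T within {0..<T})"
      using geodesic_continuous[OF c1] sub(2) unfolding continuous_on_def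
      by (intro tendsto_within_subset[OF _ sub(1)]) blast
    then show "(c2 \<longlongrightarrow> c1 T) (at T within {0..<T})"
      by (rule Lim_transform_within[of _ _ _ _ 1]) (use below in auto)
    show "(c2 \<longlongrightarrow> c2 T) (at T within {0..<T})"
      using geodesic_continuous[OF c2] sub(2) unfolding continuous_on_def
      by (intro tendsto_within_subset[OF _ sub(1)]) blast
  qed
  have TA: "c1 s = c2 s" if "s \<in> {0..T}" for s using below eqT that by (cases "s = T") auto
  have "T = b"
  proof (rule ccontr)
    assume "T \<noteq> b"
    then have Tb: "T < b" using T by simp
    have T0: "T \<in> {0..b}" using T m by auto
    define \<kappa> where "\<kappa> = chart_at M (c1 T)"
    have k: "\<kappa> \<in> charts M" "c1 T \<in> cdom \<kappa>" "c2 T \<in> cdom \<kappa>"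
      using chart_at[OF geodesic_carrier[OF c1 T0]] eqT by (auto simp: \<kappa>_def)
    obtain v1 where v1: 
      "\<And>t. t \<in> {0..b} \<Longrightarrow> c1 t \<in> cdom \<kappa> \<Longrightarrow> ((cmap \<kappa> \<circ> c1) has_vector_derivative v1 t) (at t within {0..b})"
      "\<And>t. t \<in> {0..b} \<Longrightarrow> c1 t \<in> cdom \<kappa> \<Longrightarrow> (v1 has_vector_derivative geod_acc \<kappa> (cmap \<kappa> (c1 t)) (v1 t)) (at t within {0..b})"
      using geodesic_deriv[OF c1 k(1)] by blast
    obtain v2 where v2: 
      "\<And>t. t \<in> {0..b} \<Longrightarrow> c2 t \<in> cdom \<kappa> \<Longrightarrow> ((cmap \<kappa> \<circ> c2) has_vector_derivative v2 t) (at t within {0..b})"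
      "\<And>t. t \<in> {0..b} \<Longrightarrow> c2 t \<in> cdom \<kappa> \<Longrightarrow> (v2 has_vector_derivative geod_acc \<kappa> (cmap \<kappa> (c2 t)) (v2 t)) (at t within {0..b})"
      using geodesic_deriv[OF c2 k(1)] by blast
    have sub: "{0..T} \<subseteq> {0..b}" using T by auto
    \<comment> \<open>Both are derivatives from the left of the same function; the past is
      nontrivial because \<open>T\<close> is at least \<open>m > 0\<close>.\<close>
    have "v1 T = v2 T"
    proof (rule vector_derivative_unique_within)
      show "at T within {0..T} \<noteq> bot" using T m by (simp add: trivial_limit_within islimpt_Icc)
      have "((cmap \<kappa> \<circ> c1) has_vector_derivative v1 T) (at T within {0..T})"
        using has_vector_derivative_within_subset[OF v1(1)[OF T0 k(2)] sub] .
      then show "((cmap \<kappa> \<circ> c2) has_vector_derivative v1 T) (at T within {0..T})"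
        by (rule has_vector_derivative_transform[rotated -1]) (use TA T m in auto)
      show "((cmap \<kappa> \<circ> c2) has_vector_derivative v2 T) (at T within {0..T})"
        using has_vector_derivative_within_subset[OF v2(1)[OF T0 k(3)] sub] .
    qed
    have "\<forall>\<^sub>F s in at T within {0..b}. c1 s \<in> cdom \<kappa>" "\<forall>\<^sub>F s in at T within {0..b}. c2 s \<in> cdom \<kappa>"
      using geodesic_continuous[OF c1] geodesic_continuous[OF c2] T0 k
      by (auto intro!: eventually_in_open[OF _ chart_open] simp: continuous_on_eq_continuous_within)
    then have "\<forall>\<^sub>F s in at T within {0..b}. c1 s \<in> cdom \<kappa> \<and> c2 s \<in> cdom \<kappa>" by eventually_elim auto
    then obtain e where e: "0 < e" "\<And>s. s \<in> {0..b} \<Longrightarrow> s \<noteq> T \<Longrightarrow> dist s T < e \<Longrightarrow> c1 s \<in> cdom \<kappa> \<and> c2 s \<in> cdom \<kappa>"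
      unfolding eventually_at by blast
    \<comment> \<open>Up to \<open>B\<close> both curves stay in one chart; \<open>e\<close> is
      halved since it bounds distances strictly.\<close>
    define B where "B = min b (T + e/2)"
    have B: "T < B" "B \<le> b" "{T..B} \<subseteq> {0..b}" using Tb e T m by (auto simp: B_def)
    have dom: "c1 s \<in> cdom \<kappa>" "c2 s \<in> cdom \<kappa>" if "s \<in> {T..B}" for s
      using e(2)[of s] k that B T e(1) m unfolding B_def dist_real_def by (cases "s = T"; simp)+
    let ?F = "\<lambda>p. (snd p, geod_acc \<kappa> (fst p) (snd p))"
    obtain d where d: "0 < d" "T + d \<le> B"
      "\<And>t. t \<in> {T..T+d} \<Longrightarrow> ((cmap \<kappa> \<circ> c1) t, v1 t) = ((cmap \<kappa> \<circ> c2) t, v2 t)"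
    proof (rule ode_unique_local[of ?F "\<lambda>t. ((cmap \<kappa> \<circ> c1) t, v1 t)" T B "\<lambda>t. ((cmap \<kappa> \<circ> c2) t, v2 t)"])
      show "loc_lip ?F ((cmap \<kappa> \<circ> c1) T, v1 T)"
        by (rule loc_lip_geodesic_field[OF k(1)]) (use k in auto)
      fix t assume t: "t \<in> {T..B}"
      have tb: "t \<in> {0..b}" using t B by auto
      show "((\<lambda>t. ((cmap \<kappa> \<circ> c1) t, v1 t)) has_vector_derivative ?F ((cmap \<kappa> \<circ> c1) t, v1 t)) (at t within {T..B})"
        using has_vector_derivative_within_subset[OF
            has_vector_derivative_Pair[OF v1(1)[OF tb dom(1)[OF t]] v1(2)[OF tb dom(1)[OF t]]] B(3)]
        by simp
      show "((\<lambda>t. ((cmap \<kappa> \<circ> c2) t, v2 t)) has_vector_derivative ?F ((cmap \<kappa> \<circ> c2) t, v2 t)) (at t within {T..B})"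
        using has_vector_derivative_within_subset[OF
            has_vector_derivative_Pair[OF v2(1)[OF tb dom(2)[OF t]] v2(2)[OF tb dom(2)[OF t]]] B(3)]
        by simp
    qed (use B \<open>v1 T = v2 T\<close> eqT in auto)
    have "c1 t = c2 t" if "t \<in> {T..T+d}" for t
    proof -
      have "t \<in> {T..B}" using that d(2) by auto
      then show ?thesis using d(3)[OF that] dom[of t] cinv_cmap[OF k(1)] by (metis Pair_inject comp_apply)
    qed
    then have "c1 s = c2 s" if "s \<in> {0..T+d}" for s
      using TA that by (cases "s \<le> T") auto
    then have "T + d \<in> A" using T d B by (auto simp: A_def)
    then show False using cSup_upper[OF _ bA, of "T+d"] d(1) by (simp add: T_def)
  qed
  then show ?thesis using TA t by simp
qed

end


section \<open>Segments in a uniquely geodesic disk\<close>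

context riem_surface
begin

lemma curve_length_cong:
  assumes c: "C1_curve_on M {0..1} c" and e: "\<And>t. t \<in> {0..1} \<Longrightarrow> c' t = c t"
  shows "curve_length M c' = curve_length M c"
proof -
  have "(speed M c' has_integral curve_length M c) {0..1}"
  proof (rule has_integral_spike_finite[OF _ _ has_integral_speed[OF c]])
    show "finite {0,1::real}" by simp
    fix t :: real assume "t \<in> {0..1} - {0,1}"
    then show "speed M c' t = speed M c t"
      using speed_affine[OF c, of 0 t 1 1 0 c'] e by auto
  qed
  then show ?thesis unfolding curve_length_eq[of c'] by (rule integral_unique)
qed

lemma C1_curve_between:
  assumes "C1_curve_on M {0..1} c"
  shows "curve_between M (c 0) (c 1) c"
  unfolding curve_between_def
proof (intro conjI exI[of _ "{}"] allI impI)
  fix a b :: real assume "0 \<le> a \<and> a < b \<and> b \<le> 1 \<and> {a<..<b} \<inter> {} = {}"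
  then show "C1_curve_on M {a..b} c"
    using C1_affine[OF assms, of 1 0 "{a..b}"] by auto
qed auto

lemma velocity_affine:
  assumes c: "C1_curve_on M {0..1} c" and im: "(\<lambda>s. a * s+b) ` {0..1} \<subseteq> {0..1}"
    and c': "\<And>s. s \<in> {0..1} \<Longrightarrow> c' s = c (a * s+b)"
  shows "velocity M c' 0 = a *\<^sub>R velocity M c b"
proof -
  have b: "b \<in> {0..1}" using im[unfolded image_subset_iff, rule_format, of 0] by auto
  define \<kappa> where "\<kappa> = chart_at M (c b)"
  have k: "\<kappa> \<in> charts M" "c b \<in> cdom \<kappa>"
    using chart_at[OF C1_carrier[OF c b]] by (auto simp: \<kappa>_def)
  obtain v where v: 
    "\<And>t. t \<in> {0..1} \<Longrightarrow> c t \<in> cdom \<kappa> \<Longrightarrow> ((cmap \<kappa> \<circ> c) has_vector_derivative v t) (at t within {0..1})"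
    using C1_deriv[OF c k(1)] by blast
  have d: "((cmap \<kappa> \<circ> c) has_vector_derivative v b) (at b within {0..1})" by (rule v[OF b k(2)])
  then have 1: "velocity M c b = v b"
    using velocity_chart_at[OF b] by (simp add: \<kappa>_def)
  have "((\<lambda>s. (cmap \<kappa> \<circ> c) (a * s+b)) has_vector_derivative a *\<^sub>R v b) (at 0 within {0..1})"
    by (rule has_vd_affine[OF _ im]) (simp only: mult_zero_right add_0_left d)
  then have "((cmap \<kappa> \<circ> c') has_vector_derivative a *\<^sub>R v b) (at 0 within {0..1})"
    by (rule has_vector_derivative_transform[rotated -1]) (use c' in auto)
  moreover have "c' 0 = c b" using c'[of 0] by simp
  ultimately show ?thesis using velocity_chart_at[of 0 c' "a *\<^sub>R v b"] 1 by (simp add: \<kappa>_def)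
qed

text \<open>Zero length means zero speed, so the coordinate velocity vanishes by positive
  definiteness. The curve is then locally constant, and constant because the interval is connected.
  This is what makes distances of distinct points positive.\<close>

lemma geodesic_const_of_length_0:
  assumes c: "geodesic_on M {0..1} c" and "curve_length M c = 0"
  shows "c 0 = c 1"
proof -
  note C1 = geodesic_C1[OF c]
  have "c constant_on {0..1}"
  proof (rule locally_constant_imp_constant)
    fix t :: real assume t: "t \<in> {0..1}"
    define \<kappa> where "\<kappa> = chart_at M (c t)"
    have k: "\<kappa> \<in> charts M" "c t \<in> cdom \<kappa>"
      using chart_at[OF C1_carrier[OF C1 t]] by (auto simp: \<kappa>_def)
    obtain v where v: 
      "\<And>t. t \<in> {0..1} \<Longrightarrow> c t \<in> cdom \<kappa> \<Longrightarrow> ((cmap \<kappa> \<circ> c) has_vector_derivative v t) (at t within {0..1})"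
      using C1_deriv[OF C1 k(1)] by blast
    have "\<forall>\<^sub>F s in at t within {0..1}. c s \<in> cdom \<kappa>"
      using C1_continuous[OF C1] t k
      by (auto intro!: eventually_in_open[OF _ chart_open] simp: continuous_on_eq_continuous_within)
    then obtain e where e: "0 < e" "\<And>s. s \<in> {0..1} \<Longrightarrow> s \<noteq> t \<Longrightarrow> dist s t < e \<Longrightarrow> c s \<in> cdom \<kappa>"
      unfolding eventually_at by blast
    let ?J = "{0..1} \<inter> ball t e"
    have dom: "c s \<in> cdom \<kappa>" if "s \<in> ?J" for s
      using that e(2)[of s] k by (cases "s = t") (auto simp: dist_commute)
    have v0: "v s = 0" if s: "s \<in> ?J" for s
    proof -
      have "speed M c s = chart_norm M \<kappa> (cmap \<kappa> (c s)) (v s)"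
        by (rule speed_eq[OF k(1)])
          (use s v dom C1_continuous[OF C1] in \<open>auto simp: continuous_on_eq_continuous_within\<close>)
      then have "chart_norm M \<kappa> (cmap \<kappa> (c s)) (v s) = 0"
        using geodesic_speed_const[OF c, of s] s assms(2) by simp
      then show ?thesis
        using metric_pos[OF k(1), of "cmap \<kappa> (c s)" "v s"] dom[OF s] by (auto simp: chart_norm_def)
    qed
    have "((cmap \<kappa> \<circ> c) has_vector_derivative 0) (at s within ?J)" if "s \<in> ?J" for s
      using has_vector_derivative_within_subset[OF v[of s], of ?J] v0[OF that] dom[OF that] that by auto
    moreover have "convex ?J" by (intro convex_Int convex_ball) auto
    ultimately obtain C where C: "\<And>s. s \<in> ?J \<Longrightarrow> (cmap \<kappa> \<circ> c) s = C"
      using has_vector_derivative_zero_constant[of ?J "cmap \<kappa> \<circ> c"] by blast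
    have tJ: "t \<in> ?J" using t e by auto
    have "c t = c s" if "s \<in> ?J" for s
      using C[OF that] C[OF tJ] cinv_cmap[OF k(1) dom[OF that]] cinv_cmap[OF k(1) dom[OF tJ]] by simp
    then show "\<exists>T. openin (top_of_set {0..1}) T \<and> t \<in> T \<and> (\<forall>s\<in>T. c s = c t)"
      using tJ by (intro exI[of _ ?J] conjI openin_open_Int open_ball ballI) simp_all
  qed auto
  then show ?thesis unfolding constant_on_def by auto
qed

end

locale geodesic_disk = riem_surface M
  for M :: "'a::{t2_space,second_countable_topology} surface" +
  fixes U :: "'a set"
  assumes disk: "uniquely_geodesic_disk M U"
    and complete: "complete_surface M"
begin

lemma U_open: "open U" and U_carrier: "U \<subseteq> carrier M"
  using disk unfolding uniquely_geodesic_disk_def by auto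

lemma geod_in: "P \<in> U \<Longrightarrow> Q \<in> U \<Longrightarrow> P \<noteq> Q \<Longrightarrow> geodesic_in M U P Q (geod M U P Q)"
proof -
  assume "P \<in> U" "Q \<in> U" "P \<noteq> Q"
  then have "\<exists>!c. geodesic_in M U P Q c" using disk unfolding uniquely_geodesic_disk_def by simp
  then show ?thesis unfolding geod_def by (rule theI')
qed

lemma geod_geodesic: "P \<in> U \<Longrightarrow> Q \<in> U \<Longrightarrow> P \<noteq> Q \<Longrightarrow> geodesic_on M {0..1} (geod M U P Q)"
  and geod_U: "P \<in> U \<Longrightarrow> Q \<in> U \<Longrightarrow> P \<noteq> Q \<Longrightarrow> t \<in> {0..1} \<Longrightarrow> geod M U P Q t \<in> U"
  and geod_0: "P \<in> U \<Longrightarrow> Q \<in> U \<Longrightarrow> P \<noteq> Q \<Longrightarrow> geod M U P Q 0 = P"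
  and geod_1: "P \<in> U \<Longrightarrow> Q \<in> U \<Longrightarrow> P \<noteq> Q \<Longrightarrow> geod M U P Q 1 = Q"
  using geod_in[of P Q] unfolding geodesic_in_def by auto

text \<open>\<open>geodesic_in\<close> prescribes \<open>undefined\<close> outside
  \<open>{0..1}\<close>, so uniqueness applies to the restriction of \<open>c\<close>.\<close>

lemma geod_eq:
  assumes c: "geodesic_on M {0..1} c" "c ` {0..1} \<subseteq> U" "c 0 = P" "c 1 = Q" "P \<noteq> Q" "t \<in> {0..1}"
  shows "geod M U P Q t = c t"
proof -
  have PQ: "P \<in> U" "Q \<in> U" using c by auto
  have "geodesic_in M U P Q (restrict c {0..1})"
    unfolding geodesic_in_def using c geodesic_cong[OF c(1), of "restrict c {0..1}"] by auto
  moreover have "\<exists>!c. geodesic_in M U P Q c"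
    using disk PQ c(5) unfolding uniquely_geodesic_disk_def by simp
  ultimately have "geod M U P Q = restrict c {0..1}"
    using geod_in[OF PQ c(5)] by (metis (no_types))
  then show ?thesis using c(6) by simp
qed

text \<open>The length of the disk geodesic in place of the infimum \<open>gdist\<close>; the disk
  property makes it a lower bound for the length of all competing curves in \<open>M\<close>. Equal
  points are treated apart because \<open>geod M U P P\<close> is not governed by the uniqueness
  assumption.\<close>

definition ds :: "'a \<Rightarrow> 'a \<Rightarrow> real" where
  "ds P Q = (if P = Q then 0 else curve_length M (geod M U P Q))"

lemma ds_self [simp]: "ds P P = 0" by (simp add: ds_def)

lemma ds_le:
  assumes "P \<in> U" "Q \<in> U" "P \<noteq> Q" "curve_between M P Q \<sigma>"
  shows "ds P Q \<le> curve_length M \<sigma>"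
  using disk assms unfolding uniquely_geodesic_disk_def ds_def by auto

lemma ds_geodesic:
  assumes c: "geodesic_on M {0..1} c" "c ` {0..1} \<subseteq> U" "c 0 \<noteq> c 1"
  shows "ds (c 0) (c 1) = curve_length M c"
  unfolding ds_def using assms(3) curve_length_cong[OF geodesic_C1[OF c(1)] geod_eq[OF c(1,2) refl refl c(3)]]
  by simp

lemma ds_pos:
  assumes "P \<in> U" "Q \<in> U" "P \<noteq> Q" shows "0 < ds P Q"
proof -
  have "curve_length M (geod M U P Q) \<noteq> 0"
    using geodesic_const_of_length_0[OF geod_geodesic[OF assms]] geod_0[OF assms] geod_1[OF assms] assms(3)
    by auto
  moreover have "0 \<le> curve_length M (geod M U P Q)"
    by (rule curve_length_nonneg[OF geodesic_C1[OF geod_geodesic[OF assms]]])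
  ultimately show ?thesis using assms(3) by (simp add: ds_def)
qed

lemma ds_nonneg: "P \<in> U \<Longrightarrow> Q \<in> U \<Longrightarrow> 0 \<le> ds P Q"
  using ds_pos[of P Q] by (cases "P = Q") auto

lemma affine_in_unit:
  fixes s t :: real
  assumes "s \<in> {0..1}" "t \<in> {0..1}"
  shows "(\<lambda>r. (t-s) * r + s) ` {0..1} \<subseteq> {0..1}"
proof
  fix x assume "x \<in> (\<lambda>r. (t-s) * r + s) ` {0..1}"
  then obtain r where r: "r \<in> {0..1}" "x = (1-r) * s + r * t" by (auto simp: algebra_simps)
  then have "x \<in> {0..1}" using convexD_alt[of "{0..1::real}" s t r] assms by auto
  then show "x \<in> {0..1}" .
qed

text \<open>\<open>s\<close> and \<open>t\<close> come in any order, so reversal is the case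
  \<open>s = 1\<close>, \<open>t = 0\<close>.\<close>

lemma sub_geodesic:
  assumes c: "geodesic_on M {0..1} c" "c ` {0..1} \<subseteq> U" and st: "s \<in> {0..1}" "t \<in> {0..1}"
  defines "e \<equiv> (\<lambda>r. c ((t-s) * r + s))"
  shows "geodesic_on M {0..1} e" "e ` {0..1} \<subseteq> U" "e 0 = c s" "e 1 = c t"
    "curve_length M e = \<bar>t - s\<bar> * curve_length M c"
proof -
  note im = affine_in_unit[OF st]
  show "geodesic_on M {0..1} e" unfolding e_def by (rule geodesic_affine[OF c(1) im])
  show "e ` {0..1} \<subseteq> U" unfolding e_def using im c(2) by blast
  show "curve_length M e = \<bar>t - s\<bar> * curve_length M c" unfolding e_def by (rule curve_length_affine[OF c(1) im])
qed (auto simp: e_def)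

lemma ds_sub:
  assumes c: "geodesic_on M {0..1} c" "c ` {0..1} \<subseteq> U" and st: "s \<in> {0..1}" "t \<in> {0..1}" "c s \<noteq> c t"
  shows "ds (c s) (c t) = \<bar>t - s\<bar> * curve_length M c"
  using ds_geodesic[OF sub_geodesic(1,2)[OF c st(1,2)]] sub_geodesic(5)[OF c st(1,2)] st(3) by simp

lemma geod_sub:
  assumes c: "geodesic_on M {0..1} c" "c ` {0..1} \<subseteq> U" and st: "s \<in> {0..1}" "t \<in> {0..1}" "c s \<noteq> c t"
    and r: "r \<in> {0..1}"
  shows "geod M U (c s) (c t) r = c ((t-s) * r + s)"
  using geod_eq[OF sub_geodesic(1-4)[OF c st(1,2)] st(3) r] .

text \<open>Every arc of the curve realizes the distance of its end points when these differ. So the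
  parameter of a point can be recovered from its distance to \<open>c 0\<close>, or to
  \<open>c 1\<close> if the point is \<open>c 0\<close> itself.\<close>

lemma geodesic_inj:
  assumes c: "geodesic_on M {0..1} c" "c ` {0..1} \<subseteq> U" "c 0 \<noteq> c 1"
  shows "inj_on c {0..1}"
proof (rule inj_onI)
  fix s t :: real assume st: "s \<in> {0..1}" "t \<in> {0..1}" "c s = c t"
  have L: "0 < curve_length M c" using ds_geodesic[OF c] ds_pos[of "c 0" "c 1"] c by (auto simp: image_subset_iff)
  show "s = t"
  proof (cases "c s = c 0")
    case False
    then have "c 0 \<noteq> c s" "c 0 \<noteq> c t" using st by auto
    then have "ds (c 0) (c s) = \<bar>s - 0\<bar> * curve_length M c" "ds (c 0) (c t) = \<bar>t - 0\<bar> * curve_length M c"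
      using st(1,2) by (intro ds_sub[OF c(1,2)]; simp)+
    then show ?thesis using st(1,2) L unfolding st(3) by auto
  next
    case True
    then have "c s \<noteq> c 1" "c t \<noteq> c 1" using st c(3) by auto
    then have "ds (c s) (c 1) = \<bar>1 - s\<bar> * curve_length M c" "ds (c t) (c 1) = \<bar>1 - t\<bar> * curve_length M c"
      using st(1,2) by (intro ds_sub[OF c(1,2)]; simp)+
    then show ?thesis using st(1,2) L unfolding st(3) by auto
  qed
qed

section \<open>Segments, their order and their intersections\<close>

definition seg :: "'a \<Rightarrow> 'a \<Rightarrow> 'a set" where
  "seg P Q = (if P = Q then {P} else geod M U P Q ` {0..1})"

lemma seg_refl [simp]: "seg P P = {P}" by (simp add: seg_def)

lemma seg_eq:
  assumes c: "geodesic_on M {0..1} c" "c ` {0..1} \<subseteq> U" "c 0 \<noteq> c 1"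
  shows "seg (c 0) (c 1) = c ` {0..1}"
  using assms geod_eq[OF c(1,2) refl refl c(3)] by (auto simp: seg_def)

lemma geod_inj: "P \<in> U \<Longrightarrow> Q \<in> U \<Longrightarrow> P \<noteq> Q \<Longrightarrow> inj_on (geod M U P Q) {0..1}"
  by (rule geodesic_inj) (auto simp: geod_geodesic geod_U geod_0 geod_1)

lemma seg_U: "P \<in> U \<Longrightarrow> Q \<in> U \<Longrightarrow> seg P Q \<subseteq> U"
  by (auto simp: seg_def geod_U)

lemma geod_param:
  assumes "P \<in> U" "Q \<in> U" "P \<noteq> Q"
  shows "geodesic_on M {0..1} (geod M U P Q)" "geod M U P Q ` {0..1} \<subseteq> U" "geod M U P Q 0 = P"
     "geod M U P Q 1 = Q" "seg P Q = geod M U P Q ` {0..1}" "inj_on (geod M U P Q) {0..1}"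
     "curve_length M (geod M U P Q) = ds P Q"
  using assms geod_inj by (auto simp: geod_geodesic geod_U geod_0 geod_1 seg_def ds_def)

lemma end_in_seg: "P \<in> U \<Longrightarrow> Q \<in> U \<Longrightarrow> P \<in> seg P Q" "P \<in> U \<Longrightarrow> Q \<in> U \<Longrightarrow> Q \<in> seg P Q"
  using geod_0[of P Q] geod_1[of P Q] by (auto simp: seg_def intro: rev_image_eqI[of 0] rev_image_eqI[of 1])

lemma geod_rev:
  assumes "P \<in> U" "Q \<in> U" "P \<noteq> Q" "r \<in> {0..1}"
  shows "geod M U Q P r = geod M U P Q (1 - r)"
  using geod_sub[OF geod_param(1,2)[OF assms(1-3)], of 1 0 r] geod_param(3,4)[OF assms(1-3)] assms by simp

lemma seg_sub:
  assumes c: "geodesic_on M {0..1} c" "c ` {0..1} \<subseteq> U" and st: "s \<in> {0..1}" "t \<in> {0..1}" "s \<le> t"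
    and inj: "inj_on c {0..1}"
  shows "seg (c s) (c t) = c ` {s..t}"
proof (cases "s = t")
  case False
  then have "c s \<noteq> c t" using inj st by (auto dest: inj_onD)
  then have "seg (c s) (c t) = (\<lambda>r. c ((t-s) * r + s)) ` {0..1}"
    using seg_eq[OF sub_geodesic(1,2)[OF c st(1,2)]] by simp
  also have "\<dots> = c ` ((\<lambda>r. (t-s) * r + s) ` {0..1})" by (simp add: image_image)
  also have "(\<lambda>r. (t-s) * r + s) ` {0..1} = {s..t}"
    using image_affinity_atLeastAtMost[of "t-s" s 0 1] st by auto
  finally show ?thesis .
qed auto

lemma seg_sym:
  assumes "P \<in> U" "Q \<in> U" shows "seg P Q = seg Q P"
proof (cases "P = Q")
  case False
  have "geod M U Q P ` {0..1} = (\<lambda>r. geod M U P Q (1 - r)) ` {0..1}"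
    using geod_rev[OF assms False] by (intro image_cong) auto
  also have "\<dots> = geod M U P Q ` ((-) 1 ` {0..1})" by (simp only: image_image)
  also have "(-) 1 ` {0..1::real} = {0..1}" by simp
  finally show ?thesis using False by (simp add: seg_def)
qed simp

lemma ds_sym:
  assumes "P \<in> U" "Q \<in> U" shows "ds P Q = ds Q P"
proof (cases "P = Q")
  case False
  then show ?thesis
    using ds_sub[OF geod_param(1,2)[OF assms False], of 1 0] geod_param[OF assms False] by simp
qed simp

lemma seg_subset:
  assumes "P \<in> U" "Q \<in> U" "X \<in> seg P Q" "Y \<in> seg P Q"
  shows "seg X Y \<subseteq> seg P Q"
proof (cases "P = Q")
  case False
  note g = geod_param[OF assms(1,2) False]
  obtain s t where st: "s \<in> {0..1}" "t \<in> {0..1}" "X = geod M U P Q s" "Y = geod M U P Q t"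
    using assms g(5) by auto
  have XY: "X \<in> U" "Y \<in> U" using st g(2) by auto
  show ?thesis
  proof (cases "s \<le> t")
    case True
    then show ?thesis using seg_sub[OF g(1,2) st(1,2) True g(6)] st g(5) by auto
  next
    case False
    then have "t \<le> s" by simp
    then show ?thesis using seg_sub[OF g(1,2) st(2,1) _ g(6)] seg_sym[OF XY] st g(5) by auto
  qed
qed (use assms in auto)

text \<open>Along the segment the points come in the order \<open>B\<close>, \<open>T\<close>,
  \<open>A\<close>, \<open>Z\<close>.\<close>

lemma seg_order:
  assumes "B \<in> U" "Z \<in> U" "A \<in> seg B Z" "T \<in> seg B A"
  shows "A \<in> seg T Z"
proof (cases "B = Z")
  case False
  note g = geod_param[OF assms(1,2) False]
  let ?c = "geod M U B Z"
  obtain a where a: "a \<in> {0..1}" "A = ?c a" using assms(3) g(5) by auto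
  have "seg B A = ?c ` {0..a}" using seg_sub[OF g(1,2) _ a(1) _ g(6), of 0] a g(3) by simp
  then obtain t where t: "t \<in> {0..a}" "T = ?c t" using assms(4) by auto
  have "seg T Z = ?c ` {t..1}" using seg_sub[OF g(1,2) _ _ _ g(6), of t 1] a t g(4) by simp
  then show ?thesis using a t by auto
qed (use assms in auto)

text \<open>The rigidity behind all intersection arguments. Up to the common point \<open>Z\<close>
  the two geodesics coincide by uniqueness in the disk, after that by unique continuation, until one
  of them ends; its end point then lies on the other.\<close>

lemma seg_meet:
  assumes U: "P \<in> U" "Q \<in> U" "R \<in> U" and Z: "Z \<in> seg P Q" "Z \<in> seg P R" "Z \<noteq> P"
  shows "Q \<in> seg P R \<or> R \<in> seg P Q"
proof -
  have PQ: "P \<noteq> Q" and PR: "P \<noteq> R" using Z by (auto split: if_splits)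
  note g1 = geod_param[OF U(1,2) PQ] and g2 = geod_param[OF U(1,3) PR]
  let ?c1 = "geod M U P Q" and ?c2 = "geod M U P R"
  obtain s r where s: "s \<in> {0..1}" "Z = ?c1 s" and r: "r \<in> {0..1}" "Z = ?c2 r"
    using Z g1(5) g2(5) by auto
  have s0: "s \<noteq> 0" and r0: "r \<noteq> 0" using s r Z(3) g1(3) g2(3) by auto
  \<comment> \<open>Both geodesics are reparametrized to reach \<open>Z\<close> at time 1; they end
    at the times \<open>1/s\<close> and \<open>1/r\<close>, and \<open>b\<close> is the earlier of
    these.\<close>
  define b where "b = min (1/s) (1/r)"
  have b: "1 \<le> b" "b \<le> 1/s" "b \<le> 1/r" using s r s0 r0 by (auto simp: b_def)
  have im: "(\<lambda>t. s*t+0) ` {0..b} \<subseteq> {0..1}" "(\<lambda>t. r*t+0) ` {0..b} \<subseteq> {0..1}"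
  proof -
    have "x * y + 0 \<in> {0..1}" if "0 \<le> x" "x \<noteq> 0" "b \<le> 1/x" "y \<in> {0..b}" for x y :: real
    proof -
      have "x * y \<le> x * (1/x)" using that by (intro mult_left_mono) auto
      then show ?thesis using that by auto
    qed
    from this[of s] this[of r]
    show "(\<lambda>t. s*t+0) ` {0..b} \<subseteq> {0..1}" "(\<lambda>t. r*t+0) ` {0..b} \<subseteq> {0..1}"
      using b s(1) r(1) s0 r0 unfolding image_subset_iff by auto
  qed
  have eq: "?c1 (s*t+0) = ?c2 (r*t+0)" if t: "t \<in> {0..b}" for t
  proof (rule geodesic_unique[OF geodesic_affine[OF g1(1) im(1)] geodesic_affine[OF g2(1) im(2)] _ b(1) _ t])
    fix t :: real assume t: "t \<in> {0..1}"
    have "geod M U (?c1 0) (?c1 s) t = ?c1 ((s - 0)*t+0)" "geod M U (?c2 0) (?c2 r) t = ?c2 ((r - 0)*t+0)"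
      by (rule geod_sub[OF g1(1,2)] geod_sub[OF g2(1,2)]; use s r t Z(3) g1(3) g2(3) in auto)+
    then show "?c1 (s*t+0) = ?c2 (r*t+0)" using s r g1(3) g2(3) by simp
  qed simp
  have b0: "0 \<le> b" using b by simp
  have in1: "s*b+0 \<in> {0..1}" "r*b+0 \<in> {0..1}" using im b0 by (auto simp: image_subset_iff)
  show ?thesis
  proof (cases "1/s \<le> 1/r")
    case True
    then have "s*b+0 = 1" using s0 by (simp add: b_def)
    then have "Q = ?c2 (r*b+0)" using eq[of b] b0 g1(4) by simp
    then show ?thesis using in1 g2(5) by blast
  next
    case False
    then have "r*b+0 = 1" using r0 by (simp add: b_def)
    then have "R = ?c1 (s*b+0)" using eq[of b] b0 g2(4) by simp
    then show ?thesis using in1 g1(5) by blast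
  qed
qed

section \<open>Initial velocities and angles\<close>

definition tang :: "'a \<Rightarrow> 'a \<Rightarrow> real^2" where
  "tang X P = velocity M (geod M U X P) 0"

lemma tang_sub:
  assumes "X \<in> U" "P \<in> U" "T \<in> seg X P" "T \<noteq> X"
  obtains s where "0 < s" "s \<le> 1" "tang X T = s *\<^sub>R tang X P"
proof -
  have XP: "X \<noteq> P" using assms by auto
  note g = geod_param[OF assms(1,2) XP]
  obtain s where s: "s \<in> {0..1}" "T = geod M U X P s" using assms(3) g(5) by auto
  have s0: "s \<noteq> 0" using s assms(4) g(3) by auto
  have "tang X T = s *\<^sub>R velocity M (geod M U X P) 0" unfolding tang_def
  proof (rule velocity_affine[OF geodesic_C1[OF g(1)]])
    show "(\<lambda>r. s * r + 0) ` {0..1} \<subseteq> {0..1}" using affine_in_unit[of 0 s] s by simp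
    show "geod M U X T r = geod M U X P (s*r + 0)" if "r \<in> {0..1}" for r
      using geod_sub[OF g(1,2), of 0 s r] s that assms(4) g(3) by simp
  qed
  then show thesis using that[of s] s s0 by (simp add: tang_def)
qed

lemma tang_opposite:
  assumes "P \<in> U" "Q \<in> U" "X \<in> seg P Q" "X \<noteq> P" "X \<noteq> Q"
  obtains k where "0 < k" "tang X P = - k *\<^sub>R tang X Q"
proof -
  have PQ: "P \<noteq> Q" using assms by auto
  note g = geod_param[OF assms(1,2) PQ]
  let ?c = "geod M U P Q"
  obtain s where s: "s \<in> {0..1}" "X = ?c s" using assms(3) g(5) by auto
  have s0: "0 < s" "s < 1" using s assms(4,5) g(3,4) by (auto simp: less_le)
  have 1: "tang X P = (0 - s) *\<^sub>R velocity M ?c s" unfolding tang_def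
  proof (rule velocity_affine[OF geodesic_C1[OF g(1)]])
    show "(\<lambda>r. (0-s) * r + s) ` {0..1} \<subseteq> {0..1}" using affine_in_unit[of s 0] s by simp
    show "geod M U X P r = ?c ((0-s)*r + s)" if "r \<in> {0..1}" for r
      using geod_sub[OF g(1,2), of s 0 r] s that assms(4) g(3) by simp
  qed
  have 2: "tang X Q = (1 - s) *\<^sub>R velocity M ?c s" unfolding tang_def
  proof (rule velocity_affine[OF geodesic_C1[OF g(1)]])
    show "(\<lambda>r. (1-s) * r + s) ` {0..1} \<subseteq> {0..1}" using affine_in_unit[of s 1] s by simp
    show "geod M U X Q r = ?c ((1-s)*r + s)" if "r \<in> {0..1}" for r
      using geod_sub[OF g(1,2), of s 1 r] s that assms(5) g(4) by simp
  qed
  \<comment> \<open>The two vectors are \<open>-s\<close> and \<open>1 - s\<close> times the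
    velocity at \<open>X\<close> of the geodesic from \<open>P\<close> to \<open>Q\<close>.\<close>
  show thesis
    by (rule that[of "s / (1-s)"]) (use s0 1 2 in auto)
qed

lemma norm_at_tang:
  assumes "X \<in> U" "P \<in> U" "X \<noteq> P"
  shows "norm_at M X (tang X P) = ds X P"
  using geodesic_speed_const[OF geod_geodesic[OF assms], of 0] assms
  by (simp add: speed_def tang_def ds_def geod_0)

lemma inner_at_scale: "inner_at M X (a *\<^sub>R u) (b *\<^sub>R v) = a * b * inner_at M X u v"
  by (simp add: inner_at_def Let_def matrix_vector_mult_scaleR)

lemma norm_at_scale: "norm_at M X (a *\<^sub>R u) = \<bar>a\<bar> * norm_at M X u"
  by (simp add: norm_at_chart_at chart_norm_scale)

lemma inner_at_sym: "X \<in> U \<Longrightarrow> inner_at M X u v = inner_at M X v u"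
proof -
  assume "X \<in> U"
  then have k: "chart_at M X \<in> charts M" "cmap (chart_at M X) X \<in> cmap (chart_at M X) ` cdom (chart_at M X)"
    using chart_at U_carrier by blast+
  have "transpose (metric M (chart_at M X) (cmap (chart_at M X) X)) = metric M (chart_at M X) (cmap (chart_at M X) X)"
    using metric_sym[OF k] .
  then show ?thesis unfolding inner_at_def Let_def
    by (metis dot_lmul_matrix inner_commute transpose_matrix_vector)
qed

lemma angle_tang:
  "angle M U P X Q = arccos (inner_at M X (tang X P) (tang X Q) / (norm_at M X (tang X P) * norm_at M X (tang X Q)))"
  by (simp add: angle_def tang_def Let_def)

lemma angle_sub:
  assumes U: "X \<in> U" "P \<in> U" "Q \<in> U" and "P' \<in> seg X P" "P' \<noteq> X" "Q' \<in> seg X Q" "Q' \<noteq> X"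
  shows "angle M U P' X Q' = angle M U P X Q"
proof -
  obtain s where s: "0 < s" "tang X P' = s *\<^sub>R tang X P" using tang_sub[OF U(1,2) assms(4,5)] by blast
  obtain r where r: "0 < r" "tang X Q' = r *\<^sub>R tang X Q" using tang_sub[OF U(1,3) assms(6,7)] by blast
  show ?thesis unfolding angle_tang s(2) r(2) inner_at_scale norm_at_scale using s r by simp
qed

lemma angle_opposite:
  assumes "P \<in> U" "Q \<in> U" "X \<in> seg P Q" "X \<noteq> P" "X \<noteq> Q"
  shows "angle M U P X Q = pi"
proof -
  have X: "X \<in> U" using assms seg_U by blast
  obtain k where k: "0 < k" "tang X P = - k *\<^sub>R tang X Q" using tang_opposite[OF assms] by blast
  have n: "0 < norm_at M X (tang X Q)" using norm_at_tang[OF X assms(2,5)] ds_pos[OF X assms(2,5)] by simp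
  have "inner_at M X (tang X Q) (tang X Q) = (norm_at M X (tang X Q))\<^sup>2"
    using n by (auto simp: norm_at_def)
  then have "inner_at M X (tang X P) (tang X Q) / (norm_at M X (tang X P) * norm_at M X (tang X Q)) = -1"
    unfolding k(2) using inner_at_scale[of X "-k" "tang X Q" 1 "tang X Q"] k(1) n
    unfolding norm_at_scale by (simp add: power2_eq_square)
  then show ?thesis unfolding angle_tang by simp
qed

end


section \<open>Distance near a point and extension of geodesics\<close>

lemma segment_param: "t \<in> {0..1} \<Longrightarrow> y + t *\<^sub>R (z - y) \<in> closed_segment y z"
  unfolding closed_segment_def mem_Collect_eq by (rule exI[of _ t]) (simp add: algebra_simps)

lemma quadratic_form_bound:
  fixes A :: "real^2^2"
  shows "\<bar>v \<bullet> (A *v v)\<bar> \<le> (\<Sum>i\<in>UNIV. \<Sum>j\<in>UNIV. \<bar>A $ i $ j\<bar>) * (norm v)\<^sup>2"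
proof -
  have "\<bar>v \<bullet> (A *v v)\<bar> = \<bar>\<Sum>i\<in>UNIV. \<Sum>j\<in>UNIV. v $ i * (A $ i $ j * v $ j)\<bar>"
    by (simp add: inner_vec_def matrix_vector_mult_def sum_distrib_left)
  also have "\<dots> \<le> (\<Sum>i\<in>UNIV. \<Sum>j\<in>UNIV. \<bar>v $ i * (A $ i $ j * v $ j)\<bar>)"
    by (rule order_trans[OF sum_abs], rule sum_mono, rule sum_abs)
  also have "\<dots> \<le> (\<Sum>i\<in>UNIV. \<Sum>j\<in>UNIV. \<bar>A $ i $ j\<bar> * (norm v)\<^sup>2)"
  proof (intro sum_mono)
    fix i j :: 2
    have "\<bar>v $ i\<bar> * \<bar>v $ j\<bar> \<le> norm v * norm v"
      by (intro mult_mono component_le_norm_cart) auto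
    then have "\<bar>A $ i $ j\<bar> * (\<bar>v $ i\<bar> * \<bar>v $ j\<bar>) \<le> \<bar>A $ i $ j\<bar> * (norm v)\<^sup>2"
      by (intro mult_left_mono) (auto simp: power2_eq_square)
    then show "\<bar>v $ i * (A $ i $ j * v $ j)\<bar> \<le> \<bar>A $ i $ j\<bar> * (norm v)\<^sup>2"
      by (simp add: abs_mult mult_ac)
  qed
  finally show ?thesis by (simp add: sum_distrib_right)
qed

context riem_surface
begin

lemma chart_norm_bound: "\<exists>K\<ge>0. \<forall>v. chart_norm M \<kappa> x v \<le> K * norm v"
proof (intro exI[of _ "sqrt (\<Sum>i\<in>UNIV. \<Sum>j\<in>UNIV. \<bar>metric M \<kappa> x $ i $ j\<bar>)"] conjI allI)
  fix v
  have "chart_norm M \<kappa> x v \<le> sqrt ((\<Sum>i\<in>UNIV. \<Sum>j\<in>UNIV. \<bar>metric M \<kappa> x $ i $ j\<bar>) * (norm v)\<^sup>2)"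
    unfolding chart_norm_def using quadratic_form_bound[of v "metric M \<kappa> x"] by (intro real_sqrt_le_mono) auto
  then show "chart_norm M \<kappa> x v \<le> sqrt (\<Sum>i\<in>UNIV. \<Sum>j\<in>UNIV. \<bar>metric M \<kappa> x $ i $ j\<bar>) * norm v"
    by (simp add: real_sqrt_mult)
qed (auto intro!: sum_nonneg)

text \<open>The root of a sum is at most the sum of the roots, so a small change of the metric costs
  an additive error proportional to \<open>norm v\<close>, and no lower bound for the metric
  enters.\<close>

lemma chart_norm_nearby:
  assumes k: "\<kappa> \<in> charts M" "x0 \<in> cmap \<kappa> ` cdom \<kappa>" and e: "0 < e"
  obtains d where "0 < d" "\<And>x v. x \<in> ball x0 d \<Longrightarrow> chart_norm M \<kappa> x v \<le> chart_norm M \<kappa> x0 v + e * norm v"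
proof -
  define N where "N = (\<lambda>x. \<Sum>i\<in>UNIV. \<Sum>j\<in>UNIV. \<bar>metric M \<kappa> x $ i $ j - metric M \<kappa> x0 $ i $ j\<bar>)"
  have "continuous_on (cmap \<kappa> ` cdom \<kappa>) N"
    unfolding N_def by (intro continuous_intros metric_continuous[OF k(1)])
  then have "isCont N x0"
    using continuous_on_eq_continuous_at[OF chart_image_open[OF k(1)]] k(2) by blast
  moreover have "N x0 = 0" by (simp add: N_def)
  ultimately obtain d where d: "0 < d" "\<And>x. dist x x0 < d \<Longrightarrow> dist (N x) 0 < e\<^sup>2"
    using e unfolding continuous_at_eps_delta by (metis zero_less_power)
  show thesis
  proof (rule that[OF d(1)])
    fix x v assume "x \<in> ball x0 d"
    then have Nx: "N x < e\<^sup>2" using d(2)[of x] by (simp add: dist_commute)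
    let ?G = "metric M \<kappa> x" and ?H = "metric M \<kappa> x0"
    have pos: "0 \<le> v \<bullet> (?H *v v)" using metric_pos[OF k, of v] by (cases "v = 0") auto
    have N_eq: "N x = (\<Sum>i\<in>UNIV. \<Sum>j\<in>UNIV. \<bar>(?G - ?H) $ i $ j\<bar>)" by (simp add: N_def)
    have "v \<bullet> (?G *v v) = v \<bullet> (?H *v v) + v \<bullet> ((?G - ?H) *v v)"
      by (simp add: matrix_vector_mult_diff_rdistrib inner_diff_right)
    also have "v \<bullet> ((?G - ?H) *v v) \<le> N x * (norm v)\<^sup>2"
      unfolding N_eq by (rule order_trans[OF abs_ge_self quadratic_form_bound])
    also have "N x * (norm v)\<^sup>2 \<le> e\<^sup>2 * (norm v)\<^sup>2" using Nx by (intro mult_right_mono) auto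
    finally have "sqrt (v \<bullet> (?G *v v)) \<le> sqrt (v \<bullet> (?H *v v) + (e * norm v)\<^sup>2)"
      by (simp add: power_mult_distrib)
    also have "\<dots> \<le> sqrt (v \<bullet> (?H *v v)) + sqrt ((e * norm v)\<^sup>2)"
      by (intro sqrt_add_le_add_sqrt pos) simp
    finally show "chart_norm M \<kappa> x v \<le> chart_norm M \<kappa> x0 v + e * norm v"
      using e by (simp add: chart_norm_def)
  qed
qed

lemma transition_frechet_continuous:
  assumes "\<kappa> \<in> charts M" "\<kappa>' \<in> charts M"
  shows "continuous_on (cmap \<kappa> ` (cdom \<kappa> \<inter> cdom \<kappa>')) (\<lambda>x. frechet_derivative (transition \<kappa> \<kappa>') (at x) w)"
proof -
  have "Ck_on (Suc 0) (cmap \<kappa> ` (cdom \<kappa> \<inter> cdom \<kappa>')) (transition \<kappa> \<kappa>')"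
    using transition_smooth[OF assms] unfolding smooth_on_def by blast
  then show ?thesis by simp
qed

text \<open>In another chart the velocity is the image of the constant vector \<open>z - y\<close>
  under the derivative of the transition map, which depends continuously on the point.\<close>

lemma chart_segment:
  assumes k: "\<kappa> \<in> charts M" and yz: "closed_segment y z \<subseteq> cmap \<kappa> ` cdom \<kappa>"
  defines "\<sigma> \<equiv> (\<lambda>t. cinv \<kappa> (y + t *\<^sub>R (z - y)))"
  shows "C1_curve_on M {0..1} \<sigma>"
    and "t \<in> {0..1} \<Longrightarrow> speed M \<sigma> t = chart_norm M \<kappa> (y + t *\<^sub>R (z - y)) (z - y)"
proof -
  let ?x = "\<lambda>t. y + t *\<^sub>R (z - y)"
  have x: "?x t \<in> cmap \<kappa> ` cdom \<kappa>" if "t \<in> {0..1}" for t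
    using segment_param[OF that] yz by blast
  have dom: "\<sigma> t \<in> cdom \<kappa>" and cx: "cmap \<kappa> (\<sigma> t) = ?x t" if "t \<in> {0..1}" for t
    unfolding \<sigma>_def using cinv_in[OF k x[OF that]] cmap_cinv[OF k x[OF that]] by auto
  have cont: "continuous_on {0..1} \<sigma>" unfolding \<sigma>_def
    by (rule continuous_on_compose2[OF cinv_continuous[OF k]]) (use x in \<open>auto intro!: continuous_intros\<close>)
  have d: "((cmap \<kappa> \<circ> \<sigma>) has_vector_derivative (z - y)) (at t within {0..1})" if t: "t \<in> {0..1}" for t
  proof (rule has_vector_derivative_transform[OF t])
    show "(?x has_vector_derivative (z - y)) (at t within {0..1})"
      by (auto intro!: derivative_eq_intros)
  qed (simp add: cx)
  show "C1_curve_on M {0..1} \<sigma>" unfolding C1_curve_on_def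
  proof (intro conjI ballI)
    show "\<sigma> ` {0..1} \<subseteq> carrier M" using dom k by (auto simp: carrier_def)
    fix \<kappa>' assume k': "\<kappa>' \<in> charts M"
    let ?J = "{t\<in>{0..1}. \<sigma> t \<in> cdom \<kappa>'}"
    show "\<exists>v. continuous_on ?J v \<and> (\<forall>t\<in>{0..1}. \<sigma> t \<in> cdom \<kappa>' \<longrightarrow>
        ((cmap \<kappa>' \<circ> \<sigma>) has_vector_derivative v t) (at t within {0..1}))"
    proof (intro exI conjI ballI impI)
      show "continuous_on ?J (\<lambda>t. frechet_derivative (transition \<kappa> \<kappa>') (at (?x t)) (z - y))"
      proof (rule continuous_on_compose2[OF transition_frechet_continuous[OF k k']])
        show "continuous_on ?J ?x" by (intro continuous_intros)
        show "?x ` ?J \<subseteq> cmap \<kappa> ` (cdom \<kappa> \<inter> cdom \<kappa>')" using cx dom 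
          by (intro image_subsetI image_eqI[of _ _ "\<sigma> _"]) auto
      qed
      fix t :: real assume t: "t \<in> {0..1}" "\<sigma> t \<in> cdom \<kappa>'"
      have "continuous (at t within {0..1}) \<sigma>" using cont t by (simp add: continuous_on_eq_continuous_within)
      from chart_change[OF k k' t(1) this dom[OF t(1)] t(2) d[OF t(1)]]
      show "((cmap \<kappa>' \<circ> \<sigma>) has_vector_derivative frechet_derivative (transition \<kappa> \<kappa>') (at (?x t)) (z - y)) (at t within {0..1})"
        by (simp add: cx[OF t(1)])
    qed
  qed (rule cont)
  show "speed M \<sigma> t = chart_norm M \<kappa> (?x t) (z - y)" if t: "t \<in> {0..1}"
    using speed_eq[OF k t _ dom[OF t] d[OF t]] cont t cx[OF t] by (simp add: continuous_on_eq_continuous_within)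
qed

end

context geodesic_disk
begin

lemma chart_disk_open: "\<kappa> \<in> charts M \<Longrightarrow> open (cmap \<kappa> ` (cdom \<kappa> \<inter> U))"
  by (rule chart_image_inter_open[OF _ U_open])

text \<open>The competing curve runs straight from \<open>y\<close> to \<open>z\<close> in the chart
  and then along the geodesic to \<open>Q\<close>. Freezing the metric at \<open>p\<close> costs the
  term with \<open>e\<close>. The radius does not depend on \<open>Q\<close>.\<close>

lemma ds_chart_segment:
  assumes k: "\<kappa> \<in> charts M" and p: "p \<in> cdom \<kappa>" "p \<in> U" and e: "0 < e"
  obtains d where "0 < d" "ball (cmap \<kappa> p) d \<subseteq> cmap \<kappa> ` (cdom \<kappa> \<inter> U)"
    "\<And>y z Q. y \<in> ball (cmap \<kappa> p) d \<Longrightarrow> z \<in> ball (cmap \<kappa> p) d \<Longrightarrow> Q \<in> U \<Longrightarrow>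
       ds (cinv \<kappa> y) Q \<le> chart_norm M \<kappa> (cmap \<kappa> p) (z - y) + e * norm (z - y) + ds (cinv \<kappa> z) Q"
proof -
  let ?x0 = "cmap \<kappa> p"
  have x0: "?x0 \<in> cmap \<kappa> ` cdom \<kappa>" using p by auto
  obtain d1 where d1: "0 < d1" "\<And>x v. x \<in> ball ?x0 d1 \<Longrightarrow> chart_norm M \<kappa> x v \<le> chart_norm M \<kappa> ?x0 v + e * norm v"
    using chart_norm_nearby[OF k x0 e] by blast
  have "?x0 \<in> cmap \<kappa> ` (cdom \<kappa> \<inter> U)" using p by auto
  then obtain d2 where d2: "0 < d2" "ball ?x0 d2 \<subseteq> cmap \<kappa> ` (cdom \<kappa> \<inter> U)"
    using openE[OF chart_disk_open[OF k]] by blast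
  define d where "d = min d1 d2"
  have sub: "ball ?x0 d \<subseteq> cmap \<kappa> ` (cdom \<kappa> \<inter> U)" "ball ?x0 d \<subseteq> ball ?x0 d1" using d2(2) by (auto simp: d_def)
  show thesis
  proof (rule that[of d])
    show "0 < d" using d1 d2 by (simp add: d_def)
    fix y z Q assume yz: "y \<in> ball ?x0 d" "z \<in> ball ?x0 d" and Q: "Q \<in> U"
    let ?B = "chart_norm M \<kappa> ?x0 (z - y) + e * norm (z - y)"
    have seg: "closed_segment y z \<subseteq> ball ?x0 d"
      using yz convex_ball[of ?x0 d] by (simp add: closed_segment_subset)
    define \<sigma> where "\<sigma> = (\<lambda>t. cinv \<kappa> (y + t *\<^sub>R (z - y)))"
    have seg': "closed_segment y z \<subseteq> cmap \<kappa> ` cdom \<kappa>" using seg sub by blast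
    note C1 = chart_segment(1)[OF k seg', folded \<sigma>_def]
    have B: "curve_length M \<sigma> \<le> ?B"
    proof (rule has_integral_le[OF has_integral_speed[OF C1]])
      show "((\<lambda>_. ?B) has_integral ?B) {0..1::real}" using has_integral_const_real[of ?B 0 1] by simp
      fix t :: real assume t: "t \<in> {0..1}"
      have "y + t *\<^sub>R (z - y) \<in> closed_segment y z" by (rule segment_param[OF t])
      then show "speed M \<sigma> t \<le> ?B"
        using chart_segment(2)[OF k seg' t, folded \<sigma>_def] d1(2) seg sub(2) by auto
    qed
    have ends: "\<sigma> 0 = cinv \<kappa> y" "\<sigma> 1 = cinv \<kappa> z" by (auto simp: \<sigma>_def)
    have "cinv \<kappa> x \<in> U" if x: "x \<in> ball ?x0 d" for x
    proof -
      obtain q where "q \<in> cdom \<kappa>" "q \<in> U" "x = cmap \<kappa> q"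
        using subsetD[OF sub(1) x] by auto
      then show ?thesis using cinv_cmap[OF k] by simp
    qed
    then have inU: "cinv \<kappa> y \<in> U" "cinv \<kappa> z \<in> U" using yz by auto
    have B0: "0 \<le> ?B" using B curve_length_nonneg[OF C1] by linarith
    show "ds (cinv \<kappa> y) Q \<le> ?B + ds (cinv \<kappa> z) Q"
    proof (cases "cinv \<kappa> y = Q")
      case True
      then show ?thesis using B0 ds_nonneg[OF inU(2) Q] by simp
    next
      case ne: False
      show ?thesis
      proof (cases "cinv \<kappa> z = Q")
        case True
        then show ?thesis using ds_le[OF inU(1) Q ne, of \<sigma>] C1_curve_between[OF C1] ends B by simp
      next
        case False
        note g = geod_param[OF inU(2) Q False]
        have j: "\<sigma> 1 = geod M U (cinv \<kappa> z) Q 0" using ends g by simp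
        have "ds (cinv \<kappa> y) Q \<le> curve_length M (\<sigma> +++ geod M U (cinv \<kappa> z) Q)"
          using join_curves(1)[OF C1 geodesic_C1[OF g(1)] j] ends g(4) by (intro ds_le inU Q ne) simp
        also have "\<dots> = curve_length M \<sigma> + ds (cinv \<kappa> z) Q"
          using join_curves(2)[OF C1 geodesic_C1[OF g(1)] j] g(7) by simp
        finally show ?thesis using B by linarith
      qed
    qed
  qed (rule sub(1))
qed

text \<open>With \<open>e = 1\<close> and the two points in either order, the chart estimate bounds
  the difference of the distances by \<open>K+1\<close> times the coordinate distance.\<close>

lemma ds_continuous:
  assumes Q: "Q \<in> U"
  shows "continuous_on U (\<lambda>Z. ds Z Q)"
  unfolding continuous_on_eq_continuous_at[OF U_open]
proof
  fix T assume T: "T \<in> U"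
  define \<kappa> where "\<kappa> = chart_at M T"
  have k: "\<kappa> \<in> charts M" "T \<in> cdom \<kappa>" using chart_at[of T] T U_carrier by (auto simp: \<kappa>_def)
  obtain d where d: "0 < d" "ball (cmap \<kappa> T) d \<subseteq> cmap \<kappa> ` (cdom \<kappa> \<inter> U)"
    "\<And>y z Q. y \<in> ball (cmap \<kappa> T) d \<Longrightarrow> z \<in> ball (cmap \<kappa> T) d \<Longrightarrow> Q \<in> U \<Longrightarrow>
       ds (cinv \<kappa> y) Q \<le> chart_norm M \<kappa> (cmap \<kappa> T) (z - y) + 1 * norm (z - y) + ds (cinv \<kappa> z) Q"
    using ds_chart_segment[OF k T zero_less_one] by blast
  obtain K where K: "0 \<le> K" "\<And>v. chart_norm M \<kappa> (cmap \<kappa> T) v \<le> K * norm v"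
    using chart_norm_bound by blast
  show "isCont (\<lambda>Z. ds Z Q) T" unfolding isCont_def tendsto_iff
  proof (intro allI impI)
    fix e :: real assume e: "0 < e"
    define r where "r = min d (e / (K+1))"
    have "r \<le> e / (K+1)" by (simp add: r_def)
    then have "(K+1) * r \<le> e" using K(1) by (simp add: pos_le_divide_eq mult.commute)
    moreover have "0 < r" "r \<le> d" using e d(1) K(1) by (auto simp: r_def)
    ultimately have r: "0 < r" "r \<le> d" "(K+1) * r \<le> e" by auto
    let ?W = "cdom \<kappa> \<inter> cmap \<kappa> -` ball (cmap \<kappa> T) r"
    have W: "open ?W" "T \<in> ?W"
      using continuous_open_preimage[OF cmap_continuous[OF k(1)] chart_open[OF k(1)] open_ball] k r by auto
    have "dist (ds Z Q) (ds T Q) < e" if Z: "Z \<in> ?W" for Z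
    proof -
      let ?z = "cmap \<kappa> Z" and ?x = "cmap \<kappa> T"
      have b: "?z \<in> ball ?x d" "?x \<in> ball ?x d" using Z r d(1) by auto
      have c: "cinv \<kappa> ?z = Z" "cinv \<kappa> ?x = T" using cinv_cmap[OF k(1)] Z k by auto
      have "ds Z Q \<le> (K+1) * norm (?x - ?z) + ds T Q"
        using d(3)[OF b Q] K(2)[of "?x - ?z"] unfolding c by (simp add: distrib_right)
      moreover have "ds T Q \<le> (K+1) * norm (?x - ?z) + ds Z Q"
        using d(3)[OF b(2,1) Q] K(2)[of "?z - ?x"] unfolding c by (simp add: distrib_right norm_minus_commute)
      moreover have "(K+1) * norm (?x - ?z) < (K+1) * r"
        using Z K(1) by (intro mult_strict_left_mono) (auto simp: dist_norm)
      ultimately show ?thesis using r(3) by (simp add: dist_real_def)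
    qed
    then show "\<forall>\<^sub>F Z in at T. dist (ds Z Q) (ds T Q) < e"
      using W unfolding eventually_at_topological by blast
  qed
qed

text \<open>Completeness supplies a geodesic from \<open>A\<close> whose initial velocity is the
  final velocity of \<open>PA\<close>, so the two pieces glue. Time 1 stays at \<open>A\<close>, and
  the length travelled up to time \<open>t\<close> will be \<open>t * ds P A\<close>.\<close>

lemma extension:
  assumes PA: "P \<in> U" "A \<in> U" "P \<noteq> A"
  obtains \<eta> where "geodesic_on M {0..} \<eta>" "\<And>t. t \<in> {0..1} \<Longrightarrow> \<eta> t = geod M U P A t"
proof -
  note g = geod_param[OF PA]
  define \<kappa> where "\<kappa> = chart_at M A"
  have k: "\<kappa> \<in> charts M" "A \<in> cdom \<kappa>" using chart_at[of A] PA U_carrier by (auto simp: \<kappa>_def)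
  obtain v where v: "\<And>t. t \<in> {0..1} \<Longrightarrow> geod M U P A t \<in> cdom \<kappa> \<Longrightarrow>
      ((cmap \<kappa> \<circ> geod M U P A) has_vector_derivative v t) (at t within {0..1})"
    using C1_deriv[OF geodesic_C1[OF g(1)] k(1)] by blast
  obtain c where c: "geodesic_on M UNIV c" "c 0 = A" "((cmap \<kappa> \<circ> c) has_vector_derivative v 1) (at 0)"
    using complete[unfolded complete_surface_def, rule_format, OF k, of "v 1"] by blast
  define \<eta> where "\<eta> = (\<lambda>t. if t \<le> 1 then geod M U P A t else c (1*t + -1))"
  have e1: "\<eta> t = geod M U P A t" if "t \<le> 1" for t using that by (simp add: \<eta>_def)
  have e2: "\<eta> t = c (1*t + -1)" if "1 \<le> t" for t
    using that c(2) g(4) by (cases "t = 1") (auto simp: \<eta>_def)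
  have "geodesic_on M ({0..1} \<union> {1..}) \<eta>"
  proof (rule geodesic_glue[where m=1 and ?\<kappa>0.0=\<kappa> and w="v 1"])
    show "geodesic_on M {0..1} \<eta>" by (rule geodesic_cong[OF g(1)]) (simp add: e1)
    show "geodesic_on M {1..} \<eta>"
      by (rule geodesic_cong[OF geodesic_affine[OF c(1)]]) (simp_all only: e2 atLeast_iff subset_UNIV)
    show "at 1 within {0..1::real} \<noteq> bot" by (simp add: trivial_limit_within islimpt_Icc)
    have "(1::real) islimpt {1..2}" by (simp add: islimpt_Icc)
    then have "(1::real) islimpt {1..}" by (rule islimpt_subset) auto
    then show "at 1 within {1::real..} \<noteq> bot" by (simp add: trivial_limit_within)
    show "\<eta> 1 \<in> cdom \<kappa>" using e1[of 1] g(4) k by simp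
    show "((cmap \<kappa> \<circ> \<eta>) has_vector_derivative v 1) (at 1 within {0..1})"
      by (rule has_vector_derivative_transform[OF _ _ v[of 1]]) (use e1 g(4) k in auto)
    have "((\<lambda>s. (cmap \<kappa> \<circ> c) (1 * s + -1)) has_vector_derivative 1 *\<^sub>R v 1) (at 1 within {1..})"
      by (rule has_vd_affine[where J=UNIV and f="cmap \<kappa> \<circ> c"]) (use c(3) in \<open>simp_all add: o_def\<close>)
    then show "((cmap \<kappa> \<circ> \<eta>) has_vector_derivative v 1) (at 1 within {1..})"
      by (intro has_vector_derivative_transform[of 1 "{1..}" "cmap \<kappa> \<circ> \<eta>" "\<lambda>s. (cmap \<kappa> \<circ> c) (1 * s + -1)"])
         (simp_all add: e2)
  qed (use k in auto)
  moreover have "{0..1} \<union> {1..} = {0::real..}" by auto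
  ultimately show thesis using that[of \<eta>] e1 by simp
qed

lemma extension_in_disk:
  assumes PA: "P \<in> U" "A \<in> U" "P \<noteq> A"
    and \<eta>: "geodesic_on M {0..} \<eta>" "\<And>t. t \<in> {0..1} \<Longrightarrow> \<eta> t = geod M U P A t"
    and t: "1 \<le> t" "\<eta> ` {0..t} \<subseteq> U"
  shows "\<eta> t \<noteq> P" "geodesic_on M {0..1} (\<lambda>s. \<eta> (t * s))" "(\<lambda>s. \<eta> (t * s)) ` {0..1} \<subseteq> U"
    "curve_length M (\<lambda>s. \<eta> (t * s)) = t * ds P A"
proof -
  note g = geod_param[OF PA]
  let ?e = "\<lambda>s. \<eta> (t * s)"
  have im: "(\<lambda>s. t * s + 0) ` {0..1} \<subseteq> {0..t}" using t by (auto intro: mult_left_le)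
  have "geodesic_on M {0..1} (\<lambda>s. \<eta> (t * s + 0))"
    by (rule geodesic_affine[OF \<eta>(1)]) (use im in auto)
  then show e: "geodesic_on M {0..1} ?e" by simp
  show eU: "?e ` {0..1} \<subseteq> U" using im t(2) by fastforce
  \<comment> \<open>The part of the rescaled curve over \<open>[0, 1/t]\<close> is the geodesic
    \<open>PA\<close>, and this determines the total length.\<close>
  have it: "(\<lambda>s. (1/t) * s + 0) ` {0..1} \<subseteq> {0..1}" using t by (auto simp: divide_simps)
  have "curve_length M (\<lambda>s. ?e ((1/t) * s + 0)) = \<bar>1/t\<bar> * curve_length M ?e"
    by (rule curve_length_affine[OF e it])
  moreover have "curve_length M (\<lambda>s. ?e ((1/t) * s + 0)) = ds P A"
    using curve_length_cong[OF geodesic_C1[OF g(1)], of "\<lambda>s. ?e ((1/t) * s + 0)"] \<eta>(2) t(1) g(7) by simp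
  ultimately show len: "curve_length M ?e = t * ds P A" using t(1) by (simp add: field_simps)
  show "\<eta> t \<noteq> P"
  proof
    assume tP: "\<eta> t = P"
    \<comment> \<open>Suppose the extension returns to \<open>P\<close>. The midpoint of
      \<open>PA\<close> then has its distance to \<open>P\<close> realized along both arcs of the
      loop, so it halves the loop; this gives \<open>t = 1\<close> and hence
      \<open>A = P\<close>.\<close>
    have h: "1/(2*t) \<in> {0..1}" "t * (1/(2*t)) = 1/2" using t(1) by (auto simp: divide_simps)
    have g0: "?e 0 = P" using \<eta>(2)[of 0] g(3) by simp
    have g1: "?e 1 = P" using tP by simp
    have eh: "?e (1/(2*t)) = geod M U P A (1/2)" unfolding h(2) by (rule \<eta>(2)) simp
    have ne: "?e (1/(2*t)) \<noteq> P"
      unfolding eh using inj_onD[OF g(6), of "1/2" 0] g(3) by auto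
    have "ds (?e 0) (?e (1/(2*t))) = \<bar>1/(2*t) - 0\<bar> * curve_length M ?e"
      by (rule ds_sub[OF e eU _ h(1)]) (use ne g0 in auto)
    moreover have "ds (?e 1) (?e (1/(2*t))) = \<bar>1/(2*t) - 1\<bar> * curve_length M ?e"
      by (rule ds_sub[OF e eU _ h(1)]) (use ne g1 in auto)
    ultimately have "\<bar>1/(2*t) - 0\<bar> * (t * ds P A) = \<bar>1/(2*t) - 1\<bar> * (t * ds P A)"
      unfolding len g0 g1 by simp
    moreover have "t * ds P A \<noteq> 0" using ds_pos[OF PA] t(1) by simp
    ultimately have "\<bar>1/(2*t) - 0\<bar> = \<bar>1/(2*t) - 1\<bar>" using mult_right_cancel by blast
    then have "1/(2*t) = 1/2" by linarith
    then have "1/(2*t) = 1/2" by linarith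
    then have "t = 1" using t(1) by (simp add: divide_simps)
    then show False using tP \<eta>(2)[of 1] g(4) PA(3) by simp
  qed
qed

text \<open>As long as the extension stays in the disk it realizes distances, so its length is the
  distance from \<open>P\<close>, and this is bounded on the compact set
  \<open>I \<union> J\<close>. Therefore it leaves \<open>I\<close>; at the first exit time it is
  still in the closed set \<open>I \<union> J\<close>, thus in \<open>J\<close>.\<close>

lemma extension_exits:
  assumes PA: "P \<in> U" "A \<in> U" "P \<noteq> A"
    and \<eta>: "geodesic_on M {0..} \<eta>" "\<And>t. t \<in> {0..1} \<Longrightarrow> \<eta> t = geod M U P A t"
    and I: "open I" "A \<in> I" "compact (I \<union> J)" "I \<union> J \<subseteq> U" "I \<inter> J = {}"
  obtains t where "1 < t" "\<eta> ` {0..t} \<subseteq> U" "\<eta> t \<in> J"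
proof -
  note g = geod_param[OF PA]
  have c: "continuous_on {1..} \<eta>" using geodesic_continuous[OF \<eta>(1)] by (rule continuous_on_subset) auto
  have below1: "\<eta> s \<in> U" if "s \<in> {0..1}" for s using \<eta>(2)[OF that] g(2) that by auto
  have \<eta>1: "\<eta> 1 = A" using \<eta>(2)[of 1] g(4) by simp
  define E where "E = {t\<in>{1..}. \<eta> t \<notin> I}"
  have "E \<noteq> {}"
  proof
    assume "E = {}"
    then have all: "\<eta> t \<in> I" if "1 \<le> t" for t using that by (auto simp: E_def)
    have "compact ((\<lambda>Z. ds Z P) ` (I \<union> J))"
      by (intro compact_continuous_image continuous_on_subset[OF ds_continuous[OF PA(1)]] I)
    then obtain B where B: "\<And>Z. Z \<in> I \<union> J \<Longrightarrow> ds Z P \<le> B"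
      using bounded_has_Sup(1)[OF compact_imp_bounded] by (metis image_eqI empty_iff)
    \<comment> \<open>Chosen so that the length \<open>t * ds P A\<close> exceeds the bound
      \<open>B\<close> on the distances.\<close>
    define t where "t = max 1 ((B + 1) / ds P A)"
    have t: "1 \<le> t" "B + 1 \<le> t * ds P A"
      using ds_pos[OF PA] by (auto simp: t_def pos_divide_le_eq[symmetric])
    have tU: "\<eta> ` {0..t} \<subseteq> U"
    proof (rule image_subsetI)
      fix s assume "s \<in> {0..t}"
      then show "\<eta> s \<in> U" using below1[of s] all[of s] I(4) by (cases "s \<le> 1") auto
    qed
    note x = extension_in_disk[OF PA \<eta> t(1) tU]
    have "ds (\<eta> (t * 0)) (\<eta> (t * 1)) = curve_length M (\<lambda>s. \<eta> (t * s))"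
      by (rule ds_geodesic[OF x(2,3)]) (use x(1) \<eta>(2)[of 0] g(3) in auto)
    then have "ds P (\<eta> t) = t * ds P A" using x(4) \<eta>(2)[of 0] g(3) by simp
    moreover have "\<eta> t \<in> U" using tU t by auto
    ultimately show False using B[of "\<eta> t"] all[OF t(1)] t(2) ds_sym[OF PA(1)] by auto
  qed
  have "E = {1..} \<inter> \<eta> -` (- I)" by (auto simp: E_def)
  then have "closed E" using continuous_closed_preimage[OF c] I(1) by (simp add: closed_Compl)
  \<comment> \<open>The first exit time; it is attained because \<open>I\<close> is open and so
    \<open>E\<close> is closed.\<close>
  define t where "t = Inf E"
  have bE: "bdd_below E" unfolding E_def by (rule bdd_belowI[of _ 1]) auto
  have tE: "t \<in> E" unfolding t_def by (rule closed_contains_Inf) fact+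
  have below: "\<eta> s \<in> I" if "1 \<le> s" "s < t" for s
    using that cInf_lower[OF _ bE, of s] by (auto simp: t_def E_def)
  have t1: "1 < t" using tE I(2) \<eta>1 unfolding E_def by (cases "t = 1") auto
  have K: "closed (I \<union> J)" using I(3) by (rule compact_imp_closed)
  have "\<eta> t \<in> I \<union> J"
  proof (rule Lim_in_closed_set[OF K])
    show "(\<eta> \<longlongrightarrow> \<eta> t) (at t within {1..<t})"
      using c t1 unfolding continuous_on_def by (meson atLeastLessThan_iff atLeast_iff less_imp_le subsetI tendsto_within_subset)
    show "at t within {1..<t} \<noteq> bot" using t1 by (simp add: trivial_limit_within islimpt_Ico)
    show "\<forall>\<^sub>F s in at t within {1..<t}. \<eta> s \<in> I \<union> J"
      unfolding eventually_at_filter using below by (intro always_eventually) auto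
  qed
  then have tJ: "\<eta> t \<in> J" using tE by (auto simp: E_def)
  have "\<eta> ` {0..t} \<subseteq> U"
  proof (rule image_subsetI)
    fix s assume s: "s \<in> {0..t}"
    consider "s \<le> 1" | "1 \<le> s" "s < t" | "s = t" using s by force
    then show "\<eta> s \<in> U" using below1[of s] below[of s] tJ I(4) s by cases auto
  qed
  then show thesis using that t1 tJ by blast
qed

end


section \<open>Triangles and theta curves\<close>

definition arc_between :: "'a::topological_space set \<Rightarrow> 'a \<Rightarrow> 'a \<Rightarrow> bool" where
  "arc_between S a b \<longleftrightarrow> (\<exists>g. arc g \<and> path_image g = S \<and> pathstart g = a \<and> pathfinish g = b)"

lemma arc_between_sym: "arc_between S a b \<Longrightarrow> arc_between S b a"
  unfolding arc_between_def by (metis arc_reversepath path_image_reversepath pathfinish_reversepath pathstart_reversepath)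

lemma arc_between_join:
  assumes "arc_between S a b" "arc_between T b c" "S \<inter> T \<subseteq> {b}"
  shows "arc_between (S \<union> T) a c"
proof -
  obtain g where g: "arc g" "path_image g = S" "pathstart g = a" "pathfinish g = b"
    using assms(1) unfolding arc_between_def by blast
  obtain h where h: "arc h" "path_image h = T" "pathstart h = b" "pathfinish h = c"
    using assms(2) unfolding arc_between_def by blast
  have "arc (g +++ h)" using g h assms(3) by (intro arc_join) auto
  then show ?thesis unfolding arc_between_def using g h
    by (intro exI[of _ "g +++ h"]) (simp add: path_image_join)
qed

lemma arc_between_endless:
  assumes "arc_between S a b"
  shows "compact S" "connected S" "connected (S - {a,b})" "a \<in> S" "b \<in> S"
proof -
  obtain g where g: "arc g" "path_image g = S" "pathstart g = a" "pathfinish g = b"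
    using assms unfolding arc_between_def by blast
  show "compact S" "connected S" "connected (S - {a,b})" "a \<in> S" "b \<in> S"
    using g compact_arc_image connected_arc_image connected_simple_path_endless[OF arc_imp_simple_path[OF g(1)]]
      pathstart_in_path_image[of g] pathfinish_in_path_image[of g] by auto
qed

lemma arc_between_image:
  assumes "arc_between S a b" "continuous_on S f" "inj_on f S"
  shows "arc_between (f ` S) (f a) (f b)"
proof -
  obtain g where g: "arc g" "path_image g = S" "pathstart g = a" "pathfinish g = b"
    using assms(1) unfolding arc_between_def by blast
  have "arc (f \<circ> g)" using g(1) assms(2,3) unfolding arc_def path_def g(2)[symmetric] path_image_def
    by (blast intro: continuous_on_compose comp_inj_on)
  then show ?thesis unfolding arc_between_def using g
    by (intro exI[of _ "f \<circ> g"]) (auto simp: path_image_compose pathstart_compose pathfinish_compose)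
qed

lemma connected_inside:
  assumes "connected T" "T \<inter> S = {}" "x \<in> T" "x \<in> inside S"
  shows "T \<subseteq> inside S"
proof
  fix y assume "y \<in> T"
  then have "connected_component (- S) x y"
    using assms unfolding connected_component_def by (intro exI[of _ T]) auto
  then show "y \<in> inside S" using inside_same_component assms(4) by blast
qed

lemma Jordan_arcs:
  fixes S T :: "complex set"
  assumes S: "arc_between S a b" and T: "arc_between T a b" and "S \<inter> T = {a,b}"
  shows "inside (S \<union> T) \<noteq> {}" "connected (inside (S \<union> T))" "frontier (inside (S \<union> T)) = S \<union> T"
proof -
  obtain g where g: "arc g" "path_image g = S" "pathstart g = a" "pathfinish g = b"
    using S unfolding arc_between_def by blast
  obtain h where h: "arc h" "path_image h = T" "pathstart h = b" "pathfinish h = a"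
    using arc_between_sym[OF T] unfolding arc_between_def by blast
  have "simple_path (g +++ h)" using g h assms(3) by (intro simple_path_join_loop) auto
  moreover have "pathfinish (g +++ h) = pathstart (g +++ h)" using g h by simp
  moreover have "path_image (g +++ h) = S \<union> T" using g h by (simp add: path_image_join)
  ultimately show "inside (S \<union> T) \<noteq> {}" "connected (inside (S \<union> T))" "frontier (inside (S \<union> T)) = S \<union> T"
    using Jordan_inside_outside[of "g +++ h"] by auto
qed

text \<open>If the third arc of a theta curve avoids the inside of the loop formed by the other two, a point
  of that inside can only be separated from infinity by a loop through the third arc (Janiszewski).\<close>

lemma theta_curve:
  fixes P P1 P2 :: "complex set"
  assumes P1: "arc_between P1 a b" and P2: "arc_between P2 a b" and P: "arc_between P a b"
    and i12: "P1 \<inter> P2 = {a,b}" and i1: "P1 \<inter> P = {a,b}" and i2: "P2 \<inter> P = {a,b}"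
  shows "P - {a,b} \<subseteq> inside (P1 \<union> P2) \<or> P1 - {a,b} \<subseteq> inside (P2 \<union> P) \<or> P2 - {a,b} \<subseteq> inside (P1 \<union> P)"
proof (cases "P \<inter> inside (P1 \<union> P2) = {}")
  case False
  then obtain x where x: "x \<in> P" "x \<in> inside (P1 \<union> P2)" by blast
  then have "x \<notin> P1 \<union> P2" using inside_no_overlap by blast
  then have "x \<in> P - {a,b}" using x i12 by blast
  moreover have "(P - {a,b}) \<inter> (P1 \<union> P2) = {}" using i1 i2 by blast
  ultimately show ?thesis
    using connected_inside[OF arc_between_endless(3)[OF P] _ _ x(2)] by blast
next
  case True
  let ?I = "inside (P1 \<union> P2)"
  note J = Jordan_arcs[OF P1 P2 i12]
  obtain x where x: "x \<in> ?I" using J(1) by blast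
  have cpt: "compact P1" "compact P2" "compact P" using arc_between_endless(1) P1 P2 P by blast+
  have disj: "?I \<inter> (P1 \<union> P2) = {}" using inside_no_overlap by blast
  have *: "Q - {a,b} \<subseteq> inside (R \<union> P)"
    \<comment> \<open>\<open>R\<close> and \<open>Q\<close> are the two arcs of the original loop.
      Its connected inside misses \<open>R \<union> P\<close>, hence lies inside that loop as soon
      as one of its points does; passing to closures brings the frontier along, and with it
      \<open>Q\<close>.\<close>
    if xR: "x \<in> inside (R \<union> P)" and RQ: "P1 \<union> P2 = R \<union> Q" "R \<inter> Q = {a,b}" "Q \<inter> P = {a,b}" "compact R" for Q R
  proof -
    have "?I \<inter> (R \<union> P) = {}" using disj True RQ by blast
    then have "?I \<subseteq> inside (R \<union> P)" using connected_inside[OF J(2) _ x xR] by blast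
    then have "closure ?I \<subseteq> closure (inside (R \<union> P))" by (rule closure_mono)
    also have "\<dots> \<subseteq> (R \<union> P) \<union> inside (R \<union> P)"
      using RQ(4) cpt by (intro closure_inside_subset closed_Un compact_imp_closed)
    finally have "R \<union> Q \<subseteq> (R \<union> P) \<union> inside (R \<union> P)"
      using J(3) RQ(1) unfolding frontier_def by blast
    then show ?thesis using RQ by blast
  qed
  have "x \<in> inside (P1 \<union> P) \<or> x \<in> inside (P2 \<union> P)"
  proof (rule ccontr)
    assume no: "\<not> ?thesis"
    have "x \<notin> P" "x \<notin> P1" "x \<notin> P2" using True disj x by blast+
    then have xo: "x \<in> outside (P1 \<union> P)" "x \<in> outside (P2 \<union> P)"
      using no inside_Un_outside by (metis ComplI UnE)+
    have "bounded (P1 \<union> P2 \<union> P)" using cpt by (simp add: compact_imp_bounded)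
    then have "outside (P1 \<union> P2 \<union> P) \<noteq> {}" using outside_bounded_nonempty by blast
    then obtain y where y: "y \<in> outside (P1 \<union> P2 \<union> P)" by blast
    have yo: "y \<in> outside (P1 \<union> P)" "y \<in> outside (P2 \<union> P)" "y \<in> outside (P1 \<union> P2)"
      using y outside_mono[of "P1 \<union> P" "P1 \<union> P2 \<union> P"] outside_mono[of "P2 \<union> P" "P1 \<union> P2 \<union> P"]
        outside_mono[of "P1 \<union> P2" "P1 \<union> P2 \<union> P"] by blast+
    have cc: "connected_component (- (R \<union> P)) x y"
      if "compact R" "x \<in> outside (R \<union> P)" "y \<in> outside (R \<union> P)" for R
    proof -
      have "connected (outside (R \<union> P))" using that(1) cpt by (intro connected_outside) (auto simp: compact_imp_bounded)
      then show ?thesis unfolding connected_component_def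
        using that outside_no_overlap[of "R \<union> P"]
        by (intro exI[of _ "outside (R \<union> P)"] conjI) (assumption | blast)+
    qed
    \<comment> \<open>Neither of the two loops separates \<open>x\<close> from \<open>y\<close>, and
      they meet in the connected set \<open>P\<close>; so their union does not separate them either,
      although \<open>P1 \<union> P2\<close> does.\<close>
    have "connected_component (- ((P1 \<union> P) \<union> (P2 \<union> P))) x y"
    proof (rule Janiszewski)
      have "(P1 \<union> P) \<inter> (P2 \<union> P) = P" using i12 i1 by blast
      then show "connected ((P1 \<union> P) \<inter> (P2 \<union> P))" using arc_between_endless(2)[OF P] by simp
    qed (use cc cpt xo yo in \<open>auto intro: compact_imp_closed\<close>)
    then have "connected_component (- (P1 \<union> P2)) x y"
      by (rule connected_component_of_subset) blast
    then have "y \<in> ?I" using inside_same_component x by blast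
    then show False using yo(3) inside_Int_outside[of "P1 \<union> P2"] by blast
  qed
  then show ?thesis
    using *[of P1 P2] *[of P2 P1] i12 i1 i2 cpt by (auto simp: Un_commute Int_commute)
qed

section \<open>Insides of loops in the disk\<close>

locale geodesic_disk_coords = geodesic_disk M U
  for M :: "'a::{t2_space,second_countable_topology} surface" and U +
  fixes \<psi> :: "'a \<Rightarrow> complex" and \<psi>i :: "complex \<Rightarrow> 'a"
  assumes hom: "homeomorphism U UNIV \<psi> \<psi>i"
begin

lemma psi: "continuous_on U \<psi>" "continuous_on UNIV \<psi>i" "X \<in> U \<Longrightarrow> \<psi>i (\<psi> X) = X" "\<psi> (\<psi>i z) = z" "\<psi>i z \<in> U"
  using hom by (auto simp: homeomorphism_def)

lemma psi_inj: "inj_on \<psi> U" by (metis inj_on_inverseI psi(3))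

text \<open>Transported to the plane because \<open>inside\<close> refers to bounded components, and
  boundedness has no meaning in the bare topological type of \<open>M\<close>.\<close>

definition ins :: "'a set \<Rightarrow> 'a set" where
  "ins J = {X \<in> U. \<psi> X \<in> inside (\<psi> ` J)}"

lemma ins_U: "ins J \<subseteq> U" by (auto simp: ins_def)

lemma ins_disjoint: "J \<subseteq> U \<Longrightarrow> ins J \<inter> J = {}"
  using inside_no_overlap[of "\<psi> ` J"] unfolding ins_def by blast

lemma psi_compact: "compact J \<Longrightarrow> J \<subseteq> U \<Longrightarrow> compact (\<psi> ` J)"
  using compact_continuous_image continuous_on_subset psi(1) by blast

lemma ins_open:
  assumes "compact J" "J \<subseteq> U" shows "open (ins J)"
proof -
  have "open (inside (\<psi> ` J))"
    using open_inside compact_imp_closed psi_compact[OF assms] by blast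
  moreover have "ins J = U \<inter> \<psi> -` inside (\<psi> ` J)" by (auto simp: ins_def)
  ultimately show ?thesis using continuous_open_preimage[OF psi(1) U_open] by simp
qed

text \<open>In the plane the set is the complement of the open outside, hence closed, and it is
  bounded. The compactness serves twice: to force extended geodesics out of a loop and to obtain the
  minimiser.\<close>

lemma ins_compact:
  assumes "compact J" "J \<subseteq> U" shows "compact (ins J \<union> J)"
proof -
  let ?K = "\<psi> ` J \<union> inside (\<psi> ` J)"
  note c = psi_compact[OF assms]
  have "closed ?K"
    unfolding union_with_inside using open_outside[OF compact_imp_closed[OF c]] by (simp add: closed_def)
  moreover have "bounded ?K" using bounded_inside compact_imp_bounded[OF c] by (simp add: bounded_inside)
  ultimately have "compact (\<psi>i ` ?K)"
    by (intro compact_continuous_image continuous_on_subset[OF psi(2)]) (auto simp: compact_eq_bounded_closed)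
  moreover have "\<psi>i ` ?K = ins J \<union> J"
  proof
    show "\<psi>i ` ?K \<subseteq> ins J \<union> J" using psi assms(2) by (auto simp: ins_def)
    show "ins J \<union> J \<subseteq> \<psi>i ` ?K"
    proof
      fix X assume "X \<in> ins J \<union> J"
      then have "X \<in> U" "\<psi> X \<in> ?K" using assms(2) by (auto simp: ins_def)
      then show "X \<in> \<psi>i ` ?K" using psi(3) by (metis image_eqI)
    qed
  qed
  ultimately show ?thesis by simp
qed

lemma ins_exit:
  assumes PA: "P \<in> U" "A \<in> ins J" "P \<noteq> A" and J: "compact J" "J \<subseteq> U"
    and \<eta>: "geodesic_on M {0..} \<eta>" "\<And>t. t \<in> {0..1} \<Longrightarrow> \<eta> t = geod M U P A t"
  obtains t where "1 < t" "\<eta> ` {0..t} \<subseteq> U" "\<eta> t \<in> J"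
proof -
  have A: "A \<in> U" using PA(2) ins_U by blast
  show thesis
    by (rule extension_exits[OF PA(1) A PA(3) \<eta> ins_open[OF J] PA(2) ins_compact[OF J]])
       (use ins_U J ins_disjoint that in auto)
qed

lemma extension_seg:
  assumes PA: "P \<in> U" "A \<in> U" "P \<noteq> A"
    and \<eta>: "geodesic_on M {0..} \<eta>" "\<And>t. t \<in> {0..1} \<Longrightarrow> \<eta> t = geod M U P A t"
    and t: "1 < t" "\<eta> ` {0..t} \<subseteq> U"
  shows "A \<in> seg P (\<eta> t)" "\<eta> t \<noteq> P" "ds A (\<eta> t) = (t - 1) * ds P A"
proof -
  have t1: "1 \<le> t" using t by simp
  note x = extension_in_disk[OF PA \<eta> t1 t(2)]
  let ?e = "\<lambda>s. \<eta> (t * s)"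
  have e0: "?e 0 = P" using \<eta>(2)[of 0] geod_0[OF PA] by simp
  have eA: "?e (1/t) = A" using \<eta>(2)[of 1] geod_1[OF PA] t by simp
  have t01: "1/t \<in> {0..1}" using t by simp
  have e01: "?e 0 \<noteq> ?e 1" using e0 x(1) by auto
  show "\<eta> t \<noteq> P" by (rule x(1))
  have "seg P (\<eta> t) = ?e ` {0..1}" using seg_eq[OF x(2,3) e01] e0 by simp
  then show "A \<in> seg P (\<eta> t)" using eA t01 by (metis image_eqI)
  have "1/t \<noteq> 1" using t by simp
  then have "?e (1/t) \<noteq> ?e 1" using inj_onD[OF geodesic_inj[OF x(2,3) e01], of "1/t" 1] t01 by auto
  then have "ds (?e (1/t)) (?e 1) = \<bar>1 - 1/t\<bar> * curve_length M ?e"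
    using t01 by (intro ds_sub[OF x(2,3)]) auto
  then have "ds A (\<eta> t) = \<bar>1 - 1/t\<bar> * (t * ds P A)" using eA x(4) by simp
  also have "\<bar>1 - 1/t\<bar> * (t * ds P A) = (1 - 1/t) * t * ds P A" using t by simp
  also have "(1 - 1/t) * t = t - 1" using t by (simp add: field_simps)
  finally show "ds A (\<eta> t) = (t - 1) * ds P A" .
qed

text \<open>The form of \<open>ins_exit\<close> in which only the incidence of the exit point with
  the prolonged segment survives.\<close>

lemma ins_exit_seg:
  assumes PA: "P \<in> U" "A \<in> ins J" "P \<noteq> A" and J: "compact J" "J \<subseteq> U"
  obtains Z where "Z \<in> J" "Z \<noteq> P" "A \<in> seg P Z"
proof -
  have A: "A \<in> U" using PA(2) ins_U by blast
  obtain \<eta> where \<eta>: "geodesic_on M {0..} \<eta>" "\<And>t. t \<in> {0..1} \<Longrightarrow> \<eta> t = geod M U P A t"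
    using extension[OF PA(1) A PA(3)] by blast
  obtain t where t: "1 < t" "\<eta> ` {0..t} \<subseteq> U" "\<eta> t \<in> J"
    using ins_exit[OF PA J \<eta>] by blast
  show thesis using that[OF t(3)] extension_seg[OF PA(1) A PA(3) \<eta> t(1,2)] by blast
qed

lemma arc_seg:
  assumes "P \<in> U" "Q \<in> U" "P \<noteq> Q" shows "arc_between (seg P Q) P Q"
  unfolding arc_between_def
proof (intro exI conjI)
  show "arc (geod M U P Q)" unfolding arc_def path_def
    using geod_param(1,6)[OF assms] geodesic_continuous by blast
qed (use geod_param[OF assms] in \<open>auto simp: path_image_def pathstart_def pathfinish_def\<close>)

lemma theta_U:
  assumes P1: "arc_between P1 a b" and P2: "arc_between P2 a b" and P: "arc_between P a b"
    and U: "P1 \<subseteq> U" "P2 \<subseteq> U" "P \<subseteq> U"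
    and i12: "P1 \<inter> P2 = {a,b}" and i1: "P1 \<inter> P = {a,b}" and i2: "P2 \<inter> P = {a,b}"
  shows "P - {a,b} \<subseteq> ins (P1 \<union> P2) \<or> P1 - {a,b} \<subseteq> ins (P2 \<union> P) \<or> P2 - {a,b} \<subseteq> ins (P1 \<union> P)"
proof -
  have im: "arc_between (\<psi> ` S) (\<psi> a) (\<psi> b)" if "arc_between S a b" "S \<subseteq> U" for S
    using that by (intro arc_between_image continuous_on_subset[OF psi(1)] inj_on_subset[OF psi_inj])
  have int: "\<psi> ` S \<inter> \<psi> ` T = {\<psi> a, \<psi> b}" if "S \<subseteq> U" "T \<subseteq> U" "S \<inter> T = {a,b}" for S T
    using inj_on_image_Int[OF psi_inj that(1,2)] that(3) by simp
  have sub: "S - {a,b} \<subseteq> ins J" if "\<psi> ` S - {\<psi> a, \<psi> b} \<subseteq> inside (\<psi> ` J)" "S \<subseteq> U" "a \<in> S" "b \<in> S" for S J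
  proof
    fix X assume X: "X \<in> S - {a,b}"
    then have "\<psi> X \<notin> {\<psi> a, \<psi> b}" using that psi_inj by (auto dest: inj_onD)
    then show "X \<in> ins J" using that X by (auto simp: ins_def)
  qed
  note e = arc_between_endless(4,5)
  from theta_curve[OF im[OF P1 U(1)] im[OF P2 U(2)] im[OF P U(3)] int[OF U(1,2) i12] int[OF U(1,3) i1] int[OF U(2,3) i2]]
  show ?thesis unfolding image_Un[symmetric]
    using sub[OF _ U(1) e[OF P1]] sub[OF _ U(2) e[OF P2]] sub[OF _ U(3) e[OF P]] by blast
qed

section \<open>Nondegenerate triangles and their cevians\<close>

lemma angle_sym: "X \<in> U \<Longrightarrow> angle M U P X Q = angle M U Q X P"
  by (simp add: angle_tang inner_at_sym[of X "tang X P"] mult.commute)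

text \<open>Excluding the angle pi is the usable form of nondegeneracy: a vertex on the opposite
  side would see the other two in opposite directions. The condition is invariant under permutations
  of the vertices.\<close>

definition proper_triangle :: "'a \<Rightarrow> 'a \<Rightarrow> 'a \<Rightarrow> bool" where
  "proper_triangle A B C \<longleftrightarrow> A \<in> U \<and> B \<in> U \<and> C \<in> U \<and> A \<noteq> B \<and> B \<noteq> C \<and> C \<noteq> A \<and>
     angle M U C A B \<noteq> pi \<and> angle M U A B C \<noteq> pi \<and> angle M U B C A \<noteq> pi"

lemma proper_rotate: "proper_triangle A B C \<Longrightarrow> proper_triangle B C A"
  by (auto simp: proper_triangle_def)

lemma proper_swap: "proper_triangle A B C \<Longrightarrow> proper_triangle B A C"
  by (auto simp: proper_triangle_def angle_sym)

lemma proper_not_in_side: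
  assumes "proper_triangle A B C" shows "A \<notin> seg B C"
proof
  assume "A \<in> seg B C"
  then have "angle M U C A B = pi"
    using assms angle_opposite[of B C A] angle_sym[of A B C] by (auto simp: proper_triangle_def)
  then show False using assms by (simp add: proper_triangle_def)
qed

text \<open>By \<open>seg_meet\<close> a second common point would put a vertex on a side not ending
  there.\<close>

lemma proper_sides_meet:
  assumes "proper_triangle A B C" shows "seg A B \<inter> seg A C = {A}"
proof -
  have U: "A \<in> U" "B \<in> U" "C \<in> U" using assms by (auto simp: proper_triangle_def)
  have "B \<notin> seg A C" using proper_not_in_side[OF proper_swap[OF assms]] .
  moreover have "C \<notin> seg A B" using proper_not_in_side[OF proper_rotate[OF proper_rotate[OF assms]]] .
  ultimately show ?thesis using seg_meet[OF U] end_in_seg[of A B] end_in_seg[of A C] U by blast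
qed

lemma seg_between:
  assumes "A \<in> U" "B \<in> U" "T \<in> seg A B"
  shows "seg A T \<union> seg T B = seg A B" "seg A T \<inter> seg T B = {T}"
proof -
  have T: "T \<in> U" using assms seg_U by blast
  show "seg A T \<union> seg T B = seg A B"
  proof (cases "A = B")
    case True then show ?thesis using assms by auto
  next
    case False
    note g = geod_param[OF assms(1,2) False]
    obtain s where s: "s \<in> {0..1}" "T = geod M U A B s" using assms(3) g(5) by auto
    have "seg A T = geod M U A B ` {0..s}" using seg_sub[OF g(1,2) _ s(1) _ g(6), of 0] s g(3) by simp
    moreover have "seg T B = geod M U A B ` {s..1}" using seg_sub[OF g(1,2) s(1) _ _ g(6), of 1] s g(4) by simp
    moreover have "{0..s} \<union> {s..1} = {0..1}" using s by auto
    ultimately show ?thesis using g(5) by (metis image_Un)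
  qed
  show "seg A T \<inter> seg T B = {T}"
  proof -
    have "Z = T" if Z: "Z \<in> seg A T" "Z \<in> seg T B" for Z
    proof (rule ccontr)
      assume "Z \<noteq> T"
      then have "A \<in> seg T B \<or> B \<in> seg T A"
        using seg_meet[of T A B Z] Z seg_sym[OF T assms(1)] T assms by auto
      then show False
      proof
        assume "A \<in> seg T B"
        then have "A \<in> seg B T" using seg_sym[OF T assms(2)] by simp
        moreover have "T \<in> seg B A" using assms seg_sym by auto
        ultimately have "A \<in> seg T T" using seg_order[of B T A T] T assms by auto
        then show False using Z \<open>Z \<noteq> T\<close> by auto
      next
        assume "B \<in> seg T A"
        then have "B \<in> seg A T" using seg_sym[OF T assms(1)] by simp
        then have "B \<in> seg T T" using seg_order[of A T B T] T assms by auto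
        then show False using Z \<open>Z \<noteq> T\<close> by auto
      qed
    qed
    then show ?thesis using end_in_seg[OF assms(1) T] end_in_seg[OF T assms(2)] by blast
  qed
qed

lemma seg_antisym:
  assumes "A \<in> U" "B \<in> U" "T \<in> seg A B" "A \<in> seg B T" shows "A = T"
proof -
  have T: "T \<in> U" using assms seg_U by blast
  have "A \<in> seg T B" using assms seg_sym T by auto
  moreover have "A \<in> seg A T" using end_in_seg T assms by auto
  ultimately show ?thesis using seg_between(2)[OF assms(1-3)] by blast
qed

text \<open>If \<open>B\<close> were on the cevian, the angle at \<open>B\<close> between
  \<open>T\<close> and \<open>C\<close> would be pi; but \<open>T\<close> lies on \<open>BA\<close>,
  so this is the angle of the triangle at \<open>B\<close>.\<close>

lemma cevian_avoids:
  assumes tri: "proper_triangle A B C" and T: "T \<in> seg A B" "T \<noteq> A" "T \<noteq> B"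
  shows "B \<notin> seg T C" "T \<notin> seg B C" "T \<noteq> C"
proof -
  have U: "A \<in> U" "B \<in> U" "C \<in> U" using tri by (auto simp: proper_triangle_def)
  have TU: "T \<in> U" using T U seg_U by blast
  have CB: "C \<notin> seg A B" using proper_not_in_side[OF proper_rotate[OF proper_rotate[OF tri]]] .
  then show TC: "T \<noteq> C" using T by auto
  show "B \<notin> seg T C"
  proof
    assume B: "B \<in> seg T C"
    have BC: "B \<noteq> C" using tri by (auto simp: proper_triangle_def)
    have "angle M U T B C = pi" using angle_opposite[OF TU U(3) B] T BC by auto
    moreover have "angle M U T B C = angle M U A B C"
      using T BC seg_sym[OF U(1,2)] end_in_seg(2)[OF U(2,3)] by (intro angle_sub U) auto
    ultimately show False using tri by (simp add: proper_triangle_def)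
  qed
  show "T \<notin> seg B C"
    using proper_sides_meet[OF proper_swap[OF tri]] seg_sym[OF U(1,2)] T by auto
qed

text \<open>Otherwise \<open>BA\<close>, prolonged beyond \<open>A\<close>, hits the loop in some
  \<open>Z\<close>. On \<open>TB\<close> this contradicts the order of points on \<open>AB\<close>;
  on \<open>BC\<close> it puts \<open>A\<close> on \<open>BC\<close>; on the cevian it puts
  \<open>A\<close> between \<open>T\<close> and \<open>Z\<close>, hence on the cevian.\<close>

lemma cevian_exit:
  assumes tri: "proper_triangle A B C" and T: "T \<in> seg A B" "T \<noteq> A" "T \<noteq> B"
  shows "A \<notin> ins (seg T B \<union> seg B C \<union> seg T C)"
proof
  let ?J = "seg T B \<union> seg B C \<union> seg T C"
  assume A: "A \<in> ins ?J"
  have U: "A \<in> U" "B \<in> U" "C \<in> U" and ne: "A \<noteq> B" "B \<noteq> C" using tri by (auto simp: proper_triangle_def)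
  have TU: "T \<in> U" using T U seg_U by blast
  note av = cevian_avoids[OF tri T]
  have TB: "T \<in> seg B A" using T seg_sym[OF U(1,2)] by simp
  have "compact ?J"
    using arc_between_endless(1)[OF arc_seg] TU U T av ne by (intro compact_Un) auto
  moreover have "?J \<subseteq> U" using seg_U U TU by auto
  ultimately obtain Z where Z: "Z \<in> ?J" "Z \<noteq> B" "A \<in> seg B Z"
    using ins_exit_seg[OF U(2) A] ne by metis
  have ZU: "Z \<in> U" using Z(1) seg_U U TU by auto
  consider "Z \<in> seg T B" | "Z \<in> seg B C" | "Z \<in> seg T C" using Z(1) by blast
  then show False
  proof cases
    case 1
    then have "Z \<in> seg B T" using seg_sym[OF TU U(2)] by simp
    then have "seg B Z \<subseteq> seg B T" using seg_subset[OF U(2) TU] end_in_seg(1)[OF U(2) TU] by blast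
    then have "A \<in> seg B T" using Z(3) by blast
    then show False using seg_antisym[OF U(1,2) T(1)] T(2) by simp
  next
    case 2
    then have "seg B Z \<subseteq> seg B C" using seg_subset[OF U(2,3)] end_in_seg(1)[OF U(2,3)] by blast
    then show False using Z(3) proper_not_in_side[OF tri] by blast
  next
    case 3
    have "A \<in> seg T Z" by (rule seg_order[OF U(2) ZU Z(3) TB])
    moreover have "seg T Z \<subseteq> seg T C" using 3 seg_subset[OF TU U(3)] end_in_seg(1)[OF TU U(3)] by blast
    moreover have "A \<notin> seg T C"
      by (rule cevian_avoids(1)[OF proper_swap[OF tri] TB T(3,2)])
    ultimately show False by blast
  qed
qed

text \<open>The theta curve has ends \<open>T\<close> and \<open>C\<close>; its arcs are the cevian
  and the two ways around the triangle. In each of the two unwanted alternatives one of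
  \<open>A\<close>, \<open>B\<close> would be inside a loop, which \<open>cevian_exit\<close>
  forbids.\<close>

lemma cevian_inside:
  assumes tri: "proper_triangle A B C" and T: "T \<in> seg A B" "T \<noteq> A" "T \<noteq> B"
  shows "seg T C - {T, C} \<subseteq> ins (seg A B \<union> seg B C \<union> seg C A)"
proof -
  have U: "A \<in> U" "B \<in> U" "C \<in> U" and ne: "A \<noteq> B" "B \<noteq> C" "C \<noteq> A" using tri by (auto simp: proper_triangle_def)
  have TU: "T \<in> U" using T U seg_U by blast
  have TB: "T \<in> seg B A" using T seg_sym[OF U(1,2)] by simp
  note tri' = proper_swap[OF tri]
  note av = cevian_avoids[OF tri T] and av' = cevian_avoids[OF tri' TB T(3,2)]
  \<comment> \<open>Stated for primed vertices so that both sides of the cevian follow by exchanging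
    \<open>A\<close> and \<open>B\<close>.\<close>
  have meet: "seg T C \<inter> seg T B' = {T}" "seg C T \<inter> seg C B' = {C}" "seg T B' \<inter> seg B' C = {B'}"
    if tr: "proper_triangle A' B' C" and T': "T \<in> seg A' B'" "T \<noteq> A'" "T \<noteq> B'" for A' B'
  proof -
    have U': "A' \<in> U" "B' \<in> U" using tr by (auto simp: proper_triangle_def)
    note a = cevian_avoids[OF tr T']
    have sub: "seg T B' \<subseteq> seg A' B'" using seg_subset[OF U' T'(1) end_in_seg(2)[OF U']] .
    have C: "C \<notin> seg T B'" using sub proper_not_in_side[OF proper_rotate[OF proper_rotate[OF tr]]] by blast
    show "seg T C \<inter> seg T B' = {T}"
      using seg_meet[OF TU U(3) U'(2)] a(1) C end_in_seg(1)[OF TU U(3)] end_in_seg(1)[OF TU U'(2)] by blast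
    show "seg C T \<inter> seg C B' = {C}"
      using seg_meet[OF U(3) TU U'(2)] a seg_sym[OF U(3) TU] seg_sym[OF U(3) U'(2)]
        end_in_seg(1)[OF U(3) TU] end_in_seg(1)[OF U(3) U'(2)] by blast
    show "seg T B' \<inter> seg B' C = {B'}"
      using proper_sides_meet[OF proper_swap[OF tr]] sub seg_sym[OF U'] end_in_seg(2)[OF TU U'(2)]
        end_in_seg(1)[OF U'(2) U(3)] by blast
  qed
  note m = meet[OF tri T] and m' = meet[OF tri' TB T(3,2)]
  let ?P1 = "seg T A \<union> seg A C" and ?P2 = "seg T B \<union> seg B C" and ?P = "seg T C"
  have a1: "arc_between ?P1 T C" using m'(3) TU U T ne by (intro arc_between_join[OF arc_seg arc_seg]) auto
  have a2: "arc_between ?P2 T C" using m(3) TU U T ne by (intro arc_between_join[OF arc_seg arc_seg]) auto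
  have a: "arc_between ?P T C" using arc_seg[OF TU U(3) av(3)] .
  have sym: "seg C T = seg T C" "seg C B = seg B C" "seg C A = seg A C" "seg T A = seg A T"
    using seg_sym U TU by auto
  have sAB: "seg A B = seg T A \<union> seg T B" "seg T A \<inter> seg T B = {T}"
    using seg_between[OF U(1,2) T(1)] sym by auto
  have x1: "seg T A \<inter> seg B C = {}"
  proof -
    have a: "seg B A \<inter> seg B C = {B}" by (rule proper_sides_meet[OF tri'])
    have b: "seg T A \<subseteq> seg B A" using seg_subset[OF U(2,1) TB end_in_seg(2)[OF U(2,1)]] .
    have c: "B \<notin> seg T A" using sAB(2) end_in_seg(2)[OF TU U(2)] T(3) by auto
    have False if "Z \<in> seg T A" "Z \<in> seg B C" for Z
      using that a b c by (cases "Z = B") auto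
    then show ?thesis by blast
  qed
  have x2: "seg A C \<inter> seg T B = {}"
  proof -
    have a: "seg A B \<inter> seg A C = {A}" by (rule proper_sides_meet[OF tri])
    have c: "A \<notin> seg T B" using sAB(2) end_in_seg(2)[OF TU U(1)] T(2) by auto
    have False if "Z \<in> seg A C" "Z \<in> seg T B" for Z
      using that a c sAB(1) by (cases "Z = A") auto
    then show ?thesis by blast
  qed
  have x3: "seg A C \<inter> seg B C = {C}"
    using proper_sides_meet[OF proper_rotate[OF proper_rotate[OF tri]]] unfolding sym(2,3) .
  have "?P1 \<inter> ?P2 = (seg T A \<inter> seg T B) \<union> (seg T A \<inter> seg B C) \<union> (seg A C \<inter> seg T B) \<union> (seg A C \<inter> seg B C)"
    by blast
  then have i12: "?P1 \<inter> ?P2 = {T, C}" unfolding sAB(2) x1 x2 x3 by auto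
  have "?P1 \<inter> ?P = (seg T C \<inter> seg T A) \<union> (seg T C \<inter> seg A C)" by blast
  then have i1: "?P1 \<inter> ?P = {T, C}" unfolding m'(1) m'(2)[unfolded sym(1,3)] by auto
  have "?P2 \<inter> ?P = (seg T C \<inter> seg T B) \<union> (seg T C \<inter> seg B C)" by blast
  then have i2: "?P2 \<inter> ?P = {T, C}" unfolding m(1) m(2)[unfolded sym(1,2)] by auto
  have sub: "?P1 \<subseteq> U" "?P2 \<subseteq> U" "?P \<subseteq> U" using seg_U U TU by auto
  have A: "A \<in> ?P1 - {T, C}" "B \<in> ?P2 - {T, C}"
    using end_in_seg(2)[OF TU U(1)] end_in_seg(2)[OF TU U(2)] T ne by auto
  have "A \<notin> ins (?P2 \<union> ?P)" by (rule cevian_exit[OF tri T])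
  moreover have "B \<notin> ins (?P1 \<union> ?P)" by (rule cevian_exit[OF tri' TB T(3,2)])
  ultimately have "?P - {T, C} \<subseteq> ins (?P1 \<union> ?P2)"
    using theta_U[OF a1 a2 a sub i12 i1 i2] A by (meson subsetD)
  moreover have "?P1 \<union> ?P2 = seg A B \<union> seg B C \<union> seg C A" unfolding sAB(1) sym(3) by blast
  ultimately show ?thesis by simp
qed

end


section \<open>First variation of the distance\<close>

lemma has_vector_derivative_expansion:
  fixes f :: "real \<Rightarrow> 'b::real_normed_vector"
  assumes "(f has_vector_derivative u) (at 0 within {0..r1})" "0 < e"
  obtains d where "0 < d" "\<And>r. r \<in> {0..r1} \<Longrightarrow> r < d \<Longrightarrow> norm (f r - f 0 - r *\<^sub>R u) \<le> e * r"
proof -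
  obtain d where d: "0 < d" "\<forall>y\<in>{0..r1}. norm (y - 0) < d \<longrightarrow> norm (f y - f 0 - (y - 0) *\<^sub>R u) \<le> e * norm (y - 0)"
    using assms unfolding has_vector_derivative_def has_derivative_within_alt by blast
  show thesis by (rule that[OF d(1)]) (use d(2) in force)
qed

text \<open>Along the curve \<open>l\<close> may oscillate, so a level can be met several times. The
  intermediate value theorem provides some point on the level line, and every such point is close to
  \<open>\<epsilon> *\<^sub>R u\<close>: this leaves the freedom to choose among them later.\<close>

lemma arm_level:
  fixes q :: "real \<Rightarrow> 'b::real_normed_vector" and l :: "'b \<Rightarrow> real"
  assumes q: "(q has_vector_derivative u) (at 0 within {0..r1})" "continuous_on {0..r1} q" "0 < r1"
    and l: "bounded_linear l" "0 < l u" and e: "0 < e"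
  obtains r0 where "0 < r0" "r0 \<le> r1"
    "\<And>\<epsilon>. 0 < \<epsilon> \<Longrightarrow> \<epsilon> \<le> r0 / 2 \<Longrightarrow> \<exists>r\<in>{0..r0}. l (q r - q 0) = \<epsilon> * l u"
    "\<And>\<epsilon> r. 0 < \<epsilon> \<Longrightarrow> r \<in> {0..r0} \<Longrightarrow> l (q r - q 0) = \<epsilon> * l u \<Longrightarrow> norm (q r - q 0 - \<epsilon> *\<^sub>R u) \<le> e * \<epsilon>"
proof -
  interpret l: bounded_linear l by fact
  obtain K where K: "0 < K" "\<And>z. norm (l z) \<le> norm z * K" using l.pos_bounded by blast
  define k where "k = l u"
  have k: "0 < k" using l(2) by (simp add: k_def)
  \<comment> \<open>The first bound makes the error in \<open>l\<close> at most half of its main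
    term, so that points on the level have \<open>r \<le> 2 * \<epsilon>\<close>; the second is what
    the final triangle inequality consumes.\<close>
  define \<eta> where "\<eta> = min (k / (2 * K)) (e / (2 + 2 * K * norm u / k))"
  have den: "0 < 2 + 2 * K * norm u / k" using K(1) k by (simp add: add_pos_nonneg)
  have \<eta>: "0 < \<eta>" "K * \<eta> \<le> k / 2" "\<eta> * (2 + 2 * K * norm u / k) \<le> e"
  proof -
    show "0 < \<eta>" using K(1) k e den by (simp add: \<eta>_def)
    have "\<eta> \<le> k / (2 * K)" by (simp add: \<eta>_def)
    then show "K * \<eta> \<le> k / 2" using K(1) by (simp add: field_simps)
    have "\<eta> \<le> e / (2 + 2 * K * norm u / k)" by (simp add: \<eta>_def)
    then show "\<eta> * (2 + 2 * K * norm u / k) \<le> e" using den by (simp add: pos_le_divide_eq)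
  qed
  obtain d where d: "0 < d" "\<And>r. r \<in> {0..r1} \<Longrightarrow> r < d \<Longrightarrow> norm (q r - q 0 - r *\<^sub>R u) \<le> \<eta> * r"
    using has_vector_derivative_expansion[OF q(1) \<eta>(1)] by blast
  define r0 where "r0 = min (d/2) r1"
  have r0: "0 < r0" "r0 \<le> r1" "r0 < d" using d(1) q(3) by (auto simp: r0_def min_def)
  have ex: "norm (q r - q 0 - r *\<^sub>R u) \<le> \<eta> * r" if "r \<in> {0..r0}" for r using d(2) that r0 by auto
  have lex: "\<bar>l (q r - q 0) - r * k\<bar> \<le> K * \<eta> * r" if "r \<in> {0..r0}" for r
  proof -
    have "l (q r - q 0) - r * k = l (q r - q 0 - r *\<^sub>R u)" by (simp add: l.diff l.scaleR k_def)
    also have "\<bar>\<dots>\<bar> \<le> norm (q r - q 0 - r *\<^sub>R u) * K" using K(2) by (simp add: real_norm_def)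
    also have "\<dots> \<le> \<eta> * r * K" using ex[OF that] K(1) by (intro mult_right_mono) auto
    finally show ?thesis by (simp add: mult_ac)
  qed
  have half: "K * \<eta> * r \<le> k / 2 * r" if "0 \<le> r" for r using \<eta>(2) that by (rule mult_right_mono)
  show thesis
  proof (rule that[OF r0(1,2)])
    fix \<epsilon> :: real assume \<epsilon>: "0 < \<epsilon>" "\<epsilon> \<le> r0 / 2"
    have c: "continuous_on {0..r0} (\<lambda>r. l (q r - q 0))"
      using q(2) r0 by (intro l.continuous_on continuous_intros) (auto intro: continuous_on_subset)
    have "r0 * k - K * \<eta> * r0 \<le> l (q r0 - q 0)" using lex[of r0] r0 by (auto simp: abs_le_iff)
    moreover have "\<epsilon> * k \<le> r0 / 2 * k" using \<epsilon> k by (intro mult_right_mono) auto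
    moreover have "K * \<eta> * r0 \<le> r0 / 2 * k" using half[of r0] r0(1) by (simp only: mult.commute less_imp_le times_divide_eq_left times_divide_eq_right)
    moreover have "r0 * k = r0 / 2 * k + r0 / 2 * k" by simp
    ultimately have "\<epsilon> * k \<le> l (q r0 - q 0)" by linarith
    moreover have "l (q 0 - q 0) \<le> \<epsilon> * k" using \<epsilon> k by (simp add: l.zero)
    ultimately show "\<exists>r\<in>{0..r0}. l (q r - q 0) = \<epsilon> * l u"
      using IVT'[of "\<lambda>r. l (q r - q 0)" 0 "\<epsilon> * k" r0] c r0(1) by (auto simp: k_def)
  next
    fix \<epsilon> r :: real assume \<epsilon>: "0 < \<epsilon>" and r: "r \<in> {0..r0}" and lv: "l (q r - q 0) = \<epsilon> * l u"
    have r': "0 \<le> r" using r by simp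
    have 1: "\<bar>\<epsilon> - r\<bar> * k \<le> K * \<eta> * r"
    proof -
      have "\<bar>\<epsilon> - r\<bar> * k = \<bar>\<epsilon> * k - r * k\<bar>" using k by (simp add: abs_mult left_diff_distrib[symmetric])
      then show ?thesis using lex[OF r] lv by (simp add: k_def)
    qed
    have "r * k \<le> \<epsilon> * k + k / 2 * r"
    proof -
      have "(r - \<epsilon>) * k \<le> \<bar>\<epsilon> - r\<bar> * k" using k by (intro mult_right_mono) auto
      then show ?thesis using 1 half[OF r'] by (simp add: algebra_simps)
    qed
    then have "r * k \<le> 2 * \<epsilon> * k" by (simp add: algebra_simps)
    then have r2: "r \<le> 2 * \<epsilon>" using k by simp
    have "\<bar>\<epsilon> - r\<bar> * k \<le> K * \<eta> * (2 * \<epsilon>)" using 1 r2 K(1) \<eta>(1) by (meson mult_left_mono order_trans mult_nonneg_nonneg less_imp_le)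
    then have 2: "\<bar>\<epsilon> - r\<bar> \<le> 2 * K * \<eta> * \<epsilon> / k" using k by (simp add: pos_le_divide_eq mult_ac)
    have "norm (q r - q 0 - \<epsilon> *\<^sub>R u) \<le> norm (q r - q 0 - r *\<^sub>R u) + norm ((r - \<epsilon>) *\<^sub>R u)"
      using norm_triangle_ineq[of "q r - q 0 - r *\<^sub>R u" "(r - \<epsilon>) *\<^sub>R u"] by (simp add: algebra_simps)
    also have "\<dots> \<le> \<eta> * r + \<bar>\<epsilon> - r\<bar> * norm u" using ex[OF r] by (simp add: abs_minus_commute)
    also have "\<dots> \<le> \<eta> * (2 * \<epsilon>) + 2 * K * \<eta> * \<epsilon> / k * norm u"
      using r2 \<eta>(1) 2 by (intro add_mono mult_left_mono mult_right_mono) auto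
    also have "\<dots> = \<eta> * (2 + 2 * K * norm u / k) * \<epsilon>" by (simp add: algebra_simps)
    also have "\<dots> \<le> e * \<epsilon>" using \<eta>(3) \<epsilon> by (intro mult_right_mono) auto
    finally show "norm (q r - q 0 - \<epsilon> *\<^sub>R u) \<le> e * \<epsilon>" .
  qed
qed

context geodesic_disk
begin

section \<open>Unit directions and one-sided variations\<close>

definition udir :: "'a \<Rightarrow> 'a \<Rightarrow> real^2" where
  "udir X P = (1 / ds X P) *\<^sub>R tang X P"

lemma inner_at_linear:
  "inner_at M X (u + v) w = inner_at M X u w + inner_at M X v w"
  "inner_at M X (u - v) w = inner_at M X u w - inner_at M X v w"
  "inner_at M X u (v + w) = inner_at M X u v + inner_at M X u w"
  "inner_at M X u (v - w) = inner_at M X u v - inner_at M X u w"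
  "inner_at M X (a *\<^sub>R u) v = a * inner_at M X u v"
  "inner_at M X u (a *\<^sub>R v) = a * inner_at M X u v"
  "inner_at M X (- u) v = - inner_at M X u v"
  "inner_at M X u (- v) = - inner_at M X u v"
  by (simp_all add: inner_at_def Let_def inner_add_left inner_diff_left matrix_vector_right_distrib
      matrix_vector_mult_diff_distrib inner_add_right inner_diff_right matrix_vector_mult_scaleR)
     (simp add: matrix_vector_mult_def inner_vec_def sum_negf)

lemma bounded_linear_inner_at: "bounded_linear (inner_at M X u)"
  by (intro linear_conv_bounded_linear[THEN iffD1] linearI) (simp_all add: inner_at_linear)

lemma inner_at_pos: "X \<in> U \<Longrightarrow> v \<noteq> 0 \<Longrightarrow> 0 < inner_at M X v v"
  unfolding inner_at_def Let_def using metric_pos chart_at U_carrier by blast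

lemma norm_at_square: "X \<in> U \<Longrightarrow> (norm_at M X v)\<^sup>2 = inner_at M X v v"
  using inner_at_pos[of X v] unfolding norm_at_def by (cases "v = 0") (auto simp: inner_at_def Let_def)

lemma norm_at_nonneg: "X \<in> U \<Longrightarrow> 0 \<le> norm_at M X v"
  using inner_at_pos[of X v] unfolding norm_at_def by (cases "v = 0") (auto simp: inner_at_def Let_def)

lemma udir_unit:
  assumes "X \<in> U" "P \<in> U" "X \<noteq> P" shows "norm_at M X (udir X P) = 1" "inner_at M X (udir X P) (udir X P) = 1"
proof -
  show "norm_at M X (udir X P) = 1"
    using norm_at_tang[OF assms] ds_pos[OF assms] by (simp add: udir_def norm_at_scale)
  then show "inner_at M X (udir X P) (udir X P) = 1" using norm_at_square[OF assms(1)] by (metis one_power2)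
qed

lemma angle_udir:
  assumes "X \<in> U" "P \<in> U" "Q \<in> U" "X \<noteq> P" "X \<noteq> Q"
  shows "angle M U P X Q = arccos (inner_at M X (udir X P) (udir X Q))"
  unfolding angle_tang using norm_at_tang assms by (simp add: udir_def inner_at_linear mult.commute)

text \<open>Cauchy-Schwarz for unit vectors, from the nonnegative squares of their sum and
  difference.\<close>

lemma udir_inner_bound:
  assumes "X \<in> U" "P \<in> U" "Q \<in> U" "X \<noteq> P" "X \<noteq> Q"
  shows "\<bar>inner_at M X (udir X P) (udir X Q)\<bar> \<le> 1"
proof -
  let ?u = "udir X P" and ?v = "udir X Q"
  have "0 \<le> inner_at M X (?u + ?v) (?u + ?v)" "0 \<le> inner_at M X (?u - ?v) (?u - ?v)"
    using norm_at_square[OF assms(1)] by (metis zero_le_power2)+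
  then show ?thesis
    using udir_unit[OF assms(1,2,4)] udir_unit[OF assms(1,3,5)] inner_at_sym[OF assms(1), of ?u ?v]
    by (simp add: inner_at_linear)
qed

text \<open>One-sided derivative at \<^term>\<open>T\<close> of the distance to \<^term>\<open>Q\<close> in the direction \<^term>\<open>w\<close>, up to
  second order terms in \<^term>\<open>w\<close>.\<close>

definition variation :: "'a \<Rightarrow> 'a \<Rightarrow> real^2 \<Rightarrow> real" where
  "variation T Q w = (if Q = T then norm_at M T w else norm_at M T (udir T Q - w) - 1)"

text \<open>Expand the square of the norm and use \<open>2 * n \<le> 1 + n^2\<close>, the tangent
  bound for the square root at 1.\<close>

lemma variation_bound:
  assumes "T \<in> U" "Q \<in> U" "T \<noteq> Q"
  shows "variation T Q w \<le> - inner_at M T (udir T Q) w + (norm_at M T w)\<^sup>2 / 2"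
proof -
  let ?n = "norm_at M T (udir T Q - w)"
  have "?n\<^sup>2 = 1 - 2 * inner_at M T (udir T Q) w + (norm_at M T w)\<^sup>2"
    using udir_unit(2)[OF assms] inner_at_sym[OF assms(1), of w "udir T Q"]
    by (simp add: norm_at_square[OF assms(1)] inner_at_linear)
  moreover have "0 \<le> (?n - 1)\<^sup>2" by simp
  then have "2 * ?n \<le> 1 + ?n\<^sup>2" by (simp add: power2_diff)
  ultimately show ?thesis using assms by (simp add: variation_def)
qed

text \<open>The parameter \<open>r\<close> is arclength, so the derivative at 0 is the unit vector
  \<open>udir T Q\<close>; \<open>r1\<close> keeps the arm in the chart at \<open>T\<close>.\<close>

lemma arm_derivative:
  assumes "T \<in> U" "Q \<in> U" "T \<noteq> Q"
  defines "\<kappa> \<equiv> chart_at M T"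
  obtains r1 where "0 < r1" "r1 \<le> ds T Q" "\<And>r. r \<in> {0..r1} \<Longrightarrow> geod M U T Q (r / ds T Q) \<in> cdom \<kappa>"
    "((\<lambda>r. cmap \<kappa> (geod M U T Q (r / ds T Q))) has_vector_derivative udir T Q) (at 0 within {0..r1})"
    "continuous_on {0..r1} (\<lambda>r. cmap \<kappa> (geod M U T Q (r / ds T Q)))"
proof -
  note g = geod_param[OF assms(1-3)]
  let ?c = "geod M U T Q" and ?L = "ds T Q"
  have L: "0 < ?L" by (rule ds_pos[OF assms(1-3)])
  have k: "\<kappa> \<in> charts M" "T \<in> cdom \<kappa>" using chart_at[of T] assms U_carrier by (auto simp: \<kappa>_def)
  obtain v where v: "\<And>t. t \<in> {0..1} \<Longrightarrow> ?c t \<in> cdom \<kappa> \<Longrightarrow> ((cmap \<kappa> \<circ> ?c) has_vector_derivative v t) (at t within {0..1})"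
    using C1_deriv[OF geodesic_C1[OF g(1)] k(1)] by blast
  have d0: "((cmap \<kappa> \<circ> ?c) has_vector_derivative v 0) (at 0 within {0..1})" using v[of 0] g(3) k by simp
  have "tang T Q = v 0" unfolding tang_def
    by (rule velocity_chart_at) (use d0 g(3) in \<open>simp_all add: \<kappa>_def\<close>)
  have "\<forall>\<^sub>F s in at 0 within {0..1}. ?c s \<in> cdom \<kappa>"
    using geodesic_continuous[OF g(1)] g(3) k
    by (intro eventually_in_open[OF _ chart_open]) (auto simp: continuous_on_eq_continuous_within)
  then obtain d where d: "0 < d" "\<And>s. s \<in> {0..1} \<Longrightarrow> s \<noteq> 0 \<Longrightarrow> dist s 0 < d \<Longrightarrow> ?c s \<in> cdom \<kappa>"
    unfolding eventually_at by blast
  \<comment> \<open>Multiplication by \<open>?L\<close> turns the time bound \<open>d\<close> into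
    arclength; the half leaves room for strictness.\<close>
  define r1 where "r1 = min ?L (?L * d / 2)"
  have r1: "0 < r1" "r1 \<le> ?L" "r1 \<le> ?L * d / 2" using L d(1) by (auto simp: r1_def)
  have im: "(\<lambda>r. (1/?L) * r + 0) ` {0..r1} \<subseteq> {0..1}" using r1 L by auto
  have dom: "?c (r / ?L) \<in> cdom \<kappa>" if "r \<in> {0..r1}" for r
  proof (cases "r = 0")
    case False
    have "r / ?L \<le> d / 2" using that r1(3) L by (simp add: pos_divide_le_eq mult.commute)
    then have "r / ?L < d" using d(1) by linarith
    moreover have "0 \<le> r / ?L" "r / ?L \<le> 1" "r / ?L \<noteq> 0" using that r1 L False by auto
    ultimately show ?thesis by (intro d(2)) (simp_all add: dist_real_def)
  qed (use g(3) k in simp)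
  show thesis
  proof (rule that[OF r1(1,2)])
    fix r assume "r \<in> {0..r1}" then show "?c (r / ?L) \<in> cdom \<kappa>" by (rule dom)
  next
    have "((\<lambda>r. (cmap \<kappa> \<circ> ?c) ((1/?L) * r + 0)) has_vector_derivative (1/?L) *\<^sub>R v 0) (at 0 within {0..r1})"
      by (rule has_vd_affine[OF _ im]) (simp only: mult_zero_right add_0_left d0)
    then show "((\<lambda>r. cmap \<kappa> (?c (r / ?L))) has_vector_derivative udir T Q) (at 0 within {0..r1})"
      by (simp add: udir_def \<open>tang T Q = v 0\<close> o_def)
    have "continuous_on {0..r1} (\<lambda>r. ?c (r / ?L))"
      by (rule continuous_on_compose2[OF geodesic_continuous[OF g(1)]])
         (use im L in \<open>auto intro!: continuous_intros\<close>)
    then show "continuous_on {0..r1} (\<lambda>r. cmap \<kappa> (?c (r / ?L)))"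
      by (rule continuous_on_compose2[OF cmap_continuous[OF k(1)]]) (use dom in auto)
  qed
qed

text \<open>From \<open>x\<close>, near \<open>T\<close> displaced by
  \<open>\<epsilon> *\<^sub>R w\<close>, go straight to a target \<open>z \<epsilon>\<close>
  displaced by \<open>\<epsilon> *\<^sub>R u\<close> and then on to \<open>Q\<close>. The straight
  piece costs \<open>\<epsilon>\<close> times the norm at \<open>T\<close> of \<open>u - w\<close>,
  up to the error \<open>e\<close>. Leaving the target open covers both \<open>Q = T\<close> and
  \<open>Q \<noteq> T\<close>.\<close>

lemma first_variation_aux:
  fixes z :: "real \<Rightarrow> real^2"
  assumes T: "T \<in> U" and Q: "Q \<in> U" and e: "0 < e"
  defines "\<kappa> \<equiv> chart_at M T"
  assumes z: "\<And>e. 0 < e \<Longrightarrow> \<exists>d>0. \<forall>\<epsilon>. 0 < \<epsilon> \<longrightarrow> \<epsilon> < d \<longrightarrow> norm (z \<epsilon> - cmap \<kappa> T - \<epsilon> *\<^sub>R u) \<le> e * \<epsilon>"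
  obtains d where "0 < d" "\<And>\<epsilon> x. 0 < \<epsilon> \<Longrightarrow> \<epsilon> < d \<Longrightarrow> norm (x - cmap \<kappa> T - \<epsilon> *\<^sub>R w) \<le> d * \<epsilon> \<Longrightarrow>
      ds (cinv \<kappa> x) Q \<le> \<epsilon> * (norm_at M T (u - w) + e) + ds (cinv \<kappa> (z \<epsilon>)) Q"
proof -
  let ?p = "cmap \<kappa> T"
  let ?N = "chart_norm M \<kappa> ?p"
  have N: "norm_at M T v = ?N v" for v by (simp add: norm_at_chart_at \<kappa>_def)
  have k: "\<kappa> \<in> charts M" "T \<in> cdom \<kappa>" using chart_at[of T] T U_carrier by (auto simp: \<kappa>_def)
  \<comment> \<open>Bounds the rescaled displacement from \<open>x\<close> to
    \<open>z \<epsilon>\<close>, so that the error from freezing the metric is at most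
    \<open>e / 2\<close>; the other half of \<open>e\<close> goes to continuity of the norm.\<close>
  define B where "B = norm (u - w) + 1"
  have B: "0 < B" by (simp add: B_def add_nonneg_pos)
  have "0 < e / (2 * B)" using e B by simp
  then obtain \<rho> where \<rho>: "0 < \<rho>" "\<And>y z Q. y \<in> ball ?p \<rho> \<Longrightarrow> z \<in> ball ?p \<rho> \<Longrightarrow> Q \<in> U \<Longrightarrow>
       ds (cinv \<kappa> y) Q \<le> ?N (z - y) + e / (2 * B) * norm (z - y) + ds (cinv \<kappa> z) Q"
    using ds_chart_segment[OF k T] by metis
  have "continuous_on UNIV ?N"
    by (rule chart_norm_continuous[OF k(1)]) (use k in auto)
  then have "isCont ?N (u - w)" by (simp add: continuous_on_eq_continuous_at)
  then obtain d2 where d2: "0 < d2" "\<And>v. dist v (u - w) < d2 \<Longrightarrow> dist (?N v) (?N (u - w)) < e / 2"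
    using e unfolding continuous_at_eps_delta by (metis half_gt_zero)
  \<comment> \<open>Two errors of this size add up: \<open>2 * e2\<close> must stay below
    \<open>d2\<close> for continuity of the norm, and below 1 for the bound
    \<open>B\<close>.\<close>
  define e2 where "e2 = min (1/2) (d2 / 4)"
  have e2: "0 < e2" "e2 \<le> 1/2" "e2 \<le> d2/4" using d2(1) by (auto simp: e2_def)
  obtain d3 where d3: "0 < d3" "\<And>\<epsilon>. 0 < \<epsilon> \<Longrightarrow> \<epsilon> < d3 \<Longrightarrow> norm (z \<epsilon> - ?p - \<epsilon> *\<^sub>R u) \<le> e2 * \<epsilon>"
    using z[OF e2(1)] by blast
  \<comment> \<open>The last quotient keeps both \<open>x\<close> and \<open>z \<epsilon>\<close> in
    the ball of radius \<open>\<rho>\<close>.\<close>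
  define d where "d = min (min d3 e2) (\<rho> / (norm u + norm w + 1))"
  have den: "0 < norm u + norm w + 1" by (simp add: add_nonneg_pos)
  have "d \<le> \<rho> / (norm u + norm w + 1)" by (simp add: d_def)
  then have dr: "d * (norm u + norm w + 1) \<le> \<rho>" using den by (simp add: pos_le_divide_eq)
  have d: "0 < d" "d \<le> d3" "d \<le> e2" using d3(1) e2(1) \<rho>(1) den by (auto simp: d_def)
  show thesis
  proof (rule that[OF d(1)])
    fix \<epsilon> :: real and x assume \<epsilon>: "0 < \<epsilon>" "\<epsilon> < d" and x: "norm (x - ?p - \<epsilon> *\<^sub>R w) \<le> d * \<epsilon>"
    have zb: "norm (z \<epsilon> - ?p - \<epsilon> *\<^sub>R u) \<le> e2 * \<epsilon>" using d3(2) \<epsilon> d by simp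
    have small: "y \<in> ball ?p \<rho>" if y: "norm (y - ?p - \<epsilon> *\<^sub>R v) \<le> e2 * \<epsilon>" and v: "norm v \<le> norm u + norm w" for y v
    proof -
      have "norm (y - ?p) \<le> norm (y - ?p - \<epsilon> *\<^sub>R v) + norm (\<epsilon> *\<^sub>R v)"
        using norm_triangle_ineq[of "y - ?p - \<epsilon> *\<^sub>R v" "\<epsilon> *\<^sub>R v"] by simp
      also have "\<dots> \<le> e2 * \<epsilon> + \<epsilon> * norm v" using y \<epsilon> by simp
      also have "\<dots> = \<epsilon> * (norm v + e2)" by (simp add: algebra_simps)
      also have "\<dots> < d * (norm u + norm w + 1)"
        using \<epsilon> v e2 by (intro mult_strict_mono') auto
      finally show ?thesis using dr by (simp add: dist_norm norm_minus_commute)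
    qed
    have xe: "norm (x - ?p - \<epsilon> *\<^sub>R w) \<le> e2 * \<epsilon>"
      using x d(3) \<epsilon> by (meson mult_right_mono order_trans less_imp_le)
    have "ds (cinv \<kappa> x) Q \<le> ?N (z \<epsilon> - x) + e / (2 * B) * norm (z \<epsilon> - x) + ds (cinv \<kappa> (z \<epsilon>)) Q"
      by (rule \<rho>(2)[OF small[OF xe] small[OF zb] Q]) auto
    also have "?N (z \<epsilon> - x) + e / (2 * B) * norm (z \<epsilon> - x) \<le> \<epsilon> * (?N (u - w) + e)"
    proof -
      define v where "v = (1/\<epsilon>) *\<^sub>R (z \<epsilon> - x)"
      have zv: "z \<epsilon> - x = \<epsilon> *\<^sub>R v" using \<epsilon> by (simp add: v_def)
      have "\<epsilon> *\<^sub>R (v - (u - w)) = (z \<epsilon> - ?p - \<epsilon> *\<^sub>R u) - (x - ?p - \<epsilon> *\<^sub>R w)"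
        using zv by (simp add: algebra_simps)
      then have "norm (\<epsilon> *\<^sub>R (v - (u - w))) = norm ((z \<epsilon> - ?p - \<epsilon> *\<^sub>R u) - (x - ?p - \<epsilon> *\<^sub>R w))" by simp
      also have "\<dots> \<le> norm (z \<epsilon> - ?p - \<epsilon> *\<^sub>R u) + norm (x - ?p - \<epsilon> *\<^sub>R w)" by (rule norm_triangle_ineq4)
      also have "\<dots> \<le> e2 * \<epsilon> + e2 * \<epsilon>" by (intro add_mono zb xe)
      finally have "norm (\<epsilon> *\<^sub>R (v - (u - w))) \<le> e2 * \<epsilon> + e2 * \<epsilon>" .
      moreover have "norm (\<epsilon> *\<^sub>R (v - (u - w))) = \<epsilon> * norm (v - (u - w))"
        using \<epsilon> by (simp only: norm_scaleR abs_of_pos)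
      moreover have "e2 * \<epsilon> + e2 * \<epsilon> = \<epsilon> * (2 * e2)" by simp
      ultimately have "\<epsilon> * norm (v - (u - w)) \<le> \<epsilon> * (2 * e2)" by (simp only:)
      then have v1: "norm (v - (u - w)) \<le> 2 * e2" using \<epsilon> by simp
      then have "dist v (u - w) < d2" using e2 d2(1) by (simp add: dist_norm)
      from d2(2)[OF this] have "?N v \<le> ?N (u - w) + e / 2" unfolding dist_real_def by linarith
      moreover have "norm v \<le> B"
        using norm_triangle_ineq[of "v - (u - w)" "u - w"] v1 e2(2) by (simp add: B_def)
      then have "e / (2 * B) * norm v \<le> e / (2 * B) * B" using e B by (intro mult_left_mono) auto
      then have "e / (2 * B) * norm v \<le> e / 2" using B by simp
      ultimately have "?N v + e / (2 * B) * norm v \<le> ?N (u - w) + e" by linarith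
      then have "\<epsilon> * (?N v + e / (2 * B) * norm v) \<le> \<epsilon> * (?N (u - w) + e)"
        using \<epsilon> by (intro mult_left_mono) auto
      then show ?thesis unfolding zv chart_norm_scale using \<epsilon> by (simp add: algebra_simps)
    qed
    finally show "ds (cinv \<kappa> x) Q \<le> \<epsilon> * (norm_at M T (u - w) + e) + ds (cinv \<kappa> (z \<epsilon>)) Q"
      unfolding N by simp
  qed
qed

text \<open>The target is the point at arclength \<open>\<epsilon>\<close> on \<open>TQ\<close>,
  which is nearer to \<open>Q\<close> by exactly \<open>\<epsilon>\<close>: this is the
  \<open>- 1\<close> in \<open>variation\<close>. For \<open>Q = T\<close> the target stays at
  \<open>T\<close>.\<close>

lemma first_variation:
  assumes T: "T \<in> U" and Q: "Q \<in> U" and e: "0 < e"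
  defines "\<kappa> \<equiv> chart_at M T"
  obtains d where "0 < d" "\<And>\<epsilon> x. 0 < \<epsilon> \<Longrightarrow> \<epsilon> < d \<Longrightarrow> norm (x - cmap \<kappa> T - \<epsilon> *\<^sub>R w) \<le> d * \<epsilon> \<Longrightarrow>
      ds (cinv \<kappa> x) Q \<le> ds T Q + \<epsilon> * (variation T Q w + e)"
proof -
  have k: "\<kappa> \<in> charts M" "T \<in> cdom \<kappa>" using chart_at[of T] T U_carrier by (auto simp: \<kappa>_def)
  show thesis
  proof (cases "Q = T")
    case True
    have z: "\<exists>d>0. \<forall>\<epsilon>. 0 < \<epsilon> \<longrightarrow> \<epsilon> < d \<longrightarrow> norm (cmap \<kappa> T - cmap \<kappa> T - \<epsilon> *\<^sub>R 0) \<le> e' * \<epsilon>" if "0 < e'" for e' :: real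
      using that by (intro exI[of _ 1]) auto
    obtain d where d: "0 < d" "\<And>\<epsilon> x. 0 < \<epsilon> \<Longrightarrow> \<epsilon> < d \<Longrightarrow> norm (x - cmap \<kappa> T - \<epsilon> *\<^sub>R w) \<le> d * \<epsilon> \<Longrightarrow>
      ds (cinv \<kappa> x) Q \<le> \<epsilon> * (norm_at M T (0 - w) + e) + ds (cinv \<kappa> (cmap \<kappa> T)) Q"
      using first_variation_aux[OF T Q e, of "\<lambda>_. cmap \<kappa> T" 0 w] z unfolding \<kappa>_def by blast
    have "norm_at M T (0 - w) = norm_at M T w" using norm_at_scale[of T "-1" w] by simp
    then show thesis using that[OF d(1)] d(2) True cinv_cmap[OF k] by (simp add: variation_def)
  next
    case False
    then have TQ: "T \<noteq> Q" by simp
    note g = geod_param[OF T Q TQ]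
    let ?c = "geod M U T Q" and ?L = "ds T Q"
    have L: "0 < ?L" by (rule ds_pos[OF T Q TQ])
    obtain r1 where r1: "0 < r1" "r1 \<le> ?L" "\<And>r. r \<in> {0..r1} \<Longrightarrow> ?c (r / ?L) \<in> cdom \<kappa>"
      "((\<lambda>r. cmap \<kappa> (?c (r / ?L))) has_vector_derivative udir T Q) (at 0 within {0..r1})"
      using arm_derivative[OF T Q TQ] unfolding \<kappa>_def by blast
    let ?z = "\<lambda>\<epsilon>. cmap \<kappa> (?c (\<epsilon> / ?L))"
    have z: "\<exists>d>0. \<forall>\<epsilon>. 0 < \<epsilon> \<longrightarrow> \<epsilon> < d \<longrightarrow> norm (?z \<epsilon> - cmap \<kappa> T - \<epsilon> *\<^sub>R udir T Q) \<le> e' * \<epsilon>" if e': "0 < e'" for e'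
    proof -
      obtain d where "0 < d" "\<And>r. r \<in> {0..r1} \<Longrightarrow> r < d \<Longrightarrow> norm (?z r - ?z 0 - r *\<^sub>R udir T Q) \<le> e' * r"
        using has_vector_derivative_expansion[OF r1(4) e'] by blast
      then show ?thesis using g(3) r1(1) by (intro exI[of _ "min d r1"]) auto
    qed
    obtain d where d: "0 < d" "\<And>\<epsilon> x. 0 < \<epsilon> \<Longrightarrow> \<epsilon> < d \<Longrightarrow> norm (x - cmap \<kappa> T - \<epsilon> *\<^sub>R w) \<le> d * \<epsilon> \<Longrightarrow>
      ds (cinv \<kappa> x) Q \<le> \<epsilon> * (norm_at M T (udir T Q - w) + e) + ds (cinv \<kappa> (?z \<epsilon>)) Q"
      using first_variation_aux[OF T Q e, of ?z "udir T Q" w] z unfolding \<kappa>_def by blast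
    show thesis
    proof (rule that[of "min d r1"])
      fix \<epsilon> x assume \<epsilon>: "0 < \<epsilon>" "\<epsilon> < min d r1" and x: "norm (x - cmap \<kappa> T - \<epsilon> *\<^sub>R w) \<le> min d r1 * \<epsilon>"
      have x': "norm (x - cmap \<kappa> T - \<epsilon> *\<^sub>R w) \<le> d * \<epsilon>"
        using x \<epsilon> by (meson min.cobounded1 mult_right_mono order_trans less_imp_le)
      have s: "\<epsilon> / ?L \<in> {0..1}" "\<epsilon> / ?L < 1" using \<epsilon> r1(2) L by auto
      have "cinv \<kappa> (?z \<epsilon>) = ?c (\<epsilon> / ?L)" using cinv_cmap[OF k(1) r1(3)] \<epsilon> by simp
      moreover have "?c (\<epsilon> / ?L) \<noteq> ?c 1" using inj_onD[OF g(6), of "\<epsilon> / ?L" 1] s by auto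
      then have "ds (?c (\<epsilon> / ?L)) (?c 1) = \<bar>1 - \<epsilon> / ?L\<bar> * curve_length M ?c"
        by (intro ds_sub[OF g(1,2) s(1)]) auto
      then have "ds (?c (\<epsilon> / ?L)) Q = ?L - \<epsilon>" using s L g(4,7) by (simp add: field_simps)
      ultimately have "ds (cinv \<kappa> x) Q \<le> \<epsilon> * (norm_at M T (udir T Q - w) + e) + (?L - \<epsilon>)"
        using d(2)[OF \<epsilon>(1) _ x'] \<epsilon>(2) by simp
      then show "ds (cinv \<kappa> x) Q \<le> ?L + \<epsilon> * (variation T Q w + e)"
        using False by (simp add: variation_def algebra_simps)
    qed (use d(1) r1(1) in simp)
  qed
qed

text \<open>A sequence of points of \<open>D\<close> approaching \<open>T\<close> in direction
  \<open>w\<close> is enough; neither a curve nor a cone in \<open>D\<close> is asked for. One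
  \<open>\<delta>\<close> controls both the step and the relative error.\<close>

definition tangent_to :: "'a set \<Rightarrow> 'a \<Rightarrow> real^2 \<Rightarrow> bool" where
  "tangent_to D T w \<longleftrightarrow> (\<forall>\<delta>>0. \<exists>\<epsilon> Z. 0 < \<epsilon> \<and> \<epsilon> < \<delta> \<and> Z \<in> D \<and> Z \<in> cdom (chart_at M T) \<and>
      norm (cmap (chart_at M T) Z - cmap (chart_at M T) T - \<epsilon> *\<^sub>R w) \<le> \<delta> * \<epsilon>)"

lemma tangent_to_mono: "tangent_to D T w \<Longrightarrow> D \<subseteq> D' \<Longrightarrow> tangent_to D' T w"
  unfolding tangent_to_def by blast

lemma tangent_to_scale:
  assumes "tangent_to D T w" "0 < h"
  shows "tangent_to D T (h *\<^sub>R w)"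
  unfolding tangent_to_def
proof (intro allI impI)
  fix \<delta> :: real assume \<delta>: "0 < \<delta>"
  let ?\<kappa> = "chart_at M T"
  \<comment> \<open>The step shrinks to \<open>\<epsilon> / h\<close>: the first bound keeps it
    below \<open>\<delta>\<close>, the second adapts the relative error.\<close>
  define \<delta>' where "\<delta>' = min (h * \<delta>) (\<delta> / h)"
  have \<delta>': "0 < \<delta>'" "\<delta>' \<le> h * \<delta>" "\<delta>' \<le> \<delta> / h" using \<delta> assms(2) by (auto simp: \<delta>'_def)
  obtain \<epsilon> Z where Z: "0 < \<epsilon>" "\<epsilon> < \<delta>'" "Z \<in> D" "Z \<in> cdom ?\<kappa>" "norm (cmap ?\<kappa> Z - cmap ?\<kappa> T - \<epsilon> *\<^sub>R w) \<le> \<delta>' * \<epsilon>"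
    using assms(1) \<delta>'(1) unfolding tangent_to_def by blast
  show "\<exists>\<epsilon> Z. 0 < \<epsilon> \<and> \<epsilon> < \<delta> \<and> Z \<in> D \<and> Z \<in> cdom ?\<kappa> \<and> norm (cmap ?\<kappa> Z - cmap ?\<kappa> T - \<epsilon> *\<^sub>R (h *\<^sub>R w)) \<le> \<delta> * \<epsilon>"
  proof (intro exI[of _ "\<epsilon> / h"] exI[of _ Z] conjI)
    show "\<epsilon> / h < \<delta>" using Z(2) \<delta>'(2) assms(2) by (simp add: pos_divide_less_eq mult.commute)
    have "\<delta>' * \<epsilon> \<le> \<delta> / h * \<epsilon>" using \<delta>'(3) Z(1) by (intro mult_right_mono) auto
    then show "norm (cmap ?\<kappa> Z - cmap ?\<kappa> T - (\<epsilon> / h) *\<^sub>R (h *\<^sub>R w)) \<le> \<delta> * (\<epsilon> / h)"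
      using Z(5) assms(2) by simp
  qed (use Z assms(2) in auto)
qed

lemma minimum_variation:
  assumes U: "T \<in> U" "A \<in> U" "B \<in> U" "C \<in> U"
    and min: "\<And>Z. Z \<in> D \<Longrightarrow> ds T A + ds T B + ds T C \<le> ds Z A + ds Z B + ds Z C"
    and w: "tangent_to D T w"
  shows "0 \<le> variation T A w + variation T B w + variation T C w"
proof (rule ccontr)
  assume neg: "\<not> ?thesis"
  let ?\<kappa> = "chart_at M T"
  have k: "?\<kappa> \<in> charts M" using chart_at[of T] U U_carrier by auto
  \<comment> \<open>The negative sum is \<open>-6 * e\<close>; the three errors add
    \<open>3 * e\<close>, which leaves a strict decrease.\<close>
  define e where "e = - (variation T A w + variation T B w + variation T C w) / 6"
  have e: "0 < e" using neg by (simp add: e_def)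
  obtain a where a: "0 < a" "\<And>\<epsilon> x. 0 < \<epsilon> \<Longrightarrow> \<epsilon> < a \<Longrightarrow> norm (x - cmap ?\<kappa> T - \<epsilon> *\<^sub>R w) \<le> a * \<epsilon> \<Longrightarrow>
      ds (cinv ?\<kappa> x) A \<le> ds T A + \<epsilon> * (variation T A w + e)"
    using first_variation[OF U(1,2) e] by blast
  obtain b where b: "0 < b" "\<And>\<epsilon> x. 0 < \<epsilon> \<Longrightarrow> \<epsilon> < b \<Longrightarrow> norm (x - cmap ?\<kappa> T - \<epsilon> *\<^sub>R w) \<le> b * \<epsilon> \<Longrightarrow>
      ds (cinv ?\<kappa> x) B \<le> ds T B + \<epsilon> * (variation T B w + e)"
    using first_variation[OF U(1,3) e] by blast
  obtain c where c: "0 < c" "\<And>\<epsilon> x. 0 < \<epsilon> \<Longrightarrow> \<epsilon> < c \<Longrightarrow> norm (x - cmap ?\<kappa> T - \<epsilon> *\<^sub>R w) \<le> c * \<epsilon> \<Longrightarrow>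
      ds (cinv ?\<kappa> x) C \<le> ds T C + \<epsilon> * (variation T C w + e)"
    using first_variation[OF U(1,4) e] by blast
  define \<delta> where "\<delta> = min a (min b c)"
  have \<delta>: "0 < \<delta>" "\<delta> \<le> a" "\<delta> \<le> b" "\<delta> \<le> c" using a(1) b(1) c(1) by (auto simp: \<delta>_def)
  obtain \<epsilon> Z where Z: "0 < \<epsilon>" "\<epsilon> < \<delta>" "Z \<in> D" "Z \<in> cdom ?\<kappa>" "norm (cmap ?\<kappa> Z - cmap ?\<kappa> T - \<epsilon> *\<^sub>R w) \<le> \<delta> * \<epsilon>"
    using w \<delta>(1) unfolding tangent_to_def by blast
  have le: "norm (cmap ?\<kappa> Z - cmap ?\<kappa> T - \<epsilon> *\<^sub>R w) \<le> r * \<epsilon>" if "\<delta> \<le> r" for r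
    using Z(1,5) that by (meson mult_right_mono order_trans less_imp_le)
  have "ds Z A \<le> ds T A + \<epsilon> * (variation T A w + e)" "ds Z B \<le> ds T B + \<epsilon> * (variation T B w + e)"
    "ds Z C \<le> ds T C + \<epsilon> * (variation T C w + e)"
    using a(2)[OF Z(1) _ le[OF \<delta>(2)]] b(2)[OF Z(1) _ le[OF \<delta>(3)]] c(2)[OF Z(1) _ le[OF \<delta>(4)]]
      Z(2) \<delta> cinv_cmap[OF k Z(4)] by auto
  moreover have "\<epsilon> * (variation T A w + e) + \<epsilon> * (variation T B w + e) + \<epsilon> * (variation T C w + e) = \<epsilon> * (- 3 * e)"
  proof -
    have "variation T A w + variation T B w + variation T C w = - 6 * e" by (simp add: e_def)
    moreover have "\<epsilon> * (variation T A w + e) + \<epsilon> * (variation T B w + e) + \<epsilon> * (variation T C w + e) =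
        \<epsilon> * ((variation T A w + variation T B w + variation T C w) + 3 * e)" by (simp add: algebra_simps)
    ultimately show ?thesis by simp
  qed
  moreover have "\<epsilon> * (- 3 * e) < 0" using Z(1) e by (simp add: mult_pos_neg)
  ultimately show False using min[OF Z(3)] by linarith
qed

lemma tangent_to_open:
  assumes "open D" "T \<in> D" "T \<in> U"
  shows "tangent_to D T w"
  unfolding tangent_to_def
proof (intro allI impI)
  fix \<delta> :: real assume \<delta>: "0 < \<delta>"
  let ?\<kappa> = "chart_at M T"
  have k: "?\<kappa> \<in> charts M" "T \<in> cdom ?\<kappa>" using chart_at[of T] assms U_carrier by auto
  have "open (cmap ?\<kappa> ` (cdom ?\<kappa> \<inter> D))" "cmap ?\<kappa> T \<in> cmap ?\<kappa> ` (cdom ?\<kappa> \<inter> D)"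
    using chart_image_inter_open[OF k(1) assms(1)] k assms by auto
  then obtain \<rho> where \<rho>: "0 < \<rho>" "ball (cmap ?\<kappa> T) \<rho> \<subseteq> cmap ?\<kappa> ` (cdom ?\<kappa> \<inter> D)" using openE by blast
  define \<epsilon> where "\<epsilon> = min (\<delta>/2) (\<rho> / (norm w + 1))"
  have den: "0 < norm w + 1" by (simp add: add_nonneg_pos)
  have "\<epsilon> \<le> \<delta>/2" unfolding \<epsilon>_def by (rule min.cobounded1)
  then have \<epsilon>: "0 < \<epsilon>" "\<epsilon> < \<delta>" "\<epsilon> \<le> \<rho> / (norm w + 1)" using \<delta> \<rho>(1) den by (auto simp: \<epsilon>_def)
  have "\<epsilon> * norm w < \<epsilon> * (norm w + 1)" using \<epsilon> by simp
  also have "\<dots> \<le> \<rho>" using \<epsilon>(3) den by (simp add: pos_le_divide_eq)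
  finally have "cmap ?\<kappa> T + \<epsilon> *\<^sub>R w \<in> ball (cmap ?\<kappa> T) \<rho>" using \<epsilon> by (simp add: dist_norm)
  then obtain Z where Z: "Z \<in> cdom ?\<kappa>" "Z \<in> D" "cmap ?\<kappa> Z = cmap ?\<kappa> T + \<epsilon> *\<^sub>R w" using \<rho>(2) by force
  show "\<exists>\<epsilon> Z. 0 < \<epsilon> \<and> \<epsilon> < \<delta> \<and> Z \<in> D \<and> Z \<in> cdom ?\<kappa> \<and> norm (cmap ?\<kappa> Z - cmap ?\<kappa> T - \<epsilon> *\<^sub>R w) \<le> \<delta> * \<epsilon>"
    by (intro exI[of _ \<epsilon>] exI[of _ Z]) (use Z \<epsilon> \<delta> in auto)
qed

text \<open>The end points are removed because it is the open cevian that is known to lie inside the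
  triangle.\<close>

lemma tangent_to_geodesic:
  assumes "T \<in> U" "Q \<in> U" "T \<noteq> Q"
  shows "tangent_to (seg T Q - {T, Q}) T (udir T Q)"
  unfolding tangent_to_def
proof (intro allI impI)
  fix \<delta> :: real assume \<delta>: "0 < \<delta>"
  let ?\<kappa> = "chart_at M T" and ?c = "geod M U T Q" and ?L = "ds T Q"
  note g = geod_param[OF assms]
  have L: "0 < ?L" by (rule ds_pos[OF assms])
  obtain r1 where r1: "0 < r1" "r1 \<le> ?L" "\<And>r. r \<in> {0..r1} \<Longrightarrow> ?c (r / ?L) \<in> cdom ?\<kappa>"
    "((\<lambda>r. cmap ?\<kappa> (?c (r / ?L))) has_vector_derivative udir T Q) (at 0 within {0..r1})"
    using arm_derivative[OF assms] by blast
  obtain d where d: "0 < d" "\<And>r. r \<in> {0..r1} \<Longrightarrow> r < d \<Longrightarrow>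
      norm (cmap ?\<kappa> (?c (r / ?L)) - cmap ?\<kappa> (?c (0 / ?L)) - r *\<^sub>R udir T Q) \<le> \<delta> * r"
    using has_vector_derivative_expansion[OF r1(4) \<delta>] by blast
  define \<epsilon> where "\<epsilon> = min \<delta> (min d r1) / 2"
  have \<epsilon>: "0 < \<epsilon>" "\<epsilon> < \<delta>" "\<epsilon> < d" "\<epsilon> < r1" using \<delta> d(1) r1(1) by (auto simp: \<epsilon>_def min_def)
  have s: "\<epsilon> / ?L \<in> {0..1}" "\<epsilon> / ?L \<noteq> 0" "\<epsilon> / ?L \<noteq> 1" using \<epsilon> r1(2) L by auto
  have "?c (\<epsilon> / ?L) \<in> seg T Q - {T, Q}"
    using inj_onD[OF g(6) _ s(1), of 0] inj_onD[OF g(6) _ s(1), of 1] s g(3,4,5) by auto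
  moreover have "norm (cmap ?\<kappa> (?c (\<epsilon> / ?L)) - cmap ?\<kappa> T - \<epsilon> *\<^sub>R udir T Q) \<le> \<delta> * \<epsilon>"
    using d(2)[of \<epsilon>] \<epsilon> g(3) by simp
  ultimately show "\<exists>\<epsilon> Z. 0 < \<epsilon> \<and> \<epsilon> < \<delta> \<and> Z \<in> seg T Q - {T, Q} \<and> Z \<in> cdom ?\<kappa> \<and>
      norm (cmap ?\<kappa> Z - cmap ?\<kappa> T - \<epsilon> *\<^sub>R udir T Q) \<le> \<delta> * \<epsilon>"
    using \<epsilon> r1(3)[of \<epsilon>] by (intro exI[of _ \<epsilon>] exI[of _ "?c (\<epsilon> / ?L)"]) auto
qed

section \<open>Stationarity away from the vertices and at a vertex\<close>

lemma critical_point: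
  assumes U: "T \<in> U" "A \<in> U" "B \<in> U" "C \<in> U" and ne: "T \<noteq> A" "T \<noteq> B" "T \<noteq> C"
    and min: "\<And>Z. Z \<in> D \<Longrightarrow> ds T A + ds T B + ds T C \<le> ds Z A + ds Z B + ds Z C"
    and s: "tangent_to D T (udir T A + udir T B + udir T C)"
  shows "udir T A + udir T B + udir T C = 0"
proof (rule ccontr)
  let ?s = "udir T A + udir T B + udir T C"
  assume "?s \<noteq> 0"
  then have pos: "0 < inner_at M T ?s ?s" by (rule inner_at_pos[OF U(1)])
  \<comment> \<open>For \<open>w = h *\<^sub>R ?s\<close> the bound is
    \<open>-h + 3 * h^2 / 2\<close> times the square of \<open>?s\<close>; it is smallest at
    \<open>h = 1/3\<close>, with value \<open>-1/6\<close>.\<close>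
  let ?w = "(1/3) *\<^sub>R ?s"
  have "0 \<le> variation T A ?w + variation T B ?w + variation T C ?w"
    by (rule minimum_variation[OF U min tangent_to_scale[OF s]]) auto
  also have "\<dots> \<le> - inner_at M T ?s ?w + 3 * (norm_at M T ?w)\<^sup>2 / 2"
    using variation_bound[OF U(1,2) ne(1), of ?w] variation_bound[OF U(1,3) ne(2), of ?w]
      variation_bound[OF U(1,4) ne(3), of ?w] by (simp only: inner_at_linear(1))
  also have "\<dots> = - inner_at M T ?s ?s / 6"
    unfolding norm_at_square[OF U(1)] by (simp only: inner_at_linear(5,6))
  finally show False using pos by simp
qed

text \<open>Moving along the sum of the two unit vectors, of norm \<open>n\<close>, the distance to
  \<open>A\<close> grows at rate \<open>n\<close> and the other two together shrink at rate
  \<open>n^2\<close>. Minimality thus forces \<open>n \<le> 1\<close>, and \<open>n^2\<close> is 2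
  plus twice the inner product.\<close>

lemma critical_vertex:
  assumes U: "A \<in> U" "B \<in> U" "C \<in> U" and ne: "A \<noteq> B" "A \<noteq> C"
    and min: "\<And>Z. Z \<in> D \<Longrightarrow> ds A A + ds A B + ds A C \<le> ds Z A + ds Z B + ds Z C"
    and s: "tangent_to D A (udir A B + udir A C)"
  shows "inner_at M A (udir A B) (udir A C) \<le> - 1/2"
proof (rule ccontr)
  let ?s = "udir A B + udir A C"
  let ?n = "norm_at M A ?s"
  assume "\<not> ?thesis"
  moreover have n2: "?n\<^sup>2 = 2 + 2 * inner_at M A (udir A B) (udir A C)"
    using udir_unit(2)[OF U(1,2) ne(1)] udir_unit(2)[OF U(1,3) ne(2)] inner_at_sym[OF U(1), of "udir A C" "udir A B"]
    by (simp add: norm_at_square[OF U(1)] inner_at_linear)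
  ultimately have "1 < ?n\<^sup>2" by simp
  then have n: "1 < ?n" using norm_at_nonneg[OF U(1), of ?s] by (metis abs_of_nonneg one_power2 power2_less_imp_less power_one abs_square_less_1 linorder_not_less abs_le_square_iff)
  \<comment> \<open>With this step the factor \<open>1 - ?n + h * ?n\<close> becomes
    \<open>- (?n - 1) / 2\<close>, which is negative.\<close>
  define h where "h = (?n - 1) / (2 * ?n)"
  have h: "0 < h" "2 * h * ?n = ?n - 1" using n by (auto simp: h_def)
  let ?w = "h *\<^sub>R ?s"
  have "0 \<le> variation A A ?w + variation A B ?w + variation A C ?w"
    by (rule minimum_variation[OF U(1) U min tangent_to_scale[OF s h(1)]])
  moreover have "variation A A ?w = h * ?n" using h(1) by (simp add: variation_def norm_at_scale)
  moreover have "variation A B ?w + variation A C ?w \<le> - inner_at M A ?s ?w + (norm_at M A ?w)\<^sup>2"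
    using variation_bound[OF U(1,2) ne(1), of ?w] variation_bound[OF U(1,3) ne(2), of ?w]
    by (simp only: inner_at_linear(1))
  moreover have "- inner_at M A ?s ?w + (norm_at M A ?w)\<^sup>2 = - (h * ?n\<^sup>2) + h\<^sup>2 * ?n\<^sup>2"
    unfolding norm_at_square[OF U(1)] by (simp only: inner_at_linear(5,6) power2_eq_square mult.assoc)
  ultimately have "0 \<le> h * ?n + (- (h * ?n\<^sup>2) + h\<^sup>2 * ?n\<^sup>2)" by linarith
  also have "\<dots> = h * ?n * (1 - ?n + h * ?n)" by (simp add: algebra_simps power2_eq_square)
  finally have "0 \<le> h * ?n * (1 - ?n + h * ?n)" .
  moreover have "1 - ?n + h * ?n < 0" using h(2) n by linarith
  moreover have "0 < h * ?n" using h(1) n by simp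
  ultimately show False using mult_pos_neg[of "h * ?n" "1 - ?n + h * ?n"] by linarith
qed

end


section \<open>The triangle near a vertex\<close>

context geodesic_disk
begin

lemma vertex_arm:
  assumes A: "A \<in> U" "Q \<in> U" "A \<noteq> Q" and l: "bounded_linear l" "0 < l (udir A Q)" and e: "0 < e"
  defines "\<kappa> \<equiv> chart_at M A"
  defines "q \<equiv> (\<lambda>r. cmap \<kappa> (geod M U A Q (r / ds A Q)))"
  obtains r0 where "0 < r0" "r0 \<le> ds A Q" "\<And>r. r \<in> {0..r0} \<Longrightarrow> geod M U A Q (r / ds A Q) \<in> cdom \<kappa>"
    "continuous_on {0..r0} q"
    "\<And>\<epsilon>. 0 < \<epsilon> \<Longrightarrow> \<epsilon> \<le> r0 / 2 \<Longrightarrow> \<exists>r\<in>{0..r0}. l (q r - cmap \<kappa> A) = \<epsilon> * l (udir A Q)"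
    "\<And>\<epsilon> r. 0 < \<epsilon> \<Longrightarrow> r \<in> {0..r0} \<Longrightarrow> l (q r - cmap \<kappa> A) = \<epsilon> * l (udir A Q) \<Longrightarrow>
       norm (q r - cmap \<kappa> A - \<epsilon> *\<^sub>R udir A Q) \<le> e * \<epsilon>"
proof -
  obtain r1 where r1: "0 < r1" "r1 \<le> ds A Q" "\<And>r. r \<in> {0..r1} \<Longrightarrow> geod M U A Q (r / ds A Q) \<in> cdom \<kappa>"
    "(q has_vector_derivative udir A Q) (at 0 within {0..r1})" "continuous_on {0..r1} q"
    using arm_derivative[OF A] unfolding \<kappa>_def q_def by blast
  have q0: "q 0 = cmap \<kappa> A" using geod_0[OF A] by (simp add: q_def)
  obtain r0 where r0: "0 < r0" "r0 \<le> r1"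
    "\<And>\<epsilon>. 0 < \<epsilon> \<Longrightarrow> \<epsilon> \<le> r0 / 2 \<Longrightarrow> \<exists>r\<in>{0..r0}. l (q r - q 0) = \<epsilon> * l (udir A Q)"
    "\<And>\<epsilon> r. 0 < \<epsilon> \<Longrightarrow> r \<in> {0..r0} \<Longrightarrow> l (q r - q 0) = \<epsilon> * l (udir A Q) \<Longrightarrow> norm (q r - q 0 - \<epsilon> *\<^sub>R udir A Q) \<le> e * \<epsilon>"
    using arm_level[OF r1(4,5,1) l e] by blast
  show thesis
    by (rule that[of r0]) (use r0 r1 q0 in \<open>auto intro: continuous_on_subset\<close>)
qed

end

lemma closest_pair:
  fixes S T :: "'b::metric_space set"
  assumes "compact S" "compact T" "S \<noteq> {}" "T \<noteq> {}"
  obtains x y where "x \<in> S" "y \<in> T" "\<And>x' y'. x' \<in> S \<Longrightarrow> y' \<in> T \<Longrightarrow> dist x y \<le> dist x' y'"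
proof -
  have "continuous_on (S \<times> T) (\<lambda>p. dist (fst p) (snd p))" by (intro continuous_intros)
  then obtain p where p: "p \<in> S \<times> T" "\<forall>p'\<in>S \<times> T. dist (fst p) (snd p) \<le> dist (fst p') (snd p')"
    using continuous_attains_inf[of "S \<times> T" "\<lambda>p. dist (fst p) (snd p)"] compact_Times[OF assms(1,2)] assms(3,4)
    by blast
  show thesis by (rule that[of "fst p" "snd p"]) (use p in auto)
qed

context geodesic_disk_coords
begin

definition boundary :: "'a \<Rightarrow> 'a \<Rightarrow> 'a \<Rightarrow> 'a set" where
  "boundary A B C = seg A B \<union> seg B C \<union> seg C A"

lemma boundary_rotate: "boundary B C A = boundary A B C"
  by (auto simp: boundary_def)

lemma boundary_U: "proper_triangle A B C \<Longrightarrow> boundary A B C \<subseteq> U"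
  using seg_U by (auto simp: boundary_def proper_triangle_def)

lemma boundary_compact:
  assumes "proper_triangle A B C" shows "compact (boundary A B C)"
  unfolding boundary_def using assms arc_between_endless(1)[OF arc_seg]
  by (intro compact_Un) (auto simp: proper_triangle_def)

text \<open>A chord cutting off the vertex \<^term>\<open>A\<close> along a level line of \<^term>\<open>l\<close>, between the closest points of
  the two sides on this line.  The alternatives in the theta curve lemma are excluded by extending
  \<open>BA\<close> beyond \<^term>\<open>A\<close>, which leaves into the half plane where \<^term>\<open>l\<close> is negative, and
  \<open>AB\<close> beyond \<^term>\<open>B\<close>.\<close>

lemma vertex_tangent:
  assumes tri: "proper_triangle A B C"
  shows "tangent_to (ins (boundary A B C)) A (udir A B + udir A C)"
  unfolding tangent_to_def
proof (intro allI impI)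
  fix \<delta> :: real assume \<delta>: "0 < \<delta>"
  have U: "A \<in> U" "B \<in> U" "C \<in> U" and ne: "A \<noteq> B" "B \<noteq> C" "C \<noteq> A" "A \<noteq> C"
    using tri by (auto simp: proper_triangle_def)
  define \<kappa> where "\<kappa> = chart_at M A"
  have k: "\<kappa> \<in> charts M" "A \<in> cdom \<kappa>" using chart_at[of A] U U_carrier by (auto simp: \<kappa>_def)
  define x0 where "x0 = cmap \<kappa> A"
  let ?u = "udir A B" and ?v = "udir A C"
  \<comment> \<open>The level lines of \<open>l\<close> are perpendicular to the bisector. Since
    both directions are unit vectors, \<open>l\<close> has the same value \<open>c\<close> on them,
    so both arms reach the level \<open>\<epsilon> * c\<close> near step \<open>\<epsilon>\<close>;
    \<open>c\<close> is positive because the angle is not pi.\<close>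
  define l where "l = inner_at M A (?u + ?v)"
  have bl: "bounded_linear l" unfolding l_def by (rule bounded_linear_inner_at)
  interpret l: bounded_linear l by (rule bl)
  define c where "c = 1 + inner_at M A ?u ?v"
  have lu: "l ?u = c" and lv: "l ?v = c"
    using udir_unit(2)[OF U(1,2) ne(1)] udir_unit(2)[OF U(1,3) ne(4)] inner_at_sym[OF U(1), of ?u ?v]
    by (auto simp: l_def c_def inner_at_linear)
  have c: "0 < c"
  proof -
    have "angle M U C A B = arccos (inner_at M A ?u ?v)"
      using angle_udir[OF U(1,3,2) ne(4,1)] inner_at_sym[OF U(1), of ?u ?v] by simp
    then have "inner_at M A ?u ?v \<noteq> -1" using tri by (auto simp: proper_triangle_def)
    then show ?thesis using udir_inner_bound[OF U(1,2,3) ne(1,4)] by (auto simp: c_def abs_le_iff)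
  qed
  \<comment> \<open>The midpoint of the chord averages two errors \<open>e * \<epsilon>\<close> and
    corresponds to the step \<open>\<epsilon>/2\<close>, so \<open>\<delta> / 2\<close> is the right
    accuracy.\<close>
  define e where "e = \<delta> / 2"
  have e: "0 < e" using \<delta> by (simp add: e_def)
  let ?g = "geod M U A B" and ?h = "geod M U A C" and ?LB = "ds A B" and ?LC = "ds A C"
  note g = geod_param[OF U(1,2) ne(1)] and h = geod_param[OF U(1,3) ne(4)]
  have L: "0 < ?LB" "0 < ?LC" using ds_pos U ne by auto
  define q where "q = (\<lambda>r. cmap \<kappa> (?g (r / ?LB)))"
  define p where "p = (\<lambda>r. cmap \<kappa> (?h (r / ?LC)))"
  obtain rB where rB: "0 < rB" "rB \<le> ?LB" "\<And>r. r \<in> {0..rB} \<Longrightarrow> ?g (r / ?LB) \<in> cdom \<kappa>" "continuous_on {0..rB} q"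
    "\<And>\<epsilon>. 0 < \<epsilon> \<Longrightarrow> \<epsilon> \<le> rB / 2 \<Longrightarrow> \<exists>r\<in>{0..rB}. l (q r - x0) = \<epsilon> * c"
    "\<And>\<epsilon> r. 0 < \<epsilon> \<Longrightarrow> r \<in> {0..rB} \<Longrightarrow> l (q r - x0) = \<epsilon> * c \<Longrightarrow> norm (q r - x0 - \<epsilon> *\<^sub>R ?u) \<le> e * \<epsilon>"
    using vertex_arm[OF U(1,2) ne(1) bl _ e] c unfolding lu \<kappa>_def[symmetric] x0_def[symmetric] q_def by metis
  obtain rC where rC: "0 < rC" "rC \<le> ?LC" "\<And>r. r \<in> {0..rC} \<Longrightarrow> ?h (r / ?LC) \<in> cdom \<kappa>" "continuous_on {0..rC} p"
    "\<And>\<epsilon>. 0 < \<epsilon> \<Longrightarrow> \<epsilon> \<le> rC / 2 \<Longrightarrow> \<exists>r\<in>{0..rC}. l (p r - x0) = \<epsilon> * c"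
    "\<And>\<epsilon> r. 0 < \<epsilon> \<Longrightarrow> r \<in> {0..rC} \<Longrightarrow> l (p r - x0) = \<epsilon> * c \<Longrightarrow> norm (p r - x0 - \<epsilon> *\<^sub>R ?v) \<le> e * \<epsilon>"
    using vertex_arm[OF U(1,3) ne(4) bl _ e] c unfolding lv \<kappa>_def[symmetric] x0_def[symmetric] p_def by metis
  \<comment> \<open>All of the boundary except the two short arms at \<open>A\<close>: compact and
    at a positive distance from \<open>A\<close>, so a small chord avoids it.\<close>
  define Rest where "Rest = ?g ` {rB / ?LB..1} \<union> ?h ` {rC / ?LC..1} \<union> seg B C"
  have sub01: "{rB / ?LB..1} \<subseteq> {0..1}" "{rC / ?LC..1} \<subseteq> {0..1}" using rB(1) rC(1) L by auto
  have "compact Rest" unfolding Rest_def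
    using arc_between_endless(1)[OF arc_seg[OF U(2,3) ne(2)]] sub01
    by (intro compact_Un compact_continuous_image continuous_on_subset[OF geodesic_continuous[OF g(1)]]
        continuous_on_subset[OF geodesic_continuous[OF h(1)]]) auto
  then have clR: "closed Rest" by (rule compact_imp_closed)
  have AR: "A \<notin> Rest"
  proof -
    have "A \<notin> ?g ` {rB / ?LB..1}"
    proof
      assume "A \<in> ?g ` {rB / ?LB..1}"
      then obtain s where s: "s \<in> {rB / ?LB..1}" "?g s = ?g 0" using g(3) by auto
      have "0 < rB / ?LB" using rB(1) L by simp
      then show False using inj_onD[OF g(6) s(2)] s(1) by auto
    qed
    moreover have "A \<notin> ?h ` {rC / ?LC..1}"
    proof
      assume "A \<in> ?h ` {rC / ?LC..1}"
      then obtain s where s: "s \<in> {rC / ?LC..1}" "?h s = ?h 0" using h(3) by auto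
      have "0 < rC / ?LC" using rC(1) L by simp
      then show False using inj_onD[OF h(6) s(2)] s(1) by auto
    qed
    ultimately show ?thesis using proper_not_in_side[OF tri] by (auto simp: Rest_def)
  qed
  have BR: "B \<in> Rest" "C \<in> Rest" using end_in_seg[OF U(2,3)] by (auto simp: Rest_def)
  obtain \<eta> where \<eta>: "geodesic_on M {0..} \<eta>" "\<And>t. t \<in> {0..1} \<Longrightarrow> \<eta> t = geod M U B A t"
    using extension[OF U(2,1)] ne by metis
  \<comment> \<open>At time 1 the function \<open>l\<close> decreases along the extension of
    \<open>BA\<close> with derivative \<open>- (?LB * c)\<close>, so it is negative shortly
    afterwards.\<close>
  obtain \<tau> where \<tau>: "0 < \<tau>" "\<And>t. 1 < t \<Longrightarrow> t < 1 + \<tau> \<Longrightarrow> l (cmap \<kappa> (\<eta> t) - x0) < 0"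
  proof -
    note gr = geod_param[OF U(2,1)] 
    have \<eta>1: "\<eta> 1 = A" using \<eta>(2)[of 1] geod_1[OF U(2,1)] ne by auto
    obtain w where w: "\<And>t. t \<in> {0..} \<Longrightarrow> \<eta> t \<in> cdom \<kappa> \<Longrightarrow> ((cmap \<kappa> \<circ> \<eta>) has_vector_derivative w t) (at t within {0..})"
      using C1_deriv[OF geodesic_C1[OF \<eta>(1)] k(1)] by blast
    have d1: "((cmap \<kappa> \<circ> \<eta>) has_vector_derivative w 1) (at 1 within {0..})" using w[of 1] \<eta>1 k by simp
    have "((cmap \<kappa> \<circ> \<eta>) has_vector_derivative w 1) (at 1 within {0..1})"
      by (rule has_vector_derivative_within_subset[OF d1]) auto
    then have d2: "((cmap \<kappa> \<circ> geod M U B A) has_vector_derivative w 1) (at 1 within {0..1})"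
      by (rule has_vector_derivative_transform[rotated -1]) (use \<eta>(2) in auto)
    have "velocity M (geod M U B A) 1 = w 1"
      by (rule velocity_chart_at) (use d2 \<eta>(2)[of 1] \<eta>1 in \<open>simp_all add: \<kappa>_def\<close>)
    moreover have "tang A B = (-1) *\<^sub>R velocity M (geod M U B A) 1" unfolding tang_def
      by (rule velocity_affine) (use geodesic_C1[OF gr(1)] geod_rev[OF U(2,1)] ne in auto)
    ultimately have w1: "w 1 = - (?LB *\<^sub>R ?u)" using L by (simp add: udir_def)
    have "((\<lambda>t. (cmap \<kappa> \<circ> \<eta>) t - x0) has_vector_derivative w 1 - 0) (at 1 within {0..})"
      by (intro has_vector_derivative_diff d1 has_vector_derivative_const)
    then have "((\<lambda>t. l ((cmap \<kappa> \<circ> \<eta>) t - x0)) has_vector_derivative l (w 1)) (at 1 within {0..})"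
      using bounded_linear.has_vector_derivative[OF bl] by fastforce
    then have "((\<lambda>t. l ((cmap \<kappa> \<circ> \<eta>) t - x0)) has_real_derivative - (?LB * c)) (at 1 within {0..})"
      by (simp add: has_real_derivative_iff_has_vector_derivative w1 l.neg l.scaleR lu)
    moreover have "- (?LB * c) < 0" using L c by simp
    ultimately obtain d where d: "0 < d" "\<And>h. 0 < h \<Longrightarrow> 1 + h \<in> {0..} \<Longrightarrow> h < d \<Longrightarrow>
        l ((cmap \<kappa> \<circ> \<eta>) (1 + h) - x0) < l ((cmap \<kappa> \<circ> \<eta>) 1 - x0)"
      using has_real_derivative_neg_dec_right by blast
    show thesis
    proof (rule that[OF d(1)])
      fix t assume t: "1 < t" "t < 1 + d"
      show "l (cmap \<kappa> (\<eta> t) - x0) < 0"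
        using d(2)[of "t - 1"] t \<eta>1 by (simp add: x0_def l.zero)
    qed
  qed
  \<comment> \<open>In this neighbourhood of \<open>A\<close> three things hold: the bound with
    \<open>\<tau>\<close> makes any overshoot beyond \<open>A\<close> that ends here short enough
    for \<open>l < 0\<close>; the bound \<open>ds A B\<close> prevents \<open>B\<close> from lying
    between \<open>A\<close> and a point here; the rest of the boundary is missed.\<close>
  define W where "W = {Z \<in> U. ds Z A < min (\<tau> * ds B A) (ds A B)} \<inter> - Rest"
  have LBA: "ds B A = ?LB" using ds_sym U by simp
  have oW: "open W"
  proof -
    have "open (U \<inter> (\<lambda>Z. ds Z A) -` {..<min (\<tau> * ds B A) (ds A B)})"
      by (rule continuous_open_preimage[OF ds_continuous[OF U(1)] U_open]) simp
    moreover have "W = U \<inter> (\<lambda>Z. ds Z A) -` {..<min (\<tau> * ds B A) (ds A B)} \<inter> - Rest" by (auto simp: W_def)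
    ultimately show ?thesis using clR by (simp add: open_Int open_Compl)
  qed
  have AW: "A \<in> W" using U AR L \<tau>(1) LBA by (auto simp: W_def)
  have "x0 \<in> cmap \<kappa> ` (cdom \<kappa> \<inter> W)" using AW k by (auto simp: x0_def)
  then obtain \<rho> where \<rho>: "0 < \<rho>" "ball x0 \<rho> \<subseteq> cmap \<kappa> ` (cdom \<kappa> \<inter> W)"
    using openE[OF chart_image_inter_open[OF k(1) oW]] by blast
  have ballW: "cinv \<kappa> z \<in> W" "cinv \<kappa> z \<in> cdom \<kappa>" "cmap \<kappa> (cinv \<kappa> z) = z" if "z \<in> ball x0 \<rho>" for z
  proof -
    have "z \<in> cmap \<kappa> ` (cdom \<kappa> \<inter> W)" using \<rho>(2) that by blast
    then obtain X where "X \<in> cdom \<kappa>" "X \<in> W" "z = cmap \<kappa> X" by blast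
    then show "cinv \<kappa> z \<in> W" "cinv \<kappa> z \<in> cdom \<kappa>" "cmap \<kappa> (cinv \<kappa> z) = z" using cinv_cmap[OF k(1)] by auto
  qed
  define m where "m = norm ?u + norm ?v + e + 1"
  have m: "0 < m" using e by (simp add: m_def add_nonneg_pos)
  \<comment> \<open>\<open>rB/2\<close> and \<open>rC/2\<close> let the level be attained on both
    arms, the third entry keeps the chord in the ball around \<open>x0\<close>, and
    \<open>\<delta>\<close> bounds the step.\<close>
  define \<epsilon> where "\<epsilon> = Min {rB/2, rC/2, \<rho> / (2 * m), \<delta>}"
  have \<epsilon>: "0 < \<epsilon>" "\<epsilon> \<le> rB/2" "\<epsilon> \<le> rC/2" "\<epsilon> \<le> \<delta>" "\<epsilon> * m < \<rho>"
  proof -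
    show "0 < \<epsilon>" using rB(1) rC(1) \<rho>(1) m \<delta> by (simp add: \<epsilon>_def)
    show "\<epsilon> \<le> rB/2" "\<epsilon> \<le> rC/2" "\<epsilon> \<le> \<delta>" unfolding \<epsilon>_def by (rule Min_le; simp)+
    have "\<epsilon> \<le> \<rho> / (2 * m)" unfolding \<epsilon>_def by (rule Min_le; simp)
    then have "\<epsilon> * m \<le> \<rho> / 2" using m by (simp add: field_simps)
    then show "\<epsilon> * m < \<rho>" using \<rho>(1) by linarith
  qed
  \<comment> \<open>An arm may meet the level line many times: \<open>PA\<close> collects these
    points on \<open>AB\<close>, \<open>PB\<close> those on \<open>AC\<close>. Joining a closest
    pair makes the open chord miss the boundary, since a boundary point on it would belong to an arm
    and give a closer pair.\<close>
  define PA where "PA = q ` ({0..rB} \<inter> (\<lambda>r. l (q r - x0)) -` {\<epsilon> * c})"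
  define PB where "PB = p ` ({0..rC} \<inter> (\<lambda>r. l (p r - x0)) -` {\<epsilon> * c})"
  have cpt: "compact (f ` ({0..r} \<inter> (\<lambda>r. l (f r - x0)) -` {\<epsilon> * c}))" if f: "continuous_on {0..r} f" for f and r :: real
  proof -
    have "continuous_on {0..r} (\<lambda>r. l (f r - x0))" using f by (intro l.continuous_on continuous_intros)
    then have "closed ({0..r} \<inter> (\<lambda>r. l (f r - x0)) -` {\<epsilon> * c})"
      by (intro continuous_closed_preimage) auto
    then have "compact ({0..r} \<inter> (\<lambda>r. l (f r - x0)) -` {\<epsilon> * c})"
      using compact_Int_closed[of "{0..r}"] by (metis compact_Icc inf_left_idem)
    then show ?thesis using f by (intro compact_continuous_image) (auto intro: continuous_on_subset)
  qed
  have "PA \<noteq> {}" "PB \<noteq> {}" using rB(5)[OF \<epsilon>(1,2)] rC(5)[OF \<epsilon>(1,3)] by (auto simp: PA_def PB_def)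
  then obtain X Y where XY: "X \<in> PA" "Y \<in> PB" "\<And>x y. x \<in> PA \<Longrightarrow> y \<in> PB \<Longrightarrow> dist X Y \<le> dist x y"
    using closest_pair[of PA PB] cpt rB(4) rC(4) unfolding PA_def PB_def by metis
  obtain a where a: "a \<in> {0..rB}" "X = q a" "l (X - x0) = \<epsilon> * c" using XY(1) by (auto simp: PA_def)
  obtain b where b: "b \<in> {0..rC}" "Y = p b" "l (Y - x0) = \<epsilon> * c" using XY(2) by (auto simp: PB_def)
  have Xn: "norm (X - x0 - \<epsilon> *\<^sub>R ?u) \<le> e * \<epsilon>" using rB(6)[OF \<epsilon>(1) a(1)] a(2,3) by simp
  have Yn: "norm (Y - x0 - \<epsilon> *\<^sub>R ?v) \<le> e * \<epsilon>" using rC(6)[OF \<epsilon>(1) b(1)] b(2,3) by simp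
  have near: "z \<in> ball x0 \<rho>" if "norm (z - x0 - \<epsilon> *\<^sub>R w) \<le> e * \<epsilon>" "norm w \<le> norm ?u + norm ?v" for z w
  proof -
    have "norm (z - x0) \<le> norm (z - x0 - \<epsilon> *\<^sub>R w) + norm (\<epsilon> *\<^sub>R w)"
      using norm_triangle_ineq[of "z - x0 - \<epsilon> *\<^sub>R w" "\<epsilon> *\<^sub>R w"] by simp
    also have "\<dots> \<le> e * \<epsilon> + \<epsilon> * norm w" using that(1) \<epsilon>(1) by simp
    also have "\<dots> = \<epsilon> * (e + norm w)" by (simp add: algebra_simps)
    also have "\<dots> \<le> \<epsilon> * m" using that(2) \<epsilon>(1) by (intro mult_left_mono) (auto simp: m_def)
    finally show ?thesis using \<epsilon>(5) by (simp add: dist_norm norm_minus_commute)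
  qed
  have XYb: "X \<in> ball x0 \<rho>" "Y \<in> ball x0 \<rho>" using near[OF Xn] near[OF Yn] by auto
  have chb: "closed_segment X Y \<subseteq> ball x0 \<rho>" using XYb convex_ball by (simp add: closed_segment_subset)
  define Xp where "Xp = cinv \<kappa> X"
  define Yp where "Yp = cinv \<kappa> Y"
  define ch where "ch = cinv \<kappa> ` closed_segment X Y"
  have XYp: "Xp = ?g (a / ?LB)" "Yp = ?h (b / ?LC)"
    using a(1,2) b(1,2) rB(3) rC(3) cinv_cmap[OF k(1)] by (auto simp: Xp_def Yp_def q_def p_def)
  have ab: "a / ?LB \<in> {0..1}" "b / ?LC \<in> {0..1}" using a(1) b(1) rB(2) rC(2) L by auto
  have Xs: "Xp \<in> seg A B" "Yp \<in> seg A C" using XYp ab g(5) h(5) by auto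
  have XYU: "Xp \<in> U" "Yp \<in> U" using Xs seg_U U by blast+
  have XYW: "Xp \<in> W" "Yp \<in> W" using ballW(1) XYb by (auto simp: Xp_def Yp_def)
  have notR: "Z \<notin> Rest" "Z \<in> U" "ds Z A < \<tau> * ds B A" "ds Z A < ds A B" if "Z \<in> ch" for Z
  proof -
    have "Z \<in> W" using that ballW(1) chb by (auto simp: ch_def)
    then show "Z \<notin> Rest" "Z \<in> U" "ds Z A < \<tau> * ds B A" "ds Z A < ds A B" by (auto simp: W_def)
  qed
  have level: "l (z - x0) = \<epsilon> * c" if z: "z \<in> closed_segment X Y" for z
  proof -
    obtain t where t: "z = (1 - t) *\<^sub>R X + t *\<^sub>R Y" using z by (auto simp: in_segment)
    have "z - x0 = (1 - t) *\<^sub>R (X - x0) + t *\<^sub>R (Y - x0)" unfolding t by (simp add: algebra_simps)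
    then have "l (z - x0) = (1 - t) * (\<epsilon> * c) + t * (\<epsilon> * c)" using a(3) b(3) by (simp add: l.add l.scaleR)
    then show ?thesis by (simp add: algebra_simps)
  qed
  have pos: "0 < \<epsilon> * c" using \<epsilon>(1) c by simp
  have chlevel: "l (cmap \<kappa> Z - x0) = \<epsilon> * c" if Z: "Z \<in> ch" for Z
  proof -
    obtain z where z: "z \<in> closed_segment X Y" "Z = cinv \<kappa> z" using Z by (auto simp: ch_def)
    moreover have "z \<in> ball x0 \<rho>" using z(1) chb by blast
    ultimately show ?thesis using level[OF z(1)] ballW(3)[of z] by simp
  qed
  have Xch: "Xp \<in> ch" "Yp \<in> ch" by (auto simp: ch_def Xp_def Yp_def)
  have Ach: "A \<notin> ch" using chlevel[of A] pos by (auto simp: x0_def l.zero)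
  have neX: "Xp \<noteq> A" "Yp \<noteq> A" "Xp \<noteq> B" "Yp \<noteq> C" using Xch Ach notR(1) BR by auto
  note mA = proper_sides_meet[OF tri]
  have XneY: "Xp \<noteq> Yp" using mA Xs neX(1) by auto
  then have XY': "X \<noteq> Y" by (auto simp: Xp_def Yp_def)
  have ch_bd: "ch \<inter> boundary A B C \<subseteq> {Xp, Yp}"
  proof
    fix Z assume Z: "Z \<in> ch \<inter> boundary A B C"
    then obtain z where z: "z \<in> closed_segment X Y" "Z = cinv \<kappa> z" by (auto simp: ch_def)
    have cz: "cmap \<kappa> Z = z" using ballW(3)[of z] chb z by auto
    obtain t where t: "0 \<le> t" "t \<le> 1" "z = (1 - t) *\<^sub>R X + t *\<^sub>R Y" using z(1) by (auto simp: in_segment)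
    have dY: "dist z Y = (1 - t) * dist X Y"
    proof -
      have "z - Y = (1 - t) *\<^sub>R (X - Y)" unfolding t(3) by (simp add: algebra_simps)
      then show ?thesis using t(2) by (simp add: dist_norm)
    qed
    have dX: "dist X z = t * dist X Y"
    proof -
      have "X - z = t *\<^sub>R (X - Y)" unfolding t(3) by (simp add: algebra_simps)
      then show ?thesis using t(1) by (simp add: dist_norm)
    qed
    have dp: "0 < dist X Y" using XY' by simp
    have "Z \<notin> Rest" using notR(1) Z by blast
    moreover have "Z \<in> ?g ` {0..1} \<union> ?h ` {0..1} \<union> seg B C"
      using Z seg_sym[OF U(3,1)] g(5) h(5) by (auto simp: boundary_def)
    ultimately consider s where "s \<in> {0..1}" "s \<notin> {rB / ?LB..1}" "Z = ?g s" | s where "s \<in> {0..1}" "s \<notin> {rC / ?LC..1}" "Z = ?h s"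
      unfolding Rest_def by blast
    then show "Z \<in> {Xp, Yp}"
    proof cases
      case 1
      then have "s * ?LB \<in> {0..rB}" "s * ?LB / ?LB = s" using L by (auto simp: field_simps)
      then have "z \<in> PA" using cz 1(3) level[OF z(1)] unfolding PA_def q_def
        by (intro image_eqI[of _ _ "s * ?LB"]) auto
      then have "dist X Y \<le> (1 - t) * dist X Y" using XY(3)[OF _ XY(2)] dY by metis
      then have "t = 0" using dp t(1) by (simp add: left_diff_distrib mult_le_0_iff)
      then show ?thesis using t(3) z(2) by (simp add: Xp_def)
    next
      case 2
      then have "s * ?LC \<in> {0..rC}" "s * ?LC / ?LC = s" using L by (auto simp: field_simps)
      then have "z \<in> PB" using cz 2(3) level[OF z(1)] unfolding PB_def p_def
        by (intro image_eqI[of _ _ "s * ?LC"]) auto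
      then have "dist X Y \<le> t * dist X Y" using XY(3)[OF XY(1)] dX by metis
      then have "t = 1" using dp t(2) by simp
      then show ?thesis using t(3) z(2) by (simp add: Yp_def)
    qed
  qed
  let ?P1 = "seg Xp A \<union> seg A Yp" and ?P2 = "seg Xp B \<union> seg B C \<union> seg C Yp"
  have sX: "seg Xp A \<subseteq> seg A B" "seg Xp B \<subseteq> seg A B" "seg A Yp \<subseteq> seg A C" "seg C Yp \<subseteq> seg A C"
    using seg_subset[OF U(1,2) Xs(1)] end_in_seg[OF U(1,2)] seg_subset[OF U(1,3) _ Xs(2)] end_in_seg[OF U(1,3)]
    by auto
  have spl: "seg Xp A \<union> seg Xp B = seg A B" "seg Xp A \<inter> seg Xp B = {Xp}"
     "seg A Yp \<union> seg C Yp = seg A C" "seg A Yp \<inter> seg C Yp = {Yp}"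
    using seg_between[OF U(1,2) Xs(1)] seg_between[OF U(1,3) Xs(2)] seg_sym[OF XYU(1) U(1)] seg_sym[OF XYU(2) U(3)]
    by auto
  have mB: "seg A B \<inter> seg B C = {B}" using proper_sides_meet[OF proper_swap[OF tri]] seg_sym[OF U(1,2)] by auto
  have mC: "seg A C \<inter> seg B C = {C}"
    using proper_sides_meet[OF proper_rotate[OF proper_rotate[OF tri]]] seg_sym[OF U(2,3)] seg_sym[OF U(1,3)] by auto
  have ends: "Xp \<in> seg Xp A" "Xp \<in> seg Xp B" "Yp \<in> seg A Yp" "Yp \<in> seg C Yp" "A \<in> seg Xp A" "B \<in> seg Xp B"
    "A \<in> seg A Yp" "C \<in> seg C Yp"
    using end_in_seg XYU U by auto
  have nA: "A \<notin> seg Xp B" "A \<notin> seg C Yp" "B \<notin> seg Xp A" "C \<notin> seg A Yp"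
    using spl(2,4) ends neX by auto
  have a1: "arc_between ?P1 Xp Yp"
    using mA sX neX XYU U by (intro arc_between_join[OF arc_seg arc_seg]) auto
  have a2: "arc_between ?P2 Xp Yp"
  proof (rule arc_between_join[OF arc_between_join[OF arc_seg arc_seg] arc_seg])
    show "seg Xp B \<inter> seg B C \<subseteq> {B}" using mB sX(2) by blast
    have "seg Xp B \<inter> seg C Yp \<subseteq> {}" using mA sX(2,4) nA(1) by auto
    moreover have "seg B C \<inter> seg C Yp \<subseteq> {C}" using mC sX(4) by blast
    ultimately show "(seg Xp B \<union> seg B C) \<inter> seg C Yp \<subseteq> {C}" by blast
  qed (use XYU U neX ne in auto)
  have "arc_between (closed_segment X Y) X Y"
    unfolding arc_between_def using XY' by (intro exI[of _ "linepath X Y"]) (simp add: arc_linepath)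
  then have a3: "arc_between ch Xp Yp" unfolding ch_def Xp_def Yp_def
  proof (rule arc_between_image)
    have "closed_segment X Y \<subseteq> cmap \<kappa> ` cdom \<kappa>" using chb \<rho>(2) by blast
    then show "continuous_on (closed_segment X Y) (cinv \<kappa>)"
      using cinv_continuous[OF k(1)] continuous_on_subset by blast
    show "inj_on (cinv \<kappa>) (closed_segment X Y)"
      using ballW(3) chb by (intro inj_on_inverseI[of _ "cmap \<kappa>"]) auto
  qed
  have bd: "?P1 \<union> ?P2 = boundary A B C"
    unfolding boundary_def using spl(1,3) seg_sym[OF U(3,1)] by blast
  have i12: "?P1 \<inter> ?P2 = {Xp, Yp}"
  proof -
    have 1: "seg Xp A \<inter> seg B C = {}" using mB sX(1) nA(3) by auto
    have 2: "seg Xp A \<inter> seg C Yp = {}"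
    proof -
      have False if "Z \<in> seg Xp A" "Z \<in> seg C Yp" for Z
        using that mA sX(1,4) nA(2) by (cases "Z = A") auto
      then show ?thesis by blast
    qed
    have 3: "seg A Yp \<inter> seg Xp B = {}"
    proof -
      have False if "Z \<in> seg A Yp" "Z \<in> seg Xp B" for Z
        using that mA sX(2,3) nA(1) by (cases "Z = A") auto
      then show ?thesis by blast
    qed
    have 4: "seg A Yp \<inter> seg B C = {}"
    proof -
      have False if "Z \<in> seg A Yp" "Z \<in> seg B C" for Z
        using that mC sX(3) nA(4) by (cases "Z = C") auto
      then show ?thesis by blast
    qed
    have "?P1 \<inter> ?P2 = (seg Xp A \<inter> seg Xp B) \<union> (seg Xp A \<inter> seg B C) \<union> (seg Xp A \<inter> seg C Yp) \<union>
        (seg A Yp \<inter> seg Xp B) \<union> (seg A Yp \<inter> seg B C) \<union> (seg A Yp \<inter> seg C Yp)" by blast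
    then show ?thesis unfolding 1 2 3 4 spl(2,4) by auto
  qed
  have i1: "?P1 \<inter> ch = {Xp, Yp}" and i2: "?P2 \<inter> ch = {Xp, Yp}"
    using ch_bd bd Xch ends by blast+
  have sub: "?P1 \<subseteq> U" "?P2 \<subseteq> U" "ch \<subseteq> U" using seg_U U XYU notR(2) by auto
  have cP: "compact ?P1" "compact ?P2" "compact ch" using arc_between_endless(1) a1 a2 a3 by blast+
  have "A \<notin> ins (?P2 \<union> ch)"
  proof
    assume "A \<in> ins (?P2 \<union> ch)"
    then obtain t where t: "1 < t" "\<eta> ` {0..t} \<subseteq> U" "\<eta> t \<in> ?P2 \<union> ch"
      using ins_exit[OF U(2) _ _ _ _ \<eta>] cP sub ne by (metis Un_least compact_Un)
    define Z where "Z = \<eta> t"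
    have Z: "A \<in> seg B Z" "Z \<noteq> B" "ds A Z = (t - 1) * ds B A"
      using extension_seg[OF U(2,1) _ \<eta> t(1,2)] ne by (auto simp: Z_def)
    have ZU: "Z \<in> U" using t by (auto simp: Z_def)
    have ZA: "Z \<noteq> A" using Z(3) t(1) L LBA by auto
    consider "Z \<in> seg Xp B" | "Z \<in> seg B C" | "Z \<in> seg C Yp" | "Z \<in> ch" using t(3) by (auto simp: Z_def)
    then show False
    proof cases
      case 1
      then have "seg B Z \<subseteq> seg Xp B" using seg_subset[OF XYU(1) U(2)] ends(6) by blast
      then show False using Z(1) nA(1) by blast
    next
      case 2
      then have "seg B Z \<subseteq> seg B C" using seg_subset[OF U(2,3)] end_in_seg(1)[OF U(2,3)] by blast
      then show False using Z(1) proper_not_in_side[OF tri] by blast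
    next
      case 3
      \<comment> \<open>Beyond \<open>A\<close> the extension points away from \<open>B\<close>;
        meeting side \<open>AC\<close> there would make the angle at \<open>A\<close> equal to
        pi.\<close>
      then have "Z \<in> seg A C" using sX(4) by blast
      then have "angle M U B A Z = angle M U B A C"
        using ZA ne end_in_seg(2)[OF U(1,2)] by (intro angle_sub U) auto
      moreover have "angle M U B A Z = pi" using angle_opposite[OF U(2) ZU Z(1)] ZA ne by auto
      ultimately show False using tri angle_sym[OF U(1)] by (auto simp: proper_triangle_def)
    next
      case 4
      \<comment> \<open>A chord point is so near \<open>A\<close> that it is reached before time
        \<open>1 + \<tau>\<close>, where \<open>l\<close> is negative; on the chord \<open>l\<close>
        is positive.\<close>
      have "(t - 1) * ds B A < \<tau> * ds B A" using notR(3)[OF 4] Z(3) ds_sym[OF ZU U(1)] by simp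
      then have "t < 1 + \<tau>" using L LBA by (simp add: mult_less_cancel_right)
      then show False using \<tau>(2)[OF t(1)] chlevel[OF 4] pos by (simp add: Z_def)
    qed
  qed
  moreover have "B \<notin> ins (?P1 \<union> ch)"
  proof
    assume "B \<in> ins (?P1 \<union> ch)"
    then obtain Z where Z: "Z \<in> ?P1 \<union> ch" "Z \<noteq> A" "B \<in> seg A Z"
      using ins_exit_seg[OF U(1), of B "?P1 \<union> ch"] cP sub ne by (metis Un_least compact_Un)
    have ZU: "Z \<in> U" using Z(1) sub by blast
    consider "Z \<in> seg Xp A" | "Z \<in> seg A Yp" | "Z \<in> ch" using Z(1) by auto
    then show False
    proof cases
      case 1
      then have "seg A Z \<subseteq> seg Xp A" using seg_subset[OF XYU(1) U(1)] ends(5) by blast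
      then show False using Z(3) nA(3) by blast
    next
      case 2
      then have "Z \<in> seg A C" using sX(3) by blast
      then have "seg A Z \<subseteq> seg A C" using seg_subset[OF U(1,3)] end_in_seg(1)[OF U(1,3)] by blast
      then show False using Z(3) proper_not_in_side[OF proper_swap[OF tri]] by blast
    next
      case 3
      \<comment> \<open>\<open>B\<close> lies between \<open>A\<close> and \<open>Z\<close>, so
        \<open>Z\<close> is at least as far from \<open>A\<close> as \<open>B\<close>, whereas chord
        points are nearer.\<close>
      have AZ: "A \<noteq> Z" using Z(2) by simp
      note gz = geod_param[OF U(1) ZU AZ]
      obtain s where s: "s \<in> {0..1}" "B = geod M U A Z s" using Z(3) gz(5) by auto
      have "ds (geod M U A Z 0) (geod M U A Z s) = \<bar>s - 0\<bar> * curve_length M (geod M U A Z)"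
        by (rule ds_sub[OF gz(1,2)]) (use s gz(3) ne in auto)
      then have "ds A B = s * ds A Z" using gz(3,7) s by simp
      also have "\<dots> \<le> 1 * ds A Z" using s ds_nonneg[OF U(1) ZU] by (intro mult_right_mono) auto
      finally show False using notR(4)[OF 3] ds_sym[OF ZU U(1)] by simp
    qed
  qed
  moreover have "A \<in> ?P1 - {Xp, Yp}" "B \<in> ?P2 - {Xp, Yp}"
    using ends neX Xs(2) proper_not_in_side[OF proper_swap[OF tri]] by auto
  ultimately have inside: "ch - {Xp, Yp} \<subseteq> ins (boundary A B C)"
    using theta_U[OF a1 a2 a3 sub i12 i1 i2] unfolding bd by (meson subsetD)
  \<comment> \<open>The chord ends are near \<open>\<epsilon> *\<^sub>R ?u\<close> and
    \<open>\<epsilon> *\<^sub>R ?v\<close> from \<open>x0\<close>, so the midpoint approximates the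
    required direction, and being no end point it lies inside.\<close>
  define z where "z = midpoint X Y"
  have zs: "z \<in> closed_segment X Y" "z \<noteq> X" "z \<noteq> Y" using XY' by (auto simp: z_def)
  have cz: "cmap \<kappa> (cinv \<kappa> z) = z" "cinv \<kappa> z \<in> cdom \<kappa>" using ballW[of z] zs(1) chb by auto
  have "cinv \<kappa> z \<noteq> Xp" "cinv \<kappa> z \<noteq> Yp"
    using zs cz(1) ballW(3) XYb by (metis Xp_def, metis Yp_def)
  then have zin: "cinv \<kappa> z \<in> ins (boundary A B C)" using inside zs(1) by (auto simp: ch_def)
  have "z - x0 - (\<epsilon>/2) *\<^sub>R (?u + ?v) = (1/2) *\<^sub>R ((X - x0 - \<epsilon> *\<^sub>R ?u) + (Y - x0 - \<epsilon> *\<^sub>R ?v))"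
    by (simp add: z_def midpoint_def vec_eq_iff field_simps)
  also have "norm \<dots> \<le> (1/2) * (e * \<epsilon> + e * \<epsilon>)"
    using norm_triangle_le[OF add_mono[OF Xn Yn]] by simp
  also have "\<dots> = \<delta> * (\<epsilon>/2)" by (simp add: e_def)
  finally have "norm (z - x0 - (\<epsilon>/2) *\<^sub>R (?u + ?v)) \<le> \<delta> * (\<epsilon>/2)" .
  then show "\<exists>\<epsilon> Z. 0 < \<epsilon> \<and> \<epsilon> < \<delta> \<and> Z \<in> ins (boundary A B C) \<and> Z \<in> cdom (chart_at M A) \<and>
      norm (cmap (chart_at M A) Z - cmap (chart_at M A) A - \<epsilon> *\<^sub>R (?u + ?v)) \<le> \<delta> * \<epsilon>"
    unfolding \<kappa>_def[symmetric] x0_def[symmetric]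
    using \<epsilon> zin cz by (intro exI[of _ "\<epsilon>/2"] exI[of _ "cinv \<kappa> z"]) auto
qed

end


section \<open>The balanced point\<close>

lemma arccos_neg_half: "arccos (- 1/2) = 2 * pi / 3"
  using arccos_cos[of "2 * pi / 3"] by (simp add: cos_120)

context geodesic_disk_coords
begin

text \<open>\<open>arccos\<close> is decreasing, so an inner product of at most -1/2 means an angle
  of at least 2 pi / 3.\<close>

lemma minimum_not_at_vertex:
  assumes tri: "proper_triangle A B C" and angle: "angle M U C A B < 2 * pi / 3"
    and D: "ins (boundary A B C) \<subseteq> D"
  shows "\<not> (\<forall>Z\<in>D. ds A A + ds A B + ds A C \<le> ds Z A + ds Z B + ds Z C)"
proof
  assume min: "\<forall>Z\<in>D. ds A A + ds A B + ds A C \<le> ds Z A + ds Z B + ds Z C"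
  have U: "A \<in> U" "B \<in> U" "C \<in> U" and ne: "A \<noteq> B" "A \<noteq> C" using tri by (auto simp: proper_triangle_def)
  have "inner_at M A (udir A B) (udir A C) \<le> - 1/2"
    using min by (intro critical_vertex[OF U ne _ tangent_to_mono[OF vertex_tangent[OF tri] D]]) auto
  then have "arccos (- 1/2) \<le> arccos (inner_at M A (udir A B) (udir A C))"
    using udir_inner_bound[OF U(1,2,3) ne] by (subst arccos_le_mono) auto
  then show False
    using angle angle_udir[OF U(1,2,3) ne] angle_sym[OF U(1), of B C] unfolding arccos_neg_half by simp
qed

text \<open>On the open side the unit vectors towards \<open>A\<close> and \<open>B\<close> cancel.
  The remaining sum is the unit vector towards \<open>C\<close>, which is realized by the cevian
  inside the triangle and is not zero.\<close>

lemma minimum_not_on_side: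
  assumes tri: "proper_triangle A B C" and T: "T \<in> seg A B" "T \<noteq> A" "T \<noteq> B"
    and D: "ins (boundary A B C) \<subseteq> D"
  shows "\<not> (\<forall>Z\<in>D. ds T A + ds T B + ds T C \<le> ds Z A + ds Z B + ds Z C)"
proof
  assume min: "\<forall>Z\<in>D. ds T A + ds T B + ds T C \<le> ds Z A + ds Z B + ds Z C"
  have U: "A \<in> U" "B \<in> U" "C \<in> U" using tri by (auto simp: proper_triangle_def)
  have TU: "T \<in> U" using T U seg_U by blast
  have TC: "T \<noteq> C" by (rule cevian_avoids(3)[OF tri T])
  obtain k where k: "0 < k" "tang T A = - k *\<^sub>R tang T B" using tang_opposite[OF U(1,2) T] by blast
  have dA: "ds T A = k * ds T B"
    using norm_at_tang[OF TU U(1) T(2)] norm_at_tang[OF TU U(2) T(3)] k norm_at_scale[of T "-k" "tang T B"] by simp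
  have "udir T A = - udir T B"
    unfolding udir_def k(2) dA using k(1) by simp
  then have s: "udir T A + udir T B + udir T C = udir T C" by simp
  have "tangent_to D T (udir T C)"
    using cevian_inside[OF tri T] D unfolding boundary_def
    by (intro tangent_to_mono[OF tangent_to_geodesic[OF TU U(3) TC]]) blast
  then have "udir T C = 0"
    using critical_point[OF TU U T(2,3) TC, of D] min unfolding s by blast
  then show False using udir_unit(2)[OF TU U(3) TC] by (simp add: inner_at_def)
qed

text \<open>The third vector is minus the sum of the other two; comparing squared norms, 1 is 2 plus
  twice their inner product, which is therefore -1/2.\<close>

lemma angle_of_sum_zero:
  assumes U: "T \<in> U" "A \<in> U" "B \<in> U" "C \<in> U" and ne: "T \<noteq> A" "T \<noteq> B" "T \<noteq> C"
    and s: "udir T A + udir T B + udir T C = 0"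
  shows "angle M U A T B = 2 * pi / 3"
proof -
  have "udir T C = - (udir T A + udir T B)" using s by (metis add.commute minus_unique)
  then have "inner_at M T (udir T A + udir T B) (udir T A + udir T B) = 1"
    using udir_unit(2)[OF U(1,4) ne(3)] by (simp add: inner_at_linear)
  then have "inner_at M T (udir T A) (udir T B) = - 1/2"
    using udir_unit(2)[OF U(1,2) ne(1)] udir_unit(2)[OF U(1,3) ne(2)] inner_at_sym[OF U(1), of "udir T B" "udir T A"]
    by (simp add: inner_at_linear)
  then show ?thesis using angle_udir[OF U(1,2,3) ne(1,2)] arccos_neg_half by simp
qed

lemma triangle_sides_boundary:
  assumes "proper_triangle A B C"
  shows "triangle_sides M U A B C = boundary A B C"
  using assms by (auto simp: triangle_sides_def boundary_def seg_def proper_triangle_def)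

text \<open>The component of \<open>X\<close> maps to a connected set that misses the loop, so it
  stays inside; the compact set \<open>ins ?S \<union> ?S\<close> is the witness required by
  \<open>triangle_interior\<close>.\<close>

lemma ins_subset_triangle_interior:
  assumes tri: "proper_triangle A B C"
  shows "ins (boundary A B C) \<subseteq> triangle_interior M U A B C"
proof
  let ?S = "boundary A B C"
  fix X assume X: "X \<in> ins ?S"
  have SU: "?S \<subseteq> U" by (rule boundary_U[OF tri])
  have XU: "X \<in> U - ?S" using X ins_U ins_disjoint[OF SU] by blast
  let ?K = "connected_component_set (U - ?S) X"
  have K: "?K \<subseteq> U - ?S" by (rule connected_component_subset)
  have "connected (\<psi> ` ?K)"
    using K continuous_on_subset[OF psi(1)] by (intro connected_continuous_image) (auto intro: connected_connected_component)
  moreover have "\<psi> ` ?K \<inter> \<psi> ` ?S = {}"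
    using inj_on_image_Int[OF psi_inj, of ?K ?S] K SU by auto
  moreover have "\<psi> X \<in> \<psi> ` ?K" using XU by (simp add: connected_component_refl)
  ultimately have "\<psi> ` ?K \<subseteq> inside (\<psi> ` ?S)"
    using X by (intro connected_inside) (auto simp: ins_def)
  then have "?K \<subseteq> ins ?S \<union> ?S" using K by (auto simp: ins_def)
  then show "X \<in> triangle_interior M U A B C"
    unfolding triangle_interior_def triangle_sides_boundary[OF tri]
    using XU ins_compact[OF boundary_compact[OF tri] SU] ins_U SU by blast
qed

lemma balanced_point_exists:
  assumes tri: "proper_triangle A B C"
    and angles: "angle M U C A B < 2 * pi / 3" "angle M U A B C < 2 * pi / 3" "angle M U B C A < 2 * pi / 3"
  shows "\<exists>T. balanced_point M U A B C T"
proof -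
  let ?S = "boundary A B C"
  define D where "D = ins ?S \<union> ?S"
  have U: "A \<in> U" "B \<in> U" "C \<in> U" using tri by (auto simp: proper_triangle_def)
  have SU: "?S \<subseteq> U" by (rule boundary_U[OF tri])
  have cD: "compact D" unfolding D_def by (rule ins_compact[OF boundary_compact[OF tri] SU])
  have DU: "D \<subseteq> U" using ins_U SU by (auto simp: D_def)
  have inS: "A \<in> ?S" "B \<in> ?S" "C \<in> ?S" using end_in_seg U by (auto simp: boundary_def)
  have "continuous_on D (\<lambda>Z. ds Z A + ds Z B + ds Z C)"
    by (intro continuous_on_add continuous_on_subset[OF ds_continuous DU] U)
  then obtain T where T: "T \<in> D" and min: "\<forall>Z\<in>D. ds T A + ds T B + ds T C \<le> ds Z A + ds Z B + ds Z C"
    using continuous_attains_inf[OF cD] inS by (auto simp: D_def)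
  note tri2 = proper_rotate[OF tri]
  note tri3 = proper_rotate[OF tri2]
  have S: "boundary B C A = ?S" "boundary C A B = ?S" using boundary_rotate by auto
  have insD: "ins ?S \<subseteq> D" by (auto simp: D_def)
  have "T \<notin> ?S"
  proof
    assume TS: "T \<in> ?S"
    \<comment> \<open>Rotating the triangle reduces every vertex to \<open>A\<close> and every side
      to \<open>AB\<close>; the boundary and the sum of distances are unchanged.\<close>
    have "T \<noteq> A" using minimum_not_at_vertex[OF tri angles(1) insD] min by auto
    moreover have "T \<noteq> B"
      using minimum_not_at_vertex[OF tri2 angles(2), of D] insD min unfolding S by (auto simp: add_ac)
    moreover have "T \<noteq> C"
      using minimum_not_at_vertex[OF tri3 angles(3), of D] insD min unfolding S by (auto simp: add_ac)
    ultimately show False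
      using TS minimum_not_on_side[OF tri, of T D] minimum_not_on_side[OF tri2, of T D] minimum_not_on_side[OF tri3, of T D]
        insD min unfolding S by (auto simp: boundary_def add_ac)
  qed
  then have Ti: "T \<in> ins ?S" using T by (auto simp: D_def)
  then have TU: "T \<in> U" using ins_U by blast
  have ne: "T \<noteq> A" "T \<noteq> B" "T \<noteq> C" using \<open>T \<notin> ?S\<close> inS by auto
  have "tangent_to D T (udir T A + udir T B + udir T C)"
    by (rule tangent_to_mono[OF tangent_to_open[OF ins_open[OF boundary_compact[OF tri] SU] Ti TU] insD])
  then have s: "udir T A + udir T B + udir T C = 0"
    using critical_point[OF TU U ne, of D] min by blast
  have "balanced_point M U A B C T" unfolding balanced_point_def
  proof (intro conjI)
    show "T \<in> triangle_interior M U A B C" using ins_subset_triangle_interior[OF tri] Ti by blast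
    show "angle M U A T B = 2 * pi / 3" by (rule angle_of_sum_zero[OF TU U ne s])
    show "angle M U B T C = 2 * pi / 3"
      by (rule angle_of_sum_zero[OF TU U(2,3,1) ne(2,3,1)]) (use s in \<open>simp add: add_ac\<close>)
    show "angle M U C T A = 2 * pi / 3"
      by (rule angle_of_sum_zero[OF TU U(3,1,2) ne(3,1,2)]) (use s in \<open>simp add: add_ac\<close>)
  qed
  then show ?thesis by blast
qed

end

theorem corollary1p2:
  fixes M :: "'a::{t2_space,second_countable_topology} surface"
    and N U :: "'a set" and A B C :: 'a and R :: real
  assumes "riemannian_surface M" and "complete_surface M"
    and "N \<subseteq> carrier M" and "compact (carrier M \<inter> closure N)"
    and "R > 0" and "\<forall>p\<in>N. gaussian_curvature M p \<le> 1 / R\<^sup>2"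
    and "uniquely_geodesic_disk M U" and "U \<subseteq> N"
    and "A \<in> U" and "B \<in> U" and "C \<in> U" and "A \<noteq> B" and "B \<noteq> C" and "C \<noteq> A"
    and "angle M U C A B < 2 * pi / 3"
    and "angle M U A B C < 2 * pi / 3"
    and "angle M U B C A < 2 * pi / 3"
    and "\<forall>X\<in>triangle_domain M U A B C. \<forall>Y\<in>triangle_domain M U A B C. gdist M X Y < R * pi / 2"
  shows "\<exists>T. balanced_point M U A B C T"
proof -
  interpret geodesic_disk M U by unfold_locales fact+
  \<comment> \<open>The disk is modelled on \<open>real^2\<close>, whereas the theta curve argument
    takes place in \<open>complex\<close>.\<close>
  have "(UNIV :: (real^2) set) homeomorphic (UNIV :: complex set)"
    by (simp add: homeomorphic_UNIV_UNIV)
  then have "U homeomorphic (UNIV :: complex set)"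
    using assms(7) homeomorphic_trans[OF _ homeomorphic_trans[OF homeomorphic_ball01_UNIV]]
    unfolding uniquely_geodesic_disk_def by blast
  then obtain \<psi> \<psi>i where "homeomorphism U (UNIV :: complex set) \<psi> \<psi>i"
    unfolding homeomorphic_def by blast
  then interpret geodesic_disk_coords M U \<psi> \<psi>i by unfold_locales
  have "2 * pi / 3 < pi" by simp
  then have "proper_triangle A B C"
    unfolding proper_triangle_def using assms by auto
  then show ?thesis using balanced_point_exists assms(15-17) by blast
qed

end
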